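(* Let $k\ge 1$. Let $G$ be a connected graph on $n$ vertices which does not contain a path on $\min\{n,2k+3\}$ vertices. If every vertex of $G$, except for at most one vertex, has degree at least $k$, then $G$ is a subgraph of one of the following graphs: (i) $H(2k+2,2k+1,k)$, or $H(n,2k+2,k)$ with $n\ge 2k+3$; (ii) $K_1+(tK_k\cup K_{k+1}\cup K_1)$ with $t\ge 1$; (iii) the graph obtained from vertex-disjoint copies of $K_1+sK_k$ and $K_1+(tK_k\cup K_1)$, with $s\ge 1$, $t\ge 1$, by adding an edge joining their centers (the center of $K_1+sK_k$ is the $K_1$-vertex, of degree $sk$; the center of $K_1+(tK_k\cup K_1)$ is the first $K_1$-vertex, of degree $tk+1$); (iv) when $k=2$: $K_1+M_t$ with $t\ge 6$, or $K_1+(S_s\cup M_t)$ with $s+t\ge 6$; when $k=3$: $K_2+M_t$ with $t\ge 7$.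
   Context: Graphs are finite and simple. For graphs $G,H$, $G\cup H$ is their vertex-disjoint union, $G+H$ is obtained from $G\cup H$ by joining every vertex of $G$ to every vertex of $H$, and $kH$ is the disjoint union of $k$ copies of $H$. $K_m$ is the complete graph on $m$ vertices. $H(n,\ell,a)$: the $n$-vertex graph with vertex partition $A\cup B\cup C$, $|A|=a$, $|B|=n-\ell+a$, $|C|=\ell-2a$, whose edges are all pairs between $A$ and $B$ and all pairs inside $A\cup C$. $S_s=K_{1,s-1}$ is the star on $s$ vertices; $M_t$ is the graph on $t$ vertices consisting of a matching with $\lfloor t/2\rfloor$ edges plus one isolated vertex if $t$ is odd. *)

theory Defs
  imports "Graph_Theory.Graph_Theory"
begin

text \<open>
  A finite simple graph is a \<^typ>\<open>'a pair_pre_digraph\<close> satisfying \<^const>\<open>pair_graph\<close>: every edge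
  \<open>uv\<close> is represented by the two arcs \<open>(u, v)\<close> and \<open>(v, u)\<close>, so the degree of a vertex is its
  \<^const>\<open>out_degree\<close>.
\<close>

definition complete_graph :: "nat \<Rightarrow> nat pair_pre_digraph" where
  "complete_graph m = \<lparr> pverts = {..<m}, parcs = {(u, v). u < m \<and> v < m \<and> u \<noteq> v} \<rparr>"

definition graph_union ::
  "'a pair_pre_digraph \<Rightarrow> 'b pair_pre_digraph \<Rightarrow> ('a + 'b) pair_pre_digraph" where
  "graph_union G H = \<lparr>
     pverts = Inl ` pverts G \<union> Inr ` pverts H,
     parcs = map_prod Inl Inl ` parcs G \<union> map_prod Inr Inr ` parcs H \<rparr>"

definition graph_join ::
  "'a pair_pre_digraph \<Rightarrow> 'b pair_pre_digraph \<Rightarrow> ('a + 'b) pair_pre_digraph" where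
  "graph_join G H = \<lparr>
     pverts = pverts (graph_union G H),
     parcs = parcs (graph_union G H)
       \<union> Inl ` pverts G \<times> Inr ` pverts H \<union> Inr ` pverts H \<times> Inl ` pverts G \<rparr>"

definition copies :: "nat \<Rightarrow> 'a pair_pre_digraph \<Rightarrow> (nat \<times> 'a) pair_pre_digraph" where
  "copies k H = \<lparr>
     pverts = {..<k} \<times> pverts H,
     parcs = {((i, u), (i, v)) | i u v. i < k \<and> (u, v) \<in> parcs H} \<rparr>"

definition add_edge :: "'a \<Rightarrow> 'a \<Rightarrow> 'a pair_pre_digraph \<Rightarrow> 'a pair_pre_digraph" where
  "add_edge u v G = \<lparr> pverts = pverts G \<union> {u, v}, parcs = parcs G \<union> {(u, v), (v, u)} \<rparr>"

text \<open>
  The graph \<open>H(n, l, a)\<close>. When \<open>2 * a \<le> l\<close> and \<open>l \<le> n + a\<close> the vertex set \<open>{..<n}\<close> is split into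
  consecutive intervals \<open>A\<close>, \<open>C\<close>, \<open>B\<close> of sizes \<open>a\<close>, \<open>l - 2 * a\<close> and \<open>n - l + a\<close>.
\<close>

definition H_graph :: "nat \<Rightarrow> nat \<Rightarrow> nat \<Rightarrow> nat pair_pre_digraph" where
  "H_graph n l a = (let A = {..<a}; C = {a..<l - a}; B = {l - a..<n} in \<lparr>
     pverts = A \<union> B \<union> C,
     parcs = A \<times> B \<union> B \<times> A \<union> {(u, v). u \<in> A \<union> C \<and> v \<in> A \<union> C \<and> u \<noteq> v} \<rparr>)"

text \<open>The star \<open>S\<^sub>s = K\<^bsub>1,s-1\<^esub>\<close> on \<open>s \<ge> 1\<close> vertices, with center \<open>0\<close>.\<close>

definition star_graph :: "nat \<Rightarrow> nat pair_pre_digraph" where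
  "star_graph s = \<lparr> pverts = {..<s}, parcs = {0} \<times> {1..<s} \<union> {1..<s} \<times> {0} \<rparr>"

text \<open>The edges of \<open>M\<^sub>t\<close> are the pairs \<open>{2 * i, 2 * i + 1}\<close> with \<open>2 * i + 1 < t\<close>.\<close>

definition matching_graph :: "nat \<Rightarrow> nat pair_pre_digraph" where
  "matching_graph t = \<lparr> pverts = {..<t},
     parcs = {(u, v). u < t \<and> v < t \<and> u \<noteq> v \<and> u div 2 = v div 2} \<rparr>"

text \<open>
  \<open>K\<^sub>1 + s K\<^sub>k\<close> and \<open>K\<^sub>1 + (t K\<^sub>k \<union> K\<^sub>1)\<close> with their centers joined by an edge; both centers are the
  vertex \<open>0\<close> of the left operand of the respective join.
\<close>

definition linked_graph ::
  "nat \<Rightarrow> nat \<Rightarrow> nat \<Rightarrow> ((nat + nat \<times> nat) + (nat + (nat \<times> nat + nat))) pair_pre_digraph" where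
  "linked_graph k s t = add_edge (Inl (Inl 0)) (Inr (Inl 0))
     (graph_union
       (graph_join (complete_graph 1) (copies s (complete_graph k)))
       (graph_join (complete_graph 1)
         (graph_union (copies t (complete_graph k)) (complete_graph 1))))"

text \<open>``\<open>G\<close> is a subgraph of \<open>H\<close>'' for graphs given up to isomorphism.\<close>

definition is_subgraph_of :: "'a pair_pre_digraph \<Rightarrow> 'b pair_pre_digraph \<Rightarrow> bool" where
  "is_subgraph_of G H \<longleftrightarrow>
     (\<exists>H'. subgraph H' (with_proj H) \<and> digraph_iso (with_proj G) H')"

definition contains_path_on :: "'a pair_pre_digraph \<Rightarrow> nat \<Rightarrow> bool" where
  "contains_path_on G m \<longleftrightarrow> (\<exists>p. vpath p (with_proj G) \<and> length p = m)"


lemma pair_graphI':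
  assumes "finite (pverts G)"
    and "\<And>u v. (u, v) \<in> parcs G \<Longrightarrow> u \<in> pverts G \<and> u \<noteq> v \<and> (v, u) \<in> parcs G"
  shows "pair_graph G"
proof -
  have "parcs G \<subseteq> pverts G \<times> pverts G"
    by (intro subrelI SigmaI) (auto dest!: assms(2) intro: assms(2)[THEN conjunct1])
  then have "finite (parcs G)" using assms(1) by (meson finite_SigmaI finite_subset)
  moreover have "symmetric (with_proj G)"
    using assms(2) by (simp add: symmetric_def sym_def)
  moreover have "fst e \<in> pverts G" "snd e \<in> pverts G" "fst e \<noteq> snd e" if "e \<in> parcs G" for e
    using assms(2)[of "fst e" "snd e"] assms(2)[of "snd e" "fst e"] that by simp_all
  ultimately show ?thesis
    using assms(1) by unfold_locales
qed

lemma pair_graphD':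
  assumes "pair_graph G"
  shows "finite (pverts G)"
    and "(u, v) \<in> parcs G \<Longrightarrow> u \<in> pverts G \<and> v \<in> pverts G \<and> u \<noteq> v \<and> (v, u) \<in> parcs G"
proof -
  interpret pair_graph G by fact
  show "finite (pverts G)" by simp
  show "(u, v) \<in> parcs G \<Longrightarrow> u \<in> pverts G \<and> v \<in> pverts G \<and> u \<noteq> v \<and> (v, u) \<in> parcs G"
    by (auto intro: arcs_symmetric dest: in_arcsD1 in_arcsD2 no_loops')
qed

lemma pair_graph_complete_graph: "pair_graph (complete_graph m)"
  by (rule pair_graphI') (auto simp: complete_graph_def)

lemma complete_digraph_complete_graph: "complete_digraph m (with_proj (complete_graph m))"
  unfolding complete_digraph_def
  using pair_graph.pair_graphD_graph[OF pair_graph_complete_graph]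
  by (auto simp: complete_graph_def)

lemma pair_graph_graph_union:
  assumes "pair_graph G" "pair_graph H"
  shows "pair_graph (graph_union G H)"
proof (rule pair_graphI')
  note G = pair_graphD'[OF assms(1)] and H = pair_graphD'[OF assms(2)]
  show "finite (pverts (graph_union G H))" using G(1) H(1) by (simp add: graph_union_def)
  fix u v assume "(u, v) \<in> parcs (graph_union G H)"
  then consider (l) x y where "u = Inl x" "v = Inl y" "(x, y) \<in> parcs G"
    | (r) x y where "u = Inr x" "v = Inr y" "(x, y) \<in> parcs H"
    by (auto simp: graph_union_def)
  then show "u \<in> pverts (graph_union G H) \<and> u \<noteq> v \<and> (v, u) \<in> parcs (graph_union G H)"
  proof cases
    case l
    with G(2)[of x y] show ?thesis by (force simp: graph_union_def)
  next
    case r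
    with H(2)[of x y] show ?thesis by (force simp: graph_union_def)
  qed
qed

lemma pair_graph_graph_join:
  assumes "pair_graph G" "pair_graph H"
  shows "pair_graph (graph_join G H)"
proof (rule pair_graphI')
  note U = pair_graphD'[OF pair_graph_graph_union[OF assms]]
  show "finite (pverts (graph_join G H))" using U(1) by (simp add: graph_join_def)
  fix u v assume "(u, v) \<in> parcs (graph_join G H)"
  then show "u \<in> pverts (graph_join G H) \<and> u \<noteq> v \<and> (v, u) \<in> parcs (graph_join G H)"
    using U(2)[of u v] by (auto simp: graph_join_def graph_union_def)
qed

lemma pair_graph_copies:
  assumes "pair_graph H"
  shows "pair_graph (copies k H)"
proof (rule pair_graphI')
  show "finite (pverts (copies k H))" using pair_graphD'(1)[OF assms] by (simp add: copies_def)
  fix u v assume "(u, v) \<in> parcs (copies k H)"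
  then obtain i x y where "u = (i, x)" "v = (i, y)" "i < k" "(x, y) \<in> parcs H"
    by (auto simp: copies_def)
  with pair_graphD'(2)[OF assms, of x y]
  show "u \<in> pverts (copies k H) \<and> u \<noteq> v \<and> (v, u) \<in> parcs (copies k H)"
    by (simp add: copies_def)
qed

lemma pair_graph_add_edge:
  assumes "pair_graph G" "u \<noteq> v"
  shows "pair_graph (add_edge u v G)"
proof (rule pair_graphI')
  show "finite (pverts (add_edge u v G))"
    using pair_graphD'(1)[OF assms(1)] by (simp add: add_edge_def)
  fix x y assume "(x, y) \<in> parcs (add_edge u v G)"
  then show "x \<in> pverts (add_edge u v G) \<and> x \<noteq> y \<and> (y, x) \<in> parcs (add_edge u v G)"
    using pair_graphD'(2)[OF assms(1), of x y] assms(2) by (auto simp: add_edge_def)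
qed

lemma pair_graph_H_graph: "pair_graph (H_graph n l a)"
  if "2 * a \<le> l" "l \<le> n + a"
  using that by (intro pair_graphI') (auto simp: H_graph_def Let_def)

lemma pverts_H_graph: "pverts (H_graph n l a) = {..<n}" if "2 * a \<le> l" "l \<le> n + a"
  using that by (auto simp: H_graph_def Let_def)

lemma pair_graph_star_graph: "pair_graph (star_graph s)"
  by (rule pair_graphI') (auto simp: star_graph_def)

lemma complete_bipartite_star_graph:
  assumes "s \<ge> 1"
  shows "complete_bipartite_digraph 1 (s - 1) (with_proj (star_graph s))"
  unfolding complete_bipartite_digraph_def
proof (intro conjI exI)
  show "graph (with_proj (star_graph s))"
    by (rule pair_graph.pair_graphD_graph[OF pair_graph_star_graph])
  show "verts (with_proj (star_graph s)) = {0} \<union> {1..<s}"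
    using assms by (auto simp: star_graph_def)
qed (simp_all add: star_graph_def)

lemma pair_graph_matching_graph: "pair_graph (matching_graph t)"
  by (rule pair_graphI') (auto simp: matching_graph_def)

lemma pair_graph_linked_graph: "pair_graph (linked_graph k s t)"
  unfolding linked_graph_def
  by (intro pair_graph_add_edge pair_graph_graph_union pair_graph_graph_join pair_graph_copies
      pair_graph_complete_graph) simp

lemma is_subgraph_of_iff:
  assumes "pair_wf_digraph G" "pair_wf_digraph H"
  shows "is_subgraph_of G H \<longleftrightarrow>
    (\<exists>f. inj_on f (pverts G) \<and> f ` pverts G \<subseteq> pverts H \<and>
      (\<forall>u v. (u, v) \<in> parcs G \<longrightarrow> (f u, f v) \<in> parcs H))" (is "_ \<longleftrightarrow> ?R")
proof -
  have wf: "wf_digraph (with_proj G)" "wf_digraph (with_proj H)"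
    using assms by (simp_all add: wf_digraph_wp_iff)
  have G: "u \<in> pverts G" "v \<in> pverts G" if "(u, v) \<in> parcs G" for u v
    using assms(1) that by (simp_all add: pair_wf_digraph.in_arcsD1 pair_wf_digraph.in_arcsD2)
  show ?thesis
  proof
    assume "is_subgraph_of G H"
    then obtain h where h: "pre_digraph.digraph_isomorphism (with_proj G) h"
        and sub: "subgraph (app_iso h (with_proj G)) (with_proj H)"
      unfolding is_subgraph_of_def digraph_iso_def by blast
    have ht: "iso_tail h = fst" "iso_head h = snd"
      using sub by (simp_all add: subgraph_def compatible_def)
    let ?f = "iso_verts h"
    have arcs: "(?f u, ?f v) \<in> parcs H" if "(u, v) \<in> parcs G" for u v
    proof -
      have "iso_arcs h (u, v) = (?f u, ?f v)"
        using h that by (auto simp: pre_digraph.digraph_isomorphism_def ht prod_eq_iff)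
      moreover have "iso_arcs h (u, v) \<in> parcs H"
        using sub that by (auto simp: subgraph_def)
      ultimately show ?thesis by simp
    qed
    have "inj_on ?f (pverts G)"
      using pre_digraph.digraph_isomorphism_inj_on_verts[OF h] by simp
    moreover have "?f ` pverts G \<subseteq> pverts H"
      using sub by (simp add: subgraph_def)
    ultimately show ?R using arcs by blast
  next
    assume ?R
    then obtain f where f: "inj_on f (pverts G)" "f ` pverts G \<subseteq> pverts H"
        "\<And>u v. (u, v) \<in> parcs G \<Longrightarrow> (f u, f v) \<in> parcs H"
      by blast
    define h where "h = \<lparr> iso_verts = f, iso_arcs = map_prod f f, iso_head = snd, iso_tail = fst \<rparr>"
    have "inj_on (map_prod f f) (parcs G)"
    proof (rule inj_on_subset)
      show "inj_on (map_prod f f) (pverts G \<times> pverts G)"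
        by (rule map_prod_inj_on) (rule f(1))+
      show "parcs G \<subseteq> pverts G \<times> pverts G" by (intro subrelI SigmaI G)
    qed
    then have iso: "pre_digraph.digraph_isomorphism (with_proj G) h"
      using f(1) wf(1) by (simp add: pre_digraph.digraph_isomorphism_def h_def)
    have "map_prod f f ` parcs G \<subseteq> parcs H" using f(3) by auto
    then have "subgraph (app_iso h (with_proj G)) (with_proj H)"
      using wf_digraph.wf_digraphI_app_iso[OF wf(1) iso] wf(2) f(2)
      by (simp add: subgraph_def h_def compatible_def)
    with iso show "is_subgraph_of G H"
      unfolding is_subgraph_of_def digraph_iso_def by blast
  qed
qed

end

theory Submission
  imports Defs
begin

text \<open>
  Let \<open>m\<close> be the order of a longest path; then \<open>m \<le> 2k + 2\<close> and \<open>m < n\<close>.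

  If there is a cycle \<open>C\<close> of length \<open>m - 1\<close>, the vertices off \<open>C\<close> are independent. One of them has a
  set \<open>A\<close> of at least \<open>k\<close> pairwise non-consecutive neighbours on \<open>C\<close>, and both the successors and
  the predecessors of \<open>A\<close> on \<open>C\<close> are independent, so \<open>|A| = k\<close> and \<open>A\<close> covers all edges but at most
  one: this is (i).

  Otherwise suppose that both ends of some longest path have degree at least \<open>k\<close>. Counting
  neighbours of the two ends along the path, without the crossings that would close a cycle of
  length \<open>m\<close> or \<open>m - 1\<close>, leaves two possibilities. Either a crossing yields a cycle of length \<open>2k\<close>
  with an edge off it, which gives (i) again unless \<open>k\<close> is 2 or 3, where the small cases (iv) appear;
  or the neighbours of one end precede those of the other, and rotating the path at its ends exposes
  a cut vertex, or two adjacent ones, whose removal leaves components of at most \<open>k\<close> vertices (one of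
  them possibly of \<open>k + 1\<close>): this is (ii), (iii), or a star in (iv) for \<open>k = 2\<close>.

  Finally, if no longest path has both ends of degree at least \<open>k\<close>, rotations show that the exceptional
  vertex is a leaf, and the previous analysis applies to the graph without it.
\<close>


section \<open>Paths and cycles\<close>

text \<open>The counting rests on one family of crossings. If the first vertex of a longest path is
  adjacent to position i + d and the last one to position i, reversing the initial segment closes a
  cycle on m + 1 - d vertices. For d = 1, connectedness and m < n turn it into a longer path; d = 2
  is the case of a cycle of length m - 1. So two index sets of size at least k, disjoint even after
  a shift by one, must fit into m - 1 \<le> 2k + 1 places, and the slack is one place: it allows a
  crossing with d = 3, or separated sets with at most one index left over. For d = 3 the cycle has
  length 2k and skips an edge uv. If both ends of such an edge have degree at least k, their common
  neighbours on the cycle are pairwise at distance at least 3, so 3(k - 1) \<le> 2k; this is one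
  source of the sporadic values k = 2 and k = 3. The recurring obstacle is the exceptional vertex,
  because an extremal choice may end in it. Most such arguments therefore supply a second candidate:
  of two distinct vertices one has degree at least k.\<close>

lemma mem_set_nth: "x \<in> set xs \<Longrightarrow> \<exists>i<length xs. x = xs ! i"
  by (auto simp: in_set_conv_nth)

section \<open>Graphs as symmetric relations on a finite set\<close>

locale simple_graph =
  fixes V :: "'a set" and adj :: "'a \<Rightarrow> 'a \<Rightarrow> bool"
  assumes finite_V: "finite V"
    and adj_V: "adj x y \<Longrightarrow> x \<in> V \<and> y \<in> V"
    and adj_irrefl: "\<not> adj x x"
    and adj_sym: "adj x y \<Longrightarrow> adj y x"
begin

definition nbrs :: "'a \<Rightarrow> 'a set" where
  "nbrs x = {y. adj x y}"

definition is_path :: "'a list \<Rightarrow> bool" where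
  "is_path xs \<longleftrightarrow> xs \<noteq> [] \<and> distinct xs \<and> set xs \<subseteq> V \<and> successively adj xs"

definition is_cycle :: "'a list \<Rightarrow> bool" where
  "is_cycle xs \<longleftrightarrow> 3 \<le> length xs \<and> is_path xs \<and> adj (last xs) (hd xs)"

text \<open>Connectedness in cut form, because the arguments use it to find an edge leaving a
  nonempty proper vertex set.\<close>

definition is_connected :: bool where
  "is_connected \<longleftrightarrow> (\<forall>S. S \<subseteq> V \<longrightarrow> S \<noteq> {} \<longrightarrow> S \<noteq> V \<longrightarrow> (\<exists>x\<in>S. \<exists>y\<in>V - S. adj x y))"

lemma adj_commute: "adj x y \<longleftrightarrow> adj y x"
  using adj_sym by blast

lemma adj_neq: "adj x y \<Longrightarrow> x \<noteq> y"
  using adj_irrefl by blast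

lemma mem_nbrs [simp]: "y \<in> nbrs x \<longleftrightarrow> adj x y"
  by (simp add: nbrs_def)

lemma nbrs_subset: "nbrs x \<subseteq> V"
  using adj_V by auto

lemma finite_nbrs [simp]: "finite (nbrs x)"
  using nbrs_subset finite_V by (rule finite_subset)

lemma successively_adj_rev: "successively adj (rev xs) \<longleftrightarrow> successively adj xs"
proof -
  have "(\<lambda>x y. adj y x) = adj" using adj_commute by (intro ext) blast
  then show ?thesis using successively_rev[of adj xs] by (simp only:)
qed

lemma is_path_rev [simp]: "is_path (rev xs) \<longleftrightarrow> is_path xs"
  unfolding is_path_def using successively_adj_rev by (auto simp del: successively_rev)

lemma is_path_append_iff:
  "xs \<noteq> [] \<Longrightarrow> ys \<noteq> [] \<Longrightarrow> is_path (xs @ ys) \<longleftrightarrow>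
     is_path xs \<and> is_path ys \<and> set xs \<inter> set ys = {} \<and> adj (last xs) (hd ys)"
  unfolding is_path_def by (auto simp: successively_append_iff)

lemma is_path_Cons_iff:
  "xs \<noteq> [] \<Longrightarrow> is_path (x # xs) \<longleftrightarrow> is_path xs \<and> x \<notin> set xs \<and> adj x (hd xs)"
  using adj_V[of x "hd xs"] unfolding is_path_def by (auto simp: successively_Cons)

lemma is_path_singleton [simp]: "is_path [x] \<longleftrightarrow> x \<in> V"
  by (simp add: is_path_def)

lemma not_is_path_Nil [simp]: "\<not> is_path []"
  by (simp add: is_path_def)

lemma is_pathD:
  assumes "is_path xs"
  shows "xs \<noteq> []" "distinct xs" "set xs \<subseteq> V"
  using assms by (auto simp: is_path_def)

lemma is_path_nth: "is_path xs \<Longrightarrow> Suc i < length xs \<Longrightarrow> adj (xs ! i) (xs ! Suc i)"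
  unfolding is_path_def using successively_nth by metis

lemma is_path_take:
  assumes "is_path xs" "0 < i"
  shows "is_path (take i xs)"
proof (cases "drop i xs = []")
  case False
  then show ?thesis
    using assms is_path_append_iff[of "take i xs" "drop i xs"] is_pathD(1)[OF assms(1)] by simp
qed (use assms in simp)

lemma is_path_drop: "is_path xs \<Longrightarrow> i < length xs \<Longrightarrow> is_path (drop i xs)"
  using is_path_append_iff[of "take i xs" "drop i xs"] by (cases "i = 0"; cases "xs = []") auto

lemma is_path_appendI:
  "is_path xs \<Longrightarrow> is_path ys \<Longrightarrow> set xs \<inter> set ys = {} \<Longrightarrow> adj (last xs) (hd ys) \<Longrightarrow> is_path (xs @ ys)"
  using is_path_append_iff[of xs ys] is_pathD(1) by blast

lemma is_path_snoc_iff: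
  "xs \<noteq> [] \<Longrightarrow> is_path (xs @ [x]) \<longleftrightarrow> is_path xs \<and> x \<notin> set xs \<and> adj (last xs) x"
  using is_path_append_iff[of xs "[x]"] adj_V[of "last xs" x] by auto

lemma length_path_le: "is_path xs \<Longrightarrow> length xs \<le> card V"
  using is_pathD finite_V by (metis card_mono distinct_card)

lemma exists_path_of_length:
  assumes "is_path xs" "0 < i" "i \<le> length xs"
  shows "\<exists>ys. is_path ys \<and> length ys = i"
  using is_path_take[OF assms(1,2)] assms by (intro exI[of _ "take i xs"]) simp

lemma connectedE:
  assumes is_connected "S \<subseteq> V" "S \<noteq> {}" "S \<noteq> V"
  obtains x y where "x \<in> S" "y \<in> V - S" "adj x y"
  using assms unfolding is_connected_def by blast

text \<open>The basic rotation: an edge from the first vertex to position \<open>Suc i\<close> lets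
  the segment before that position be reversed, so \<open>p ! i\<close> becomes the first vertex
  while the vertex set and the last vertex stay.\<close>

lemma rotate_path:
  assumes "is_path p" "adj (hd p) (p ! Suc i)" "Suc i < length p"
  shows "is_path (rev (take (Suc i) p) @ drop (Suc i) p)"
proof -
  have ne: "p \<noteq> []" using assms by auto
  have "is_path (take (Suc i) p)" "is_path (drop (Suc i) p)"
    using assms by (auto intro: is_path_take is_path_drop)
  moreover have "set (take (Suc i) p) \<inter> set (drop (Suc i) p) = {}"
    using is_pathD(2)[OF assms(1)] by (simp add: set_take_disj_set_drop_if_distinct)
  moreover have "adj (last (rev (take (Suc i) p))) (hd (drop (Suc i) p))"
    using assms ne by (simp add: last_rev hd_drop_conv_nth hd_take)
  ultimately show ?thesis by (intro is_path_appendI) auto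
qed

text \<open>Replaces indices modulo the length by a successor map, so that crossing arguments become
  set arguments. The last clause cuts the cycle into two arcs, one from \<open>\<sigma> x\<close> to
  \<open>y\<close> and one from \<open>\<sigma> y\<close> to \<open>x\<close>; reversing the second
  gives the chord arguments below.\<close>

lemma cycle_next:
  assumes "is_cycle C"
  obtains \<sigma> where "bij_betw \<sigma> (set C) (set C)"
    and "\<And>x. x \<in> set C \<Longrightarrow> adj x (\<sigma> x) \<and> \<sigma> x \<noteq> x \<and> \<sigma> (\<sigma> x) \<noteq> x"
    and "\<And>x. x \<in> set C \<Longrightarrow> \<exists>Q. is_path Q \<and> set Q = set C \<and> length Q = length C \<and> hd Q = \<sigma> x \<and> last Q = x"
    and "\<And>x y. x \<in> set C \<Longrightarrow> y \<in> set C \<Longrightarrow> x \<noteq> y \<Longrightarrow>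
      \<exists>xs ys. is_path (xs @ ys) \<and> xs \<noteq> [] \<and> ys \<noteq> [] \<and> set (xs @ ys) = set C \<and> length (xs @ ys) = length C
        \<and> hd xs = \<sigma> x \<and> last xs = y \<and> hd ys = \<sigma> y \<and> last ys = x"
proof -
  let ?L = "length C"
  have C: "3 \<le> ?L" "is_path C" "adj (last C) (hd C)" using assms by (auto simp: is_cycle_def)
  have ne: "C \<noteq> []" and dist: "distinct C" using is_pathD[OF C(2)] by auto
  define idx where "idx x = (THE i. i < ?L \<and> C ! i = x)" for x
  have idx_nth: "idx (C ! i) = i" if "i < ?L" for i
    unfolding idx_def using that dist by (intro the_equality) (auto simp: nth_eq_iff_index_eq)
  define \<sigma> where "\<sigma> x = C ! (Suc (idx x) mod ?L)" for x
  have \<sigma>_nth: "\<sigma> (C ! i) = C ! (Suc i mod ?L)" if "i < ?L" for i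
    using that by (simp add: \<sigma>_def idx_nth)
  have adj_nth: "adj (C ! i) (C ! (Suc i mod ?L))" if "i < ?L" for i
  proof (cases "Suc i < ?L")
    case True then show ?thesis using is_path_nth[OF C(2)] by simp
  next
    case False
    then have "Suc i = ?L" using that by simp
    then show ?thesis using C(3) ne by (simp add: last_conv_nth hd_conv_nth flip: \<open>Suc i = ?L\<close>)
  qed
  have step: "adj x (\<sigma> x) \<and> \<sigma> x \<noteq> x \<and> \<sigma> (\<sigma> x) \<noteq> x" if x: "x \<in> set C" for x
  proof -
    obtain i where i: "i < ?L" "x = C ! i" using x by (auto dest!: mem_set_nth)
    have lt: "Suc i mod ?L < ?L" "Suc (Suc i mod ?L) mod ?L < ?L" using i ne by auto
    \<comment> \<open>Two steps do not return to the start because the length is at least 3.\<close>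
    have "Suc (Suc i mod ?L) mod ?L \<noteq> i"
      using i C(1) by (cases "Suc i = ?L"; cases "Suc (Suc i) = ?L") (auto simp: mod_Suc)
    then have "C ! (Suc (Suc i mod ?L) mod ?L) \<noteq> C ! i"
      using nth_eq_iff_index_eq[OF dist lt(2) i(1)] by simp
    moreover have "\<sigma> (\<sigma> x) = C ! (Suc (Suc i mod ?L) mod ?L)"
      using i lt by (simp add: \<sigma>_nth)
    moreover have "adj x (\<sigma> x)" using adj_nth[OF i(1)] i by (simp add: \<sigma>_nth)
    ultimately show ?thesis using adj_neq i(2) by metis
  qed
  have inj: "inj_on \<sigma> (set C)"
  proof (rule inj_onI)
    fix x y assume "x \<in> set C" "y \<in> set C" and eq: "\<sigma> x = \<sigma> y"
    then obtain i j where ij: "i < ?L" "x = C ! i" "j < ?L" "y = C ! j"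
      by (auto dest!: mem_set_nth)
    then have "C ! (Suc i mod ?L) = C ! (Suc j mod ?L)" using eq by (simp add: \<sigma>_nth)
    then have "Suc i mod ?L = Suc j mod ?L"
      using dist ne by (simp add: nth_eq_iff_index_eq)
    then have "i = j"
      using ij by (cases "Suc i = ?L"; cases "Suc j = ?L") (auto simp: mod_Suc)
    then show "x = y" using ij by simp
  qed
  have "\<sigma> ` set C \<subseteq> set C"
    using ne by (auto simp: \<sigma>_def intro!: nth_mem)
  then have bij: "bij_betw \<sigma> (set C) (set C)"
    using inj by (simp add: bij_betw_def endo_inj_surj)
  have whole: "is_path (drop (Suc i) C @ take (Suc i) C)" if i: "i < ?L" for i
  proof (cases "Suc i < ?L")
    case True
    have "is_path (drop (Suc i) C)" "is_path (take (Suc i) C)"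
      using True C(2) by (auto intro: is_path_take is_path_drop)
    moreover have "set (drop (Suc i) C) \<inter> set (take (Suc i) C) = {}"
      using dist set_take_disj_set_drop_if_distinct[of C "Suc i" "Suc i"] by auto
    ultimately show ?thesis
      using C(3) True ne by (intro is_path_appendI) (auto simp: hd_take)
  next
    case False then show ?thesis using i C(2) by simp
  qed
  have rot: "\<exists>Q. is_path Q \<and> set Q = set C \<and> length Q = ?L \<and> Q = rotate (Suc i) C
       \<and> hd Q = \<sigma> (C ! i) \<and> last Q = C ! i" if i: "i < ?L" for i
  proof (intro exI conjI)
    let ?Q = "rotate (Suc i) C"
    have Q: "?Q = drop (Suc i) C @ take (Suc i) C"
      using i by (cases "Suc i = ?L") (auto simp: rotate_drop_take)
    show "is_path ?Q" unfolding Q by (rule whole[OF i])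
    show "hd ?Q = \<sigma> (C ! i)" using ne i by (simp only: hd_rotate_conv_nth \<sigma>_nth not_False_eq_True)
    have "last ?Q = last (take (Suc i) C)" unfolding Q using ne i by simp
    also have "\<dots> = C ! i" using i ne by (simp add: take_Suc_conv_app_nth)
    finally show "last ?Q = C ! i" .
  qed simp_all
  show thesis
  proof (rule that[OF bij step])
    fix x assume "x \<in> set C"
    then obtain i where "i < ?L" "x = C ! i" by (auto dest!: mem_set_nth)
    then show "\<exists>Q. is_path Q \<and> set Q = set C \<and> length Q = length C \<and> hd Q = \<sigma> x \<and> last Q = x"
      using rot by blast
  next
    fix x y assume x: "x \<in> set C" and y: "y \<in> set C" and "x \<noteq> y"
    obtain i where i: "i < ?L" "x = C ! i" using x by (auto dest!: mem_set_nth)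
    obtain Q where Q: "is_path Q" "set Q = set C" "length Q = ?L" "Q = rotate (Suc i) C"
      "hd Q = \<sigma> x" "last Q = x" using rot[OF i(1)] i by blast
    have Qne: "Q \<noteq> []" using Q(1) by (rule is_pathD)
    obtain j where j: "j < ?L" "Q ! j = y" using mem_set_nth[of y Q] y Q(2,3) by auto
    \<comment> \<open>The rotated list ends in \<open>x\<close>, so \<open>y\<close> comes strictly
      before the end and the second arc is nonempty.\<close>
    have "j \<noteq> ?L - 1"
      using j Q(3,6) Qne \<open>x \<noteq> y\<close> by (metis last_conv_nth)
    then have j': "Suc j < ?L" using j by simp
    have nxt: "Q ! Suc j = \<sigma> y"
    proof -
      let ?t = "(Suc i + j) mod ?L"
      have "y = C ! ?t" using j Q(4) nth_rotate[of j C "Suc i"] by (simp del: rotate_Suc)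
      moreover have "Q ! Suc j = C ! ((Suc i + Suc j) mod ?L)"
        using j' Q(4) nth_rotate[of "Suc j" C "Suc i"] by (simp del: rotate_Suc)
      moreover have "(Suc i + Suc j) mod ?L = Suc ?t mod ?L" by (simp add: mod_Suc_eq)
      moreover have "?t < ?L" using ne by simp
      ultimately show ?thesis using \<sigma>_nth[of ?t] by simp
    qed
    show "\<exists>xs ys. is_path (xs @ ys) \<and> xs \<noteq> [] \<and> ys \<noteq> [] \<and> set (xs @ ys) = set C \<and> length (xs @ ys) = length C
        \<and> hd xs = \<sigma> x \<and> last xs = y \<and> hd ys = \<sigma> y \<and> last ys = x"
    proof (rule exI[of _ "take (Suc j) Q"], rule exI[of _ "drop (Suc j) Q"], intro conjI)
      show "last (take (Suc j) Q) = y" using j Q(3) by (simp add: take_Suc_conv_app_nth)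
      show "hd (drop (Suc j) Q) = \<sigma> y" using j' Q(3) nxt by (simp add: hd_drop_conv_nth)
      show "last (drop (Suc j) Q) = x" using j' Q(3,6) by simp
    qed (use Q j' Qne in \<open>simp_all add: append_take_drop_id del: set_append length_append rotate_Suc\<close>)
  qed
qed

end

section \<open>A cycle missing one vertex of a longest path\<close>

context simple_graph begin

definition at_most_one_low :: "nat \<Rightarrow> bool" where
  "at_most_one_low k \<longleftrightarrow>
     (\<forall>x\<in>V. \<forall>y\<in>V. card (nbrs x) < k \<longrightarrow> card (nbrs y) < k \<longrightarrow> x = y)"

text \<open>A vertex cover of order \<open>k\<close>. It describes the subgraphs of H(n, 2k + 1, k)
  on n vertices: there the part C is a single vertex and cannot be told apart from the vertices of
  B.\<close>

definition covered :: "nat \<Rightarrow> bool" where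
  "covered k \<longleftrightarrow> (\<exists>A\<subseteq>V. card A = k \<and> (\<forall>x y. adj x y \<longrightarrow> x \<in> A \<or> y \<in> A))"

text \<open>\<open>u\<close> and \<open>v\<close> are the two vertices of the part C of H(n, 2k + 2,
  k).\<close>

definition covered_but_edge :: "nat \<Rightarrow> bool" where
  "covered_but_edge k \<longleftrightarrow> (\<exists>A u v. A \<subseteq> V \<and> card A = k \<and> u \<in> V - A \<and> v \<in> V - A \<and> u \<noteq> v \<and>
     (\<forall>x y. adj x y \<longrightarrow> x \<in> A \<or> y \<in> A \<or> {x, y} = {u, v}))"

text \<open>The form in which the degree hypothesis is used: whenever two distinct vertices could
  serve, one of them has degree at least \<open>k\<close>.\<close>

lemma low_unique:
  assumes "at_most_one_low k" "x \<in> V" "y \<in> V" "x \<noteq> y"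
  shows "k \<le> card (nbrs x) \<or> k \<le> card (nbrs y)"
  using assms unfolding at_most_one_low_def by (meson not_le)

end

text \<open>A cycle with a fixed orientation; the assumptions on \<open>\<sigma>\<close> are the
  clauses of \<open>cycle_next\<close>.\<close>

locale oriented_cycle = simple_graph V adj for V :: "'a set" and adj +
  fixes C :: "'a list" and \<sigma> :: "'a \<Rightarrow> 'a"
  assumes cycle_C: "is_cycle C"
    and bij_next: "bij_betw \<sigma> (set C) (set C)"
    and next_step: "x \<in> set C \<Longrightarrow> adj x (\<sigma> x) \<and> \<sigma> x \<noteq> x \<and> \<sigma> (\<sigma> x) \<noteq> x"
    and next_whole: "x \<in> set C \<Longrightarrow>
      \<exists>Q. is_path Q \<and> set Q = set C \<and> length Q = length C \<and> hd Q = \<sigma> x \<and> last Q = x"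
    and next_split: "x \<in> set C \<Longrightarrow> y \<in> set C \<Longrightarrow> x \<noteq> y \<Longrightarrow>
      \<exists>xs ys. is_path (xs @ ys) \<and> xs \<noteq> [] \<and> ys \<noteq> [] \<and> set (xs @ ys) = set C \<and>
        length (xs @ ys) = length C \<and> hd xs = \<sigma> x \<and> last xs = y \<and> hd ys = \<sigma> y \<and> last ys = x"

lemma (in simple_graph) ex_oriented_cycle:
  assumes "is_cycle C"
  shows "\<exists>\<sigma>. oriented_cycle V adj C \<sigma>"
proof (rule cycle_next[OF assms], goal_cases)
  case (1 \<sigma>)
  show ?case
    by (rule exI[of _ \<sigma>], intro oriented_cycle.intro oriented_cycle_axioms.intro)
      (rule simple_graph_axioms assms 1 | assumption)+
qed

context oriented_cycle begin

lemma C_V: "set C \<subseteq> V" and distinct_C: "distinct C" and length_C: "3 \<le> length C"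
  using cycle_C is_pathD unfolding is_cycle_def by auto

lemma next_in [simp]: "x \<in> set C \<Longrightarrow> \<sigma> x \<in> set C"
  using bij_next by (auto simp: bij_betw_def)

lemma next_inj: "x \<in> set C \<Longrightarrow> y \<in> set C \<Longrightarrow> \<sigma> x = \<sigma> y \<Longrightarrow> x = y"
  using bij_next by (auto simp: bij_betw_def inj_on_def)

lemma prev_ex: "x \<in> set C \<Longrightarrow> \<exists>y\<in>set C. \<sigma> y = x"
  using bij_next by (force simp: bij_betw_def)

lemma card_next_image: "X \<subseteq> set C \<Longrightarrow> card (\<sigma> ` X) = card X"
  using bij_next by (intro card_image) (auto simp: bij_betw_def intro: inj_on_subset)

lemma card_C: "card (set C) = length C"
  using distinct_C by (rule distinct_card)

lemma path_from:
  assumes "x \<in> set C"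
  obtains Q where "is_path Q" "set Q = set C" "length Q = length C" "hd Q = x" "last Q = \<sigma> x"
proof -
  obtain Q where "is_path Q" "set Q = set C" "length Q = length C" "hd Q = \<sigma> x" "last Q = x"
    using next_whole[OF assms] by blast
  then show thesis by (intro that[of "rev Q"]) (auto simp: hd_rev last_rev)
qed

text \<open>Otherwise \<open>r\<close> could be inserted between \<open>x\<close> and
  \<open>\<sigma> x\<close>, giving a cycle with one more vertex.\<close>

lemma outside_not_both:
  assumes "r \<notin> set C" "x \<in> set C" "adj r x" "\<nexists>D. is_cycle D \<and> length D = Suc (length C)"
  shows "\<not> adj r (\<sigma> x)"
proof
  assume a: "adj r (\<sigma> x)"
  obtain Q where Q: "is_path Q" "set Q = set C" "length Q = length C" "hd Q = x" "last Q = \<sigma> x"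
    using path_from[OF assms(2)] .
  have "is_cycle (r # Q)"
    unfolding is_cycle_def using Q assms a length_C is_pathD(1)[OF Q(1)]
    by (auto simp: is_path_Cons_iff adj_commute)
  then show False using assms(4) Q(3) by (metis length_Cons)
qed

text \<open>The chord and \<open>r\<close> would reconnect the two arcs: from
  \<open>\<sigma> x\<close> to \<open>y\<close>, to \<open>r\<close>, to \<open>x\<close>, backwards
  to \<open>\<sigma> y\<close>, and by the chord to the start. This cycle uses all of
  \<open>C\<close> and \<open>r\<close>.\<close>

lemma no_chord_next:
  assumes "r \<notin> set C" "x \<in> set C" "y \<in> set C" "adj r x" "adj r y"
    "\<nexists>D. is_cycle D \<and> length D = Suc (length C)"
  shows "\<not> adj (\<sigma> x) (\<sigma> y)"
proof
  assume a: "adj (\<sigma> x) (\<sigma> y)"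
  then have "x \<noteq> y" using adj_neq by blast
  then obtain xs ys where s: "is_path (xs @ ys)" "xs \<noteq> []" "ys \<noteq> []" "set (xs @ ys) = set C"
    "length (xs @ ys) = length C" "hd xs = \<sigma> x" "last xs = y" "hd ys = \<sigma> y" "last ys = x"
    using next_split[OF assms(2,3)] by blast
  have "is_path (xs @ r # rev ys)"
    using s assms by (auto simp: is_path_append_iff is_path_Cons_iff hd_rev adj_commute)
  then have "is_cycle (xs @ r # rev ys)"
    unfolding is_cycle_def using s a length_C by (auto simp: last_rev adj_commute)
  then show False using assms(6) s(5) by (metis add_Suc_right length_append length_Cons length_rev)
qed

text \<open>The mirror image: from \<open>r\<close> to \<open>\<sigma> x\<close>, along to
  \<open>y\<close>, across the chord to \<open>x\<close>, backwards to \<open>\<sigma> y\<close>,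
  and back to \<open>r\<close>.\<close>

lemma no_chord_prev:
  assumes "r \<notin> set C" "x \<in> set C" "y \<in> set C" "adj r (\<sigma> x)" "adj r (\<sigma> y)"
    "\<nexists>D. is_cycle D \<and> length D = Suc (length C)"
  shows "\<not> adj x y"
proof
  assume a: "adj x y"
  then have "x \<noteq> y" using adj_neq by blast
  then obtain xs ys where s: "is_path (xs @ ys)" "xs \<noteq> []" "ys \<noteq> []" "set (xs @ ys) = set C"
    "length (xs @ ys) = length C" "hd xs = \<sigma> x" "last xs = y" "hd ys = \<sigma> y" "last ys = x"
    using next_split[OF assms(2,3)] by blast
  have "is_path (r # xs @ rev ys)"
    using s assms a by (auto simp: is_path_append_iff is_path_Cons_iff hd_rev adj_commute)
  then have "is_cycle (r # xs @ rev ys)"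
    unfolding is_cycle_def using s assms(5) length_C by (auto simp: last_rev adj_commute)
  then show False using assms(6) s(5) by (metis length_append length_Cons length_rev)
qed

text \<open>Opening the cycle at the edge from \<open>x\<close> to \<open>\<sigma> x\<close> leaves
  a path whose two ends carry \<open>p\<close> and \<open>q\<close>.\<close>

lemma path_through:
  assumes "x \<in> set C" "is_path p" "is_path q" "set p \<inter> set C = {}" "set q \<inter> set C = {}"
    "set p \<inter> set q = {}" "adj (last p) x" "adj (\<sigma> x) (hd q)"
  shows "\<exists>P. is_path P \<and> length P = length p + length C + length q"
proof -
  obtain Q where Q: "is_path Q" "set Q = set C" "length Q = length C" "hd Q = x" "last Q = \<sigma> x"
    using path_from[OF assms(1)] .
  have ne: "p \<noteq> []" "q \<noteq> []" "Q \<noteq> []" using is_pathD(1) assms Q by auto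
  have "is_path (Q @ q)" using Q assms ne by (auto simp: is_path_append_iff)
  then have "is_path (p @ Q @ q)" using Q assms ne by (subst is_path_append_iff) auto
  then show ?thesis using Q by (intro exI[of _ "p @ Q @ q"]) simp
qed

lemma path_out:
  assumes "x \<in> set C" "is_path p" "set p \<inter> set C = {}" "adj (last p) x"
  shows "\<exists>P. is_path P \<and> length P = length p + length C"
proof -
  obtain Q where Q: "is_path Q" "set Q = set C" "length Q = length C" "hd Q = x" "last Q = \<sigma> x"
    using path_from[OF assms(1)] .
  then have "is_path (p @ Q)" using assms is_pathD(1) by (intro is_path_appendI) auto
  then show ?thesis using Q by (intro exI[of _ "p @ Q"]) simp
qed

end

context simple_graph begin

text \<open>Connectedness gives an edge from the cycle to the outside; opening the cycle at the
  inner end of this edge and attaching the outer end adds one vertex.\<close>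

lemma cycle_path_longer:
  assumes "is_connected" "is_cycle D" "length D < card V"
  shows "\<exists>P. is_path P \<and> length P = Suc (length D)"
proof -
  obtain \<sigma> where "oriented_cycle V adj D \<sigma>" using ex_oriented_cycle[OF assms(2)] by blast
  then interpret oriented_cycle V adj D \<sigma> .
  have "set D \<noteq> V" using card_C assms(3) by auto
  moreover have "set D \<noteq> {}" using length_C by auto
  ultimately obtain x y where "x \<in> set D" "y \<in> V - set D" "adj x y"
    using connectedE[OF assms(1) C_V] by blast
  then show ?thesis using path_out[of x "[y]"] by (auto simp: adj_commute)
qed

theorem long_cycle_structure:
  assumes conn: is_connected and cyc: "is_cycle C"
    and bound: "\<And>p. is_path p \<Longrightarrow> length p \<le> Suc (length C)"
    and L: "length C \<le> 2 * k + 1" and n: "length C + 2 \<le> card V"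
    and low: "at_most_one_low k"
  shows "length C = 2 * k \<and> covered k \<or> length C = 2 * k + 1 \<and> covered_but_edge k"
proof -
  obtain \<sigma> where "oriented_cycle V adj C \<sigma>" using ex_oriented_cycle[OF cyc] by blast
  then interpret oriented_cycle V adj C \<sigma> .
  \<comment> \<open>\<open>Suc (length C)\<close> is the largest path order allowed and lies below
    \<open>card V\<close>, so a cycle of that length would yield a longer path.\<close>
  have nolong: "\<nexists>D. is_cycle D \<and> length D = Suc (length C)"
  proof
    assume "\<exists>D. is_cycle D \<and> length D = Suc (length C)"
    then obtain D where D: "is_cycle D" "length D = Suc (length C)" by blast
    then obtain P where "is_path P" "length P = Suc (length D)"
      using cycle_path_longer[OF conn D(1)] n by auto
    then show False using bound[of P] D by simp
  qed
  have no2: "length p \<noteq> length C + 2" if "is_path p" for p using bound[OF that] by simp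
  have single: "\<not> adj q r" if "adj r x" "x \<in> set C" "r \<notin> set C" "q \<notin> set C" for r q x
  proof
    assume "adj q r"
    then have "is_path [q, r]" using adj_V adj_neq by (auto simp: is_path_Cons_iff)
    then show False using path_out[of x "[q, r]"] that no2 by auto
  qed
  have att: "\<exists>x\<in>set C. adj r x" if r: "r \<in> V - set C" for r
  proof (rule ccontr)
    assume neg: "\<not> (\<exists>x\<in>set C. adj r x)"
    \<comment> \<open>An edge leaving the closed neighbourhood of the cycle would start at an
      attached vertex off the cycle, which \<open>single\<close> forbids.\<close>
    let ?S = "set C \<union> {r \<in> V. \<exists>x\<in>set C. adj r x}"
    have S: "?S \<subseteq> V" "?S \<noteq> {}" "?S \<noteq> V" using neg r length_C C_V by auto
    obtain x y where xy: "x \<in> ?S" "y \<in> V - ?S" "adj x y" by (rule connectedE[OF conn S])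
    show False
    proof (cases "x \<in> set C")
      case True then show ?thesis using xy adj_sym by blast
    next
      case False
      then obtain z where "z \<in> set C" "adj x z" using xy by blast
      then show ?thesis using single[of x z y] xy False adj_sym by blast
    qed
  qed
  have indep: "\<not> adj q r" if q: "q \<notin> set C" and r: "r \<notin> set C" for q r
  proof
    assume a: "adj q r"
    then obtain x where "x \<in> set C" "adj r x" using att[of r] r adj_V[OF a] by blast
    then show False using single[of r x q] that a by blast
  qed
  have cardR: "2 \<le> card (V - set C)"
    using n card_C C_V by (simp add: card_Diff_subset)
  obtain r where r: "r \<in> V - set C" "k \<le> card (nbrs r)"
  proof -
    obtain T where T: "T \<subseteq> V - set C" "card T = 2"
      by (rule obtain_subset_with_card_n[OF cardR])
    obtain a b where ab: "T = {a, b}" "a \<noteq> b" using T(2) by (auto simp: card_2_iff)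
    then have "a \<in> V - set C" "b \<in> V - set C" using T(1) by auto
    moreover have "k \<le> card (nbrs a) \<or> k \<le> card (nbrs b)"
      using low_unique[OF low, of a b] calculation ab(2) by blast
    ultimately show thesis using that by blast
  qed
  define A where "A = nbrs r"
  have AC: "A \<subseteq> set C" using indep[of r] r unfolding A_def nbrs_def by blast
  have Adj: "adj r a" if "a \<in> A" for a using that by (simp add: A_def)
  have disj: "A \<inter> \<sigma> ` A = {}"
  proof -
    have "\<sigma> a \<notin> A" if "a \<in> A" for a
      using outside_not_both[of r a] r that AC Adj nolong by (auto simp: A_def)
    then show ?thesis by auto
  qed
  have fin: "finite A" using AC finite_subset by blast
  have sub: "A \<union> \<sigma> ` A \<subseteq> set C" using AC by auto
  have cardU: "card (A \<union> \<sigma> ` A) = 2 * card A"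
    using disj fin card_next_image[OF AC] by (simp add: card_Un_disjoint)
  \<comment> \<open>\<open>A\<close> and its successors are disjoint sets of equal size on the
    cycle, so \<open>2 * card A\<close> is at most \<open>2 * k + 1\<close>; with
    \<open>k \<le> card A\<close> this determines \<open>card A\<close>.\<close>
  have "2 * card A \<le> length C" using card_mono[OF _ sub] cardU card_C by simp
  moreover have "k \<le> card A" using r by (simp add: A_def)
  ultimately have cA: "card A = k" "length C = 2 * k \<or> length C = 2 * k + 1" using L by auto
  have AV: "A \<subseteq> V" using AC C_V by blast
  have succ_indep: "\<not> adj x y" if "x \<in> \<sigma> ` A" "y \<in> \<sigma> ` A" for x y
    using that no_chord_next[of r] r AC Adj nolong by auto
  have pred_indep: "\<not> adj x y" if "x \<in> set C" "y \<in> set C" "\<sigma> x \<in> A" "\<sigma> y \<in> A" for x y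
    using that no_chord_prev[of r x y] r Adj nolong by auto
  \<comment> \<open>Opening the cycle at the edge from \<open>a\<close> to
    \<open>\<sigma> a\<close>, with \<open>r\<close> and \<open>q\<close> at its ends, would give a
    path on two more vertices than \<open>C\<close>.\<close>
  have out_succ: "\<not> adj q (\<sigma> a)" if "q \<notin> set C" "a \<in> A" for q a
  proof
    assume a: "adj q (\<sigma> a)"
    show False
    proof (cases "q = r")
      case True then show ?thesis using a that disj by (auto simp: A_def)
    next
      case False
      then show ?thesis
        using path_through[of a "[r]" "[q]"] that r AC Adj[of a] a adj_V[OF a] no2 adj_sym by fastforce
    qed
  qed
  have out_pred: "\<not> adj q x" if "q \<notin> set C" "x \<in> set C" "\<sigma> x \<in> A" for q x
  proof
    assume a: "adj q x"
    show False
    proof (cases "q = r")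
      case True then show ?thesis using a that outside_not_both[of r x] r nolong by (auto simp: A_def)
    next
      case False
      then show ?thesis
        using path_through[of x "[q]" "[r]"] that r Adj[of "\<sigma> x"] a adj_V[OF a] no2 adj_sym by fastforce
    qed
  qed
  show ?thesis
  proof (cases "length C = 2 * k")
    case True
    then have CA: "set C = A \<union> \<sigma> ` A"
      using card_subset_eq[OF _ sub] cardU cA card_C by simp
    have "x \<in> A \<or> y \<in> A" if a: "adj x y" for x y
    proof (rule ccontr)
      assume n: "\<not> (x \<in> A \<or> y \<in> A)"
      have "z \<in> \<sigma> ` A" if "z \<in> set C" "z \<notin> A" for z using that CA by blast
      then have "\<not> adj q z" if "q \<notin> set C" "z \<in> set C" "z \<notin> A" for q z
        using out_succ[OF that(1)] that(2,3) by blast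
      then have "x \<in> set C" "y \<in> set C" using n a adj_sym[OF a] indep by blast+
      then show False using succ_indep[of x y] a n CA by blast
    qed
    then show ?thesis using True AV cA unfolding covered_def by blast
  next
    case False
    then have L': "length C = 2 * k + 1" using cA by simp
    have "card (set C - (A \<union> \<sigma> ` A)) = 1"
      using card_Diff_subset[of "A \<union> \<sigma> ` A" "set C"] fin sub cardU cA(1) L' card_C by simp
    \<comment> \<open>The odd cycle has one vertex \<open>z\<close> that is neither in
      \<open>A\<close> nor a successor of \<open>A\<close>, and one vertex \<open>y\<close> that is
      neither in \<open>A\<close> nor a predecessor. An edge off \<open>A\<close> joins neither two
      successors nor two predecessors, so its ends are \<open>y\<close> and
      \<open>z\<close>.\<close>
    then obtain z where z: "set C - (A \<union> \<sigma> ` A) = {z}" by (auto simp: card_1_singleton_iff)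
    define B where "B = {x \<in> set C. \<sigma> x \<in> A}"
    have "\<sigma> ` B = A" unfolding B_def using AC prev_ex by force
    then have cB: "card B = k" using card_next_image[of B] cA(1) by (auto simp: B_def)
    have AB: "A \<inter> B = {}" using disj by (auto simp: B_def)
    have "card (set C - (A \<union> B)) = 1"
    proof -
      have B: "finite B" "B \<subseteq> set C" by (auto simp: B_def)
      then have "card (A \<union> B) = 2 * k" using fin AB cB cA(1) by (simp add: card_Un_disjoint)
      then show ?thesis
        using card_Diff_subset[of "A \<union> B" "set C"] B fin AC L' card_C by simp
    qed
    then obtain y where y: "set C - (A \<union> B) = {y}" by (auto simp: card_1_singleton_iff)
    have yz: "y \<noteq> z"
    proof
      \<comment> \<open>Then the vertex after \<open>z\<close> is neither in \<open>A\<close> nor a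
        successor of \<open>A\<close>, so it is \<open>z\<close> itself.\<close>
      assume "y = z"
      then have z': "z \<in> set C" "z \<notin> A" "z \<notin> B" "z \<notin> \<sigma> ` A" using y z by auto
      have "\<sigma> z \<notin> A" using z' by (auto simp: B_def)
      moreover have "\<sigma> z \<notin> \<sigma> ` A" using z' next_inj AC by blast
      moreover have "\<sigma> z \<in> set C" using z' by simp
      ultimately have "\<sigma> z = z" using z by blast
      then show False using next_step[OF z'(1)] by simp
    qed
    have zy: "t = z \<or> t \<in> \<sigma> ` A" "t = y \<or> t \<in> B" if "t \<in> set C" "t \<notin> A" for t
      using that y z by blast+
    have "x \<in> A \<or> x' \<in> A \<or> {x, x'} = {y, z}" if a: "adj x x'" for x x'
    proof (rule ccontr)
      assume n: "\<not> (x \<in> A \<or> x' \<in> A \<or> {x, x'} = {y, z})"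
      have out: "\<not> adj q x" if "q \<notin> set C" "x \<in> set C" "x \<notin> A" for q x
      proof (cases "x = z")
        case True
        then have "x \<in> B" using yz zy(2)[OF that(2,3)] by blast
        then show ?thesis using out_pred[OF that(1,2)] unfolding B_def by blast
      next
        case False
        then have "x \<in> \<sigma> ` A" using zy(1)[OF that(2,3)] by blast
        then show ?thesis using out_succ[OF that(1)] by blast
      qed
      have inC: "x \<in> set C" "x' \<in> set C"
        using out[of x x'] out[of x' x] indep[of x x'] a adj_sym[OF a] n by blast+
      have "\<not> (x \<in> \<sigma> ` A \<and> x' \<in> \<sigma> ` A)" using succ_indep a by blast
      moreover have "\<not> (x \<in> B \<and> x' \<in> B)" using pred_indep a unfolding B_def by blast
      ultimately have "(x = z \<or> x' = z) \<and> (x = y \<or> x' = y)"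
        using zy[OF inC(1)] zy[OF inC(2)] n by blast
      then have "{x, x'} = {y, z}" using yz by auto
      then show False using n by blast
    qed
    moreover have "y \<in> V - A" "z \<in> V - A" using y z C_V by auto
    ultimately show ?thesis using L' AV cA yz unfolding covered_but_edge_def by blast
  qed
qed

end

section \<open>Cycles of length four and six\<close>

context simple_graph begin

text \<open>Case (ii): \<open>c\<close> is the centre, \<open>D\<close> fits into K_{k+1}, and each
  class of \<open>l\<close> into a copy of K_k. Free labels instead of components allow classes to
  be described locally, like the pairs in \<open>four_cycle_structure\<close>.\<close>

definition block_cut :: "nat \<Rightarrow> bool" where
  "block_cut k \<longleftrightarrow> (\<exists>c\<in>V. \<exists>D \<subseteq> V - {c}. \<exists>l :: 'a \<Rightarrow> 'a set. card D \<le> k + 1 \<and>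
     (\<forall>x y. adj x y \<longrightarrow> x \<noteq> c \<longrightarrow> y \<noteq> c \<longrightarrow> (x \<in> D \<and> y \<in> D) \<or> (x \<notin> D \<and> y \<notin> D \<and> l x = l y)) \<and>
     (\<forall>x\<in>V - {c} - D. card {y \<in> V - {c} - D. l y = l x} \<le> k))"

text \<open>Case (iv) for k = 2: \<open>c\<close> is the hub, \<open>a\<close> the centre of the
  star, \<open>M\<close> the matching part, and the remaining vertices are the leaves of the
  star.\<close>

definition hub_star :: bool where
  "hub_star \<longleftrightarrow> (\<exists>c\<in>V. \<exists>a\<in>V - {c}. \<exists>M \<subseteq> V - {c, a}.
     (\<forall>x y. adj x y \<longrightarrow> x \<noteq> c \<longrightarrow> y \<noteq> c \<longrightarrow>
        (x \<in> M \<and> y \<in> M) \<or> (x = a \<and> y \<notin> M) \<or> (y = a \<and> x \<notin> M)) \<and>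
     (\<forall>x\<in>M. \<forall>y\<in>M. \<forall>z\<in>M. adj x y \<longrightarrow> adj x z \<longrightarrow> y = z))"

text \<open>Case (iv) for k = 3: \<open>c\<close> and \<open>d\<close> are the vertices of K_2, and
  what is left without them is a matching with isolated vertices.\<close>

definition two_hubs :: bool where
  "two_hubs \<longleftrightarrow> (\<exists>c\<in>V. \<exists>d\<in>V. c \<noteq> d \<and>
     (\<forall>x y z. adj x y \<longrightarrow> adj x z \<longrightarrow> {x, y, z} \<inter> {c, d} = {} \<longrightarrow> y = z))"

text \<open>The triangle \<open>u\<close>, \<open>v\<close>, \<open>c0\<close> hangs at
  \<open>c0\<close>, so traversing it and then the cycle leaves no room to exit at \<open>c1\<close>
  or \<open>c3\<close>: that path would have seven vertices. The chord \<open>c1 c3\<close> decides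
  the rest. With it \<open>c2\<close> is closed as well and \<open>c1\<close>, \<open>c2\<close>,
  \<open>c3\<close> are the large block; without it \<open>c2\<close> becomes the centre of a
  star.\<close>

lemma four_cycle_structure:
  assumes cyc: "is_cycle [c0, c1, c2, c3]"
    and bound: "\<And>p. is_path p \<Longrightarrow> length p \<le> 6"
    and uniq: "\<And>x y z. adj x y \<Longrightarrow> adj x z \<Longrightarrow> {x, y, z} \<inter> {c0, c1, c2, c3} = {} \<Longrightarrow> y = z"
    and uv: "adj u v" "u \<notin> {c0, c1, c2, c3}" "v \<notin> {c0, c1, c2, c3}"
    and nu: "nbrs u = {c0, v}" and nv: "nbrs v = {c0, u}"
  shows "block_cut 2 \<or> hub_star"
proof -
  let ?C = "{c0, c1, c2, c3}"
  have C: "distinct [c0, c1, c2, c3]" "?C \<subseteq> V" "adj c0 c1" "adj c1 c2" "adj c2 c3" "adj c3 c0"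
    using cyc by (auto simp: is_cycle_def is_path_def)
  have E: "adj u c0" "adj v c0" "u \<in> V" "v \<in> V" "u \<noteq> v"
    using nu nv adj_V uv(1) adj_neq[OF uv(1)] mem_nbrs by blast+
  note sy = C(3-6)[THEN adj_sym] E(1,2)[THEN adj_sym] uv(1)[THEN adj_sym]
  have U: "adj u x \<longleftrightarrow> x = c0 \<or> x = v" "adj v x \<longleftrightarrow> x = c0 \<or> x = u" for x
    using nu nv mem_nbrs by blast+
  have no7: "\<not> is_path p" if "length p = 7" for p using bound[of p] that by auto
  have q1: "\<not> adj q c1" "\<not> adj q c3" if q: "q \<notin> ?C" for q
  proof -
    have "q \<notin> {u, v} \<Longrightarrow> adj q c1 \<Longrightarrow> is_path [v, u, c0, c3, c2, c1, q]"
      using C E sy uv q adj_V adj_sym[of q c1] by (auto simp: is_path_def)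
    moreover have "q \<notin> {u, v} \<Longrightarrow> adj q c3 \<Longrightarrow> is_path [v, u, c0, c1, c2, c3, q]"
      using C E sy uv q adj_V adj_sym[of q c3] by (auto simp: is_path_def)
    moreover have "q \<in> {u, v} \<Longrightarrow> \<not> adj q c1 \<and> \<not> adj q c3" using U C(1) uv by auto
    ultimately show "\<not> adj q c1" "\<not> adj q c3" using no7 by fastforce+
  qed
  have q2: "\<not> adj q c2" if q: "q \<notin> ?C" "q' \<notin> ?C" "adj q q'" for q q'
  proof
    assume a: "adj q c2"
    then have "q \<notin> {u, v}" using U C(1) uv by auto
    moreover from this have "q' \<notin> {u, v}" using U adj_sym[OF q(3)] q by auto
    ultimately have "is_path [v, u, c0, c1, c2, q, q']"
      using C E sy uv q adj_V adj_sym[OF a] adj_neq[OF q(3)] by (auto simp: is_path_def)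
    then show False using no7 by fastforce
  qed
  show ?thesis
  proof (cases "adj c1 c3")
    case True
    have q3: "\<not> adj q c2" if q: "q \<notin> ?C" for q
    proof
      assume a: "adj q c2"
      then have "q \<notin> {u, v}" using U C(1) uv by auto
      then have "is_path [v, u, c0, c1, c3, c2, q]"
        using C E sy uv q adj_V adj_sym[OF a] True by (auto simp: is_path_def)
      then show False using no7 by fastforce
    qed
    \<comment> \<open>Off the cycle this is \<open>x\<close> with its one possible neighbour other
      than \<open>c0\<close>, so it names the edge or single vertex left there.\<close>
    define l where "l x = insert x (nbrs x - {c0})" for x
    have out: "y \<notin> ?C" if "adj x y" "x \<notin> ?C" "y \<noteq> c0" for x y
      using q1[OF that(2)] q3[OF that(2)] that by auto
    have l2: "l x = {x, y}" if "adj x y" "x \<notin> ?C" "y \<noteq> c0" for x y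
    proof -
      have "z = y" if z: "adj x z" "z \<noteq> c0" for z
      proof -
        have "z \<notin> ?C" "y \<notin> ?C" using out z \<open>adj x y\<close> \<open>x \<notin> ?C\<close> \<open>y \<noteq> c0\<close> by blast+
        then have "{x, z, y} \<inter> ?C = {}" using \<open>x \<notin> ?C\<close> by simp
        then show ?thesis using uniq[of x z y] z(1) \<open>adj x y\<close> by blast
      qed
      then have "nbrs x - {c0} = {y}" using that(1,3) unfolding nbrs_def by blast
      then show ?thesis by (simp add: l_def)
    qed
    have "(x \<in> {c1, c2, c3} \<and> y \<in> {c1, c2, c3}) \<or> (x \<notin> {c1, c2, c3} \<and> y \<notin> {c1, c2, c3} \<and> l x = l y)"
      if a: "adj x y" "x \<noteq> c0" "y \<noteq> c0" for x y
    proof (cases "x \<in> ?C")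
      case True
      then have "y \<in> ?C" using out[of y x] a adj_sym by blast
      then show ?thesis using True a by auto
    next
      case False
      then have y: "y \<notin> ?C" using out a by blast
      then have "l x = {x, y}" "l y = {y, x}" using l2 a False adj_sym by blast+
      then show ?thesis using False y by auto
    qed
    moreover have "card {y \<in> V - {c0} - {c1, c2, c3}. l y = l x} \<le> 2"
      if x: "x \<in> V - {c0} - {c1, c2, c3}" for x
    proof -
      have sub: "{y \<in> V - {c0} - {c1, c2, c3}. l y = l x} \<subseteq> l x" by (auto simp: l_def)
      have "\<exists>y. l x \<subseteq> {x, y}"
      proof (cases "nbrs x - {c0} = {}")
        case True then show ?thesis by (auto simp: l_def)
      next
        case False
        then obtain y where "adj x y" "y \<noteq> c0" unfolding nbrs_def by blast
        then show ?thesis using l2[of x y] x by auto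
      qed
      then obtain y where "l x \<subseteq> {x, y}" by blast
      then have "card {y \<in> V - {c0} - {c1, c2, c3}. l y = l x} \<le> card {x, y}"
        using sub by (intro card_mono) auto
      also have "\<dots> \<le> 2" by (simp add: card_insert_if)
      finally show ?thesis .
    qed
    moreover have "card {c1, c2, c3} \<le> 2 + 1" by (simp add: card_insert_if)
    ultimately have "block_cut 2"
      unfolding block_cut_def using C(1,2)
      by (intro bexI[of _ c0] exI[of _ "{c1, c2, c3}"] conjI exI[of _ l]) auto
    then show ?thesis ..
  next
    case False
    \<comment> \<open>Ends of edges off the cycle. Everything else apart from \<open>c0\<close> and
      \<open>c2\<close>, including \<open>c1\<close> and \<open>c3\<close>, becomes a leaf of the
      star at \<open>c2\<close>.\<close>
    define M where "M = {x. x \<notin> ?C \<and> (\<exists>y. y \<notin> ?C \<and> adj x y)}"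
    have MV: "M \<subseteq> V - {c0, c2}" using adj_V by (auto simp: M_def)
    have "(x \<in> M \<and> y \<in> M) \<or> (x = c2 \<and> y \<notin> M) \<or> (y = c2 \<and> x \<notin> M)"
      if a: "adj x y" "x \<noteq> c0" "y \<noteq> c0" for x y
    proof -
      have *: "y = c2 \<and> x \<notin> M" if "adj x y" "x \<notin> ?C" "y \<in> ?C" "y \<noteq> c0" for x y
        using q1[OF that(2)] q2[OF that(2)] that by (auto simp: M_def)
      consider "x \<notin> ?C" "y \<notin> ?C" | "x \<notin> ?C" "y \<in> ?C" | "x \<in> ?C" "y \<notin> ?C" | "x \<in> ?C" "y \<in> ?C" by blast
      then show ?thesis
      proof cases
        case 1 then show ?thesis using a adj_sym[OF a(1)] unfolding M_def by blast
      next
        case 2 then show ?thesis using * a by blast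
      next
        case 3 then show ?thesis using *[of y x] a adj_sym[OF a(1)] by blast
      next
        case 4
        then have "x = c2 \<or> y = c2" using a False adj_sym[OF a(1)] adj_neq[OF a(1)] by auto
        then show ?thesis using 4 by (auto simp: M_def)
      qed
    qed
    moreover have "y = z" if "x \<in> M" "y \<in> M" "z \<in> M" "adj x y" "adj x z" for x y z
    proof -
      have "{x, y, z} \<inter> ?C = {}" using that(1-3) by (auto simp: M_def)
      then show ?thesis using uniq that(4,5) by blast
    qed
    ultimately have hub_star
      unfolding hub_star_def using C(1,2) MV
      by (intro bexI[of _ c0] bexI[of _ c2] exI[of _ M] conjI) auto
    then show ?thesis ..
  qed
qed

text \<open>Each such chord gives a path through the five cycle vertices other than
  \<open>c0\<close> that ends in \<open>c3\<close> and continues with \<open>u\<close>,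
  \<open>v\<close>, \<open>c0\<close>, \<open>q\<close>: nine vertices. For \<open>c2 c4\<close>
  this is done with the help of the edge \<open>c1 c3\<close>, which is where the third neighbour
  \<open>x\<close> of \<open>c1\<close> enters.\<close>

lemma six_cycle_no_chord:
  assumes cyc: "is_cycle [c0, c1, c2, c3, c4, c5]"
    and bound: "\<And>p. is_path p \<Longrightarrow> length p \<le> 8"
    and uv: "adj u v" "{u, v, q} \<inter> {c0, c1, c2, c3, c4, c5} = {}" "q \<notin> {u, v}"
    and e: "adj u c3" "adj v c0" "adj q c0"
    and c1: "adj c1 x" "x \<notin> {c0, c2}" "x \<in> {c3, c4, c5}"
  shows "{(c1, c4), (c1, c5), (c2, c4), (c2, c5)} \<inter> {(y, z). adj y z} = {}"
proof -
  have C: "distinct [c0, c1, c2, c3, c4, c5]" "{c0, c1, c2, c3, c4, c5} \<subseteq> V"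
    and A: "adj c0 c1" "adj c1 c2" "adj c2 c3" "adj c3 c4" "adj c4 c5" "adj c5 c0"
    using cyc by (auto simp: is_cycle_def is_path_def)
  have W: "u \<in> V" "v \<in> V" "q \<in> V" "u \<noteq> v" using e adj_V adj_neq[OF uv(1)] by blast+
  note S = A e uv(1) A[THEN adj_sym] e[THEN adj_sym] uv(1)[THEN adj_sym]
  have no9: "\<not> is_path p" if "length p = 9" for p using bound[of p] that by auto
  have 1: "\<not> adj c1 c5"
  proof
    assume a: "adj c1 c5"
    then have "is_path [c4, c5, c1, c2, c3, u, v, c0, q]"
      using C W S uv adj_sym[OF a] by (auto simp: is_path_def)
    then show False using no9 by fastforce
  qed
  have 2: "\<not> adj c2 c5"
  proof
    assume a: "adj c2 c5"
    then have "is_path [c1, c2, c5, c4, c3, u, v, c0, q]"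
      using C W S uv adj_sym[OF a] by (auto simp: is_path_def)
    then show False using no9 by fastforce
  qed
  have 3: "\<not> adj c1 c4"
  proof
    assume a: "adj c1 c4"
    then have "is_path [c5, c4, c1, c2, c3, u, v, c0, q]"
      using C W S uv adj_sym[OF a] by (auto simp: is_path_def)
    then show False using no9 by fastforce
  qed
  have "\<not> adj c2 c4"
  proof
    assume a: "adj c2 c4"
    have "adj c1 c3" using c1 1 3 by auto
    then have "is_path [c5, c4, c2, c1, c3, u, v, c0, q]"
      using C W S uv adj_sym[OF a] by (auto simp: is_path_def)
    then show False using no9 by fastforce
  qed
  then show ?thesis using 1 2 3 by auto
qed

text \<open>The hubs are \<open>c0\<close> and \<open>c3\<close>; the point is that no chord joins
  \<open>c1\<close>, \<open>c2\<close> to \<open>c4\<close>, \<open>c5\<close>. A further vertex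
  adjacent to both hubs excludes such chords at once. Otherwise every further vertex has degree
  below 3, so there is just one; it is exceptional, and all cycle vertices have a third
  neighbour.\<close>

lemma six_cycle_structure:
  assumes cyc: "is_cycle [c0, c1, c2, c3, c4, c5]"
    and bound: "\<And>p. is_path p \<Longrightarrow> length p \<le> 8"
    and uniq: "\<And>x y z. adj x y \<Longrightarrow> adj x z \<Longrightarrow> {x, y, z} \<inter> {c0, c1, c2, c3, c4, c5} = {} \<Longrightarrow> y = z"
    and uv: "adj u v" "u \<notin> {c0, c1, c2, c3, c4, c5}" "v \<notin> {c0, c1, c2, c3, c4, c5}"
    and nu: "nbrs u = {c0, c3, v}" and nv: "nbrs v = {c0, c3, u}"
    and n: "9 \<le> card V" and low: "at_most_one_low 3" and conn: is_connected
  shows two_hubs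
proof -
  let ?C = "{c0, c1, c2, c3, c4, c5}"
  have C: "distinct [c0, c1, c2, c3, c4, c5]" "?C \<subseteq> V"
    and A: "adj c0 c1" "adj c1 c2" "adj c2 c3" "adj c3 c4" "adj c4 c5" "adj c5 c0"
    using cyc by (auto simp: is_cycle_def is_path_def)
  have e: "adj u c0" "adj u c3" "adj v c0" "adj v c3" using nu nv mem_nbrs by blast+
  have W: "u \<in> V" "v \<in> V" "u \<noteq> v" using e adj_V adj_neq[OF uv(1)] by blast+
  note S = A e uv(1) A[THEN adj_sym] e[THEN adj_sym] uv(1)[THEN adj_sym]
  have no9: "\<not> is_path p" if "length p = 9" for p using bound[of p] that by auto
  have U: "adj u x \<longleftrightarrow> x = c0 \<or> x = c3 \<or> x = v" "adj v x \<longleftrightarrow> x = c0 \<or> x = c3 \<or> x = u" for x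
    using nu nv mem_nbrs by blast+
  have q1: "\<not> adj q c1 \<and> \<not> adj q c2 \<and> \<not> adj q c4 \<and> \<not> adj q c5" if q: "q \<notin> ?C" for q
  proof (cases "q \<in> {u, v}")
    case True then show ?thesis using U C(1) uv by auto
  next
    case False
    have "adj q c1 \<Longrightarrow> is_path [v, u, c0, c5, c4, c3, c2, c1, q]"
      using C W S uv q False adj_V[of q c1] adj_sym[of q c1] by (auto simp: is_path_def)
    moreover have "adj q c5 \<Longrightarrow> is_path [v, u, c0, c1, c2, c3, c4, c5, q]"
      using C W S uv q False adj_V[of q c5] adj_sym[of q c5] by (auto simp: is_path_def)
    moreover have "adj q c2 \<Longrightarrow> is_path [v, u, c3, c4, c5, c0, c1, c2, q]"
      using C W S uv q False adj_V[of q c2] adj_sym[of q c2] by (auto simp: is_path_def)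
    moreover have "adj q c4 \<Longrightarrow> is_path [v, u, c3, c2, c1, c0, c5, c4, q]"
      using C W S uv q False adj_V[of q c4] adj_sym[of q c4] by (auto simp: is_path_def)
    ultimately show ?thesis using no9 by fastforce
  qed
  have "card (?C \<union> {u, v}) \<le> 8"
    by (rule order_trans[OF card_Un_le]) (simp add: card_insert_if)
  then have "\<not> V \<subseteq> ?C \<union> {u, v}" using n card_mono[of "?C \<union> {u, v}" V] by fastforce
  then obtain q where q: "q \<in> V" "q \<notin> ?C" "q \<notin> {u, v}" by blast
  have nochord: "\<not> adj c1 c4 \<and> \<not> adj c1 c5 \<and> \<not> adj c2 c4 \<and> \<not> adj c2 c5"
  proof (cases "\<exists>q. q \<notin> ?C \<union> {u, v} \<and> adj q c0 \<and> adj q c3")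
    case True
    then obtain q where q: "q \<notin> ?C" "q \<notin> {u, v}" "adj q c0" "adj q c3" by blast
    note qs = q(3,4) q(3,4)[THEN adj_sym]
    have qV: "q \<in> V" using q adj_V by blast
    have "adj c1 c5 \<Longrightarrow> is_path [c4, c5, c1, c2, c3, u, v, c0, q]"
      using C W S uv q qs qV adj_sym[of c1 c5] by (auto simp: is_path_def)
    moreover have "adj c1 c4 \<Longrightarrow> is_path [c2, c1, c4, c5, c0, u, v, c3, q]"
      using C W S uv q qs qV adj_sym[of c1 c4] by (auto simp: is_path_def)
    moreover have "adj c2 c5 \<Longrightarrow> is_path [c1, c2, c5, c4, c3, u, v, c0, q]"
      using C W S uv q qs qV adj_sym[of c2 c5] by (auto simp: is_path_def)
    moreover have "adj c2 c4 \<Longrightarrow> is_path [c5, c4, c2, c1, c0, u, v, c3, q]"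
      using C W S uv q qs qV adj_sym[of c2 c4] by (auto simp: is_path_def)
    ultimately show ?thesis using no9 by fastforce
  next
    case False
    \<comment> \<open>At most one hub as neighbour on the cycle and, by \<open>uniq\<close>, at most
      one neighbour off it.\<close>
    have few: "card (nbrs p) < 3" if p: "p \<notin> ?C" "p \<notin> {u, v}" for p
    proof -
      have "\<exists>a b. nbrs p \<subseteq> {a, b}"
      proof -
        have "nbrs p \<inter> ?C \<subseteq> {c0} \<or> nbrs p \<inter> ?C \<subseteq> {c3}"
          using q1[OF p(1)] False p by auto
        then obtain a where a: "nbrs p \<inter> ?C \<subseteq> {a}" by blast
        obtain b where b: "nbrs p - ?C \<subseteq> {b}"
        proof (cases "nbrs p - ?C = {}")
          case True then show ?thesis using that by auto
        next
          case ne: False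
          then obtain b where "b \<in> nbrs p - ?C" by blast
          then have b: "adj p b" "b \<notin> ?C" by auto
          have "x = b" if "x \<in> nbrs p - ?C" for x
            using uniq[of p x b] b p(1) that unfolding nbrs_def by blast
          then have "nbrs p - ?C \<subseteq> {b}" by blast
          then show ?thesis using that by blast
        qed
        have "nbrs p = (nbrs p \<inter> ?C) \<union> (nbrs p - ?C)" by (rule Int_Diff_Un[symmetric])
        also have "\<dots> \<subseteq> {a} \<union> {b}" using a b by (rule Un_mono)
        finally have "nbrs p \<subseteq> {a, b}" by blast
        then show ?thesis by blast
      qed
      then obtain a b where "nbrs p \<subseteq> {a, b}" by blast
      then have "card (nbrs p) \<le> card {a, b}" by (intro card_mono) auto
      also have "\<dots> \<le> 2" by (simp add: card_insert_if)
      finally show ?thesis by simp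
    qed
    have reg: "3 \<le> card (nbrs x)" if "x \<in> ?C" for x
    proof -
      have "x \<in> V" "x \<noteq> q" using that C(2) q(2) by blast+
      then show ?thesis using low_unique[OF low _ q(1), of x] few[OF q(2,3)] by linarith
    qed
    have iso: "\<not> adj q p" if p: "p \<notin> ?C" for p
    proof
      assume a: "adj q p"
      then have "p \<notin> {u, v}" using U q adj_sym[OF a] by auto
      then have "card (nbrs p) < 3" by (rule few[OF p])
      moreover have "q \<in> V" "p \<in> V" "q \<noteq> p" using adj_V[OF a] adj_neq[OF a] by blast+
      ultimately show False using low_unique[OF low, of q p] few[OF q(2,3)] by linarith
    qed
    have "{q} \<subseteq> V" "{q} \<noteq> {}" "{q} \<noteq> V" using q C(2) by auto
    then obtain y where yq: "adj q y" using connectedE[OF conn] by blast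
    then have y: "y = c0 \<or> y = c3" using iso[of y] q1[OF q(2)] by auto
    have third: "\<exists>x. adj c x \<and> x \<notin> {a, b} \<and> x \<in> ?C - {a, b, c}"
      if c: "c \<in> {c1, c2, c4, c5}" for c a b
    proof -
      have "\<not> nbrs c \<subseteq> {a, b}"
      proof
        assume "nbrs c \<subseteq> {a, b}"
        then have "card (nbrs c) \<le> card {a, b}" by (intro card_mono) auto
        also have "\<dots> \<le> 2" by (simp add: card_insert_if)
        finally show False using reg[of c] c by auto
      qed
      then obtain x where x: "adj c x" "x \<notin> {a, b}" unfolding nbrs_def by blast
      then have "x \<in> ?C" using q1[of x] c adj_sym[OF x(1)] by blast
      then show ?thesis using x adj_neq[OF x(1)] by blast
    qed
    show ?thesis
    proof (cases "y = c0")
      case True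
      obtain x where x: "adj c1 x" "x \<notin> {c0, c2}" "x \<in> ?C - {c0, c2, c1}" using third[of c1 c0 c2] by blast
      have "{(c1, c4), (c1, c5), (c2, c4), (c2, c5)} \<inter> {(y, z). adj y z} = {}"
        by (rule six_cycle_no_chord[OF cyc bound uv(1) _ _ e(2,3) _ x(1,2)])
          (use uv q x True yq in auto)
      then show ?thesis by auto
    next
      case False
      then have y3: "y = c3" using y by simp
      \<comment> \<open>Reflecting the cycle swaps the hubs, so the lemma for an edge at
        \<open>c0\<close> applies with \<open>c2\<close> in the role of \<open>c1\<close>.\<close>
      have cyc': "is_cycle [c3, c2, c1, c0, c5, c4]"
        using C A A[THEN adj_sym] by (auto simp: is_cycle_def is_path_def)
      obtain x where x: "adj c2 x" "x \<notin> {c3, c1}" "x \<in> ?C - {c3, c1, c2}" using third[of c2 c3 c1] by blast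
      have "{(c2, c5), (c2, c4), (c1, c5), (c1, c4)} \<inter> {(y, z). adj y z} = {}"
        by (rule six_cycle_no_chord[OF cyc' bound uv(1) _ _ e(1,4) _ x(1,2)])
          (use uv q x y3 yq in auto)
      then show ?thesis by auto
    qed
  qed
  have only: "y = z" if "adj x y" "adj x z" "{x, y, z} \<inter> {c0, c3} = {}" for x y z
  proof (cases "x \<in> ?C")
    case True
    have neg: "\<not> adj c4 c1" "\<not> adj c5 c1" "\<not> adj c4 c2" "\<not> adj c5 c2"
      using nochord adj_commute by metis+
    have inC: "t \<in> ?C" if t: "adj s t" "s \<in> {c1, c2, c4, c5}" for s t
    proof (rule ccontr)
      assume "t \<notin> ?C"
      from q1[OF this] show False using adj_sym[OF t(1)] t(2) by auto
    qed
    have "adj c1 t \<Longrightarrow> t \<notin> {c0, c3} \<Longrightarrow> t = c2" for t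
      using inC[of c1 t] nochord adj_neq[of c1 t] by auto
    moreover have "adj c2 t \<Longrightarrow> t \<notin> {c0, c3} \<Longrightarrow> t = c1" for t
      using inC[of c2 t] nochord adj_neq[of c2 t] by auto
    moreover have "adj c4 t \<Longrightarrow> t \<notin> {c0, c3} \<Longrightarrow> t = c5" for t
      using inC[of c4 t] neg adj_neq[of c4 t] by auto
    moreover have "adj c5 t \<Longrightarrow> t \<notin> {c0, c3} \<Longrightarrow> t = c4" for t
      using inC[of c5 t] neg adj_neq[of c5 t] by auto
    moreover have "x = c1 \<or> x = c2 \<or> x = c4 \<or> x = c5" "y \<notin> {c0, c3}" "z \<notin> {c0, c3}"
      using True that(3) by auto
    ultimately show ?thesis using that(1,2) by metis
  next
    case False
    have "t \<notin> ?C" if "adj x t" "t \<notin> {c0, c3}" for t using q1[OF False] that by auto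
    then have "y \<notin> ?C" "z \<notin> ?C" using that by auto
    then have "{x, y, z} \<inter> ?C = {}" using False by simp
    then show ?thesis using uniq[OF that(1,2)] by blast
  qed
  then have "\<forall>x y z. adj x y \<longrightarrow> adj x z \<longrightarrow> {x, y, z} \<inter> {c0, c3} = {} \<longrightarrow> y = z" by simp
  moreover have "c0 \<in> V" "c3 \<in> V" "c0 \<noteq> c3" using C by auto
  ultimately show two_hubs unfolding two_hubs_def by (intro bexI conjI)
qed

end

section \<open>A cycle missing an edge of a longest path\<close>

context simple_graph begin

lemma is_path2 [simp]: "is_path [x, y] \<longleftrightarrow> adj x y"
  using adj_V[of x y] adj_neq[of x y] by (auto simp: is_path_Cons_iff)

lemma is_path3: "is_path [x, y, z] \<longleftrightarrow> adj x y \<and> adj y z \<and> x \<noteq> z"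
  using adj_neq[of x y] by (auto simp: is_path_Cons_iff[of "[y, z]" x])

end

context oriented_cycle begin

lemma next_image_subset: "X \<subseteq> set C \<Longrightarrow> \<sigma> ` X \<subseteq> set C"
  using next_in by blast

lemma card_next_next_image: "X \<subseteq> set C \<Longrightarrow> card (\<sigma> ` \<sigma> ` X) = card X"
  using card_next_image next_image_subset by metis

text \<open>If \<open>\<sigma> (\<sigma> x)\<close> were outside \<open>U\<close>, it would be the
  successor of a vertex of \<open>U\<close>; that vertex is \<open>\<sigma> x\<close>, which is not
  in \<open>U\<close>.\<close>

lemma alternate_next:
  assumes "set C = U \<union> \<sigma> ` U" "U \<inter> \<sigma> ` U = {}" "x \<in> U"
  shows "\<sigma> (\<sigma> x) \<in> U"
proof (rule ccontr)
  assume n: "\<sigma> (\<sigma> x) \<notin> U"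
  have x: "x \<in> set C" "\<sigma> x \<in> set C" using assms(1,3) by blast+
  then have "\<sigma> (\<sigma> x) \<in> set C" by (intro next_in)
  then have "\<sigma> (\<sigma> x) \<in> \<sigma> ` U" using n assms(1) by blast
  then obtain y where y: "y \<in> U" "\<sigma> (\<sigma> x) = \<sigma> y" by blast
  then have "\<sigma> x = y" using next_inj[OF x(2)] assms(1) by blast
  then show False using y(1) assms(2,3) by blast
qed

text \<open>
  A vertex off the cycle without a neighbour on it has degree one, so there is at most one of them.
\<close>

lemma outside_matching:
  assumes conn: is_connected
    and bound: "\<And>p. is_path p \<Longrightarrow> length p \<le> length C + 2"
    and low: "at_most_one_low k" and k: "2 \<le> k"
    and xy: "adj x y" "adj x z" "x \<notin> set C" "y \<notin> set C" "z \<notin> set C"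
  shows "y = z"
proof (rule ccontr)
  assume yz: "y \<noteq> z"
  define att where "att r \<longleftrightarrow> (\<exists>x\<in>set C. adj r x)" for r
  \<comment> \<open>A three-vertex path hanging from the cycle would give a path with three more
    vertices than the cycle.\<close>
  have p3: False if h: "att r" "r \<notin> set C" "s \<notin> set C" "t \<notin> set C" "adj t s" "adj s r" "t \<noteq> r" for r s t
  proof -
    obtain x where x: "x \<in> set C" "adj r x" using h(1) unfolding att_def by blast
    have "is_path [t, s, r]" using h by (simp add: is_path3)
    then obtain P where "is_path P" "length P = 3 + length C"
      using path_out[of x "[t, s, r]"] x h by auto
    then show False using bound[of P] by simp
  qed
  have pend: "card (nbrs r) < k" if r: "r \<in> V" "r \<notin> set C" "\<not> att r" for r
  proof -
    \<comment> \<open>Every vertex is on the cycle, attached to it, or next to an attached vertex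
      off the cycle: an edge leaving this set would again hang a three-vertex path on the
      cycle.\<close>
    let ?T = "{s \<in> V. s \<notin> set C \<and> (\<exists>t. t \<notin> set C \<and> att t \<and> adj s t)}"
    let ?S = "set C \<union> {s \<in> V. att s} \<union> ?T"
    have "r \<in> ?S"
    proof (rule ccontr)
      assume "r \<notin> ?S"
      then have S: "?S \<subseteq> V" "?S \<noteq> {}" "?S \<noteq> V" using C_V length_C r by auto
      obtain s t where st: "s \<in> ?S" "t \<in> V - ?S" "adj s t" by (rule connectedE[OF conn S])
      have t: "t \<notin> set C" "\<not> att t" "t \<in> V" using st(2) by blast+
      consider "s \<in> set C" | "s \<notin> set C" "att s" | "s \<notin> set C" "s \<in> ?T" using st(1) by blast
      then show False
      proof cases
        case 1 then show ?thesis using t(2) adj_sym[OF st(3)] unfolding att_def by blast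
      next
        case 2 then show ?thesis using st(2) t adj_sym[OF st(3)] by blast
      next
        case 3
        then obtain w where w: "w \<notin> set C" "att w" "adj s w" by blast
        have "t \<noteq> w" using t w by blast
        then show ?thesis using p3[OF w(2,1) 3(1) t(1) adj_sym[OF st(3)] w(3)] by blast
      qed
    qed
    then obtain w where w: "w \<notin> set C" "att w" "adj r w" using r by blast
    have "t = w" if t: "adj r t" for t
    proof (rule ccontr)
      assume "t \<noteq> w"
      moreover have "t \<notin> set C" using t r(3) unfolding att_def by blast
      ultimately show False using p3[OF w(2,1) r(2) _ adj_sym[OF t] w(3)] by blast
    qed
    then have "nbrs r \<subseteq> {w}" unfolding nbrs_def by blast
    then have "card (nbrs r) \<le> 1" using card_mono[of "{w}" "nbrs r"] by simp
    then show ?thesis using k by simp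
  qed
  \<comment> \<open>If \<open>y\<close> were attached, \<open>z\<close>, \<open>x\<close>,
    \<open>y\<close> would be a three-vertex path hanging from the cycle, and symmetrically for
    \<open>z\<close>. So both are unattached, and both have degree below \<open>k\<close>.\<close>
  have "\<not> att y" using p3[of y x z] xy adj_sym yz by blast
  moreover have "\<not> att z" using p3[of z x y] xy adj_sym yz by blast
  moreover have "y \<in> V" "z \<in> V" using xy adj_V by blast+
  ultimately show False using pend[of y] pend[of z] xy low_unique[OF low, of y z] yz by fastforce
qed

text \<open>Inserting \<open>u\<close> and \<open>v\<close> between \<open>x\<close> and
  \<open>\<sigma> x\<close> makes a cycle on \<open>length C + 2\<close> vertices, which
  connectedness extends to a forbidden path.\<close>

lemma edge_not_next:
  assumes conn: is_connected and n: "length C + 2 < card V"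
    and bound: "\<And>p. is_path p \<Longrightarrow> length p \<le> length C + 2"
    and uv: "adj u v" "u \<notin> set C" "v \<notin> set C" and x: "x \<in> set C" "adj u x"
  shows "\<not> adj v (\<sigma> x)"
proof
  assume a: "adj v (\<sigma> x)"
  obtain Q where Q: "is_path Q" "set Q = set C" "length Q = length C" "hd Q = x" "last Q = \<sigma> x"
    using path_from[OF x(1)] .
  have ne: "Q \<noteq> []" using Q(1) by auto
  have "is_path (v # u # Q)"
    using Q ne uv x adj_sym[OF uv(1)] adj_neq[OF uv(1)] by (auto simp: is_path_Cons_iff)
  then have "is_cycle (v # u # Q)" using Q ne a adj_sym length_C unfolding is_cycle_def by auto
  then obtain P where "is_path P" "length P = Suc (length (v # u # Q))"
    using cycle_path_longer[OF conn] n Q by fastforce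
  then show False using bound[of P] Q by simp
qed

text \<open>Replacing \<open>\<sigma> x\<close> by \<open>u\<close> and \<open>v\<close> would
  lengthen the cycle by one.\<close>

lemma edge_not_next2:
  assumes nolong: "\<nexists>D. is_cycle D \<and> length D = Suc (length C)"
    and uv: "adj u v" "u \<notin> set C" "v \<notin> set C" and x: "x \<in> set C" "adj u x"
  shows "\<not> adj v (\<sigma> (\<sigma> x))"
proof
  assume a: "adj v (\<sigma> (\<sigma> x))"
  have st: "\<sigma> x \<in> set C" "x \<noteq> \<sigma> x" using x(1) next_step[OF x(1)] by (simp, metis)
  obtain xs ys where s: "is_path (xs @ ys)" "xs \<noteq> []" "ys \<noteq> []" "set (xs @ ys) = set C"
    "length (xs @ ys) = length C" "hd xs = \<sigma> x" "last xs = \<sigma> x" "hd ys = \<sigma> (\<sigma> x)" "last ys = x"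
    using next_split[OF x(1) st] by blast
  \<comment> \<open>The arc from \<open>\<sigma> x\<close> to \<open>\<sigma> x\<close> is the
    single vertex that is bypassed.\<close>
  have "length xs = 1"
  proof -
    have d: "distinct xs" using s(1) is_pathD(2) by fastforce
    have "xs ! 0 = xs ! (length xs - 1)" using s(2,6,7) by (simp add: hd_conv_nth last_conv_nth)
    then have "0 = length xs - 1" using d s(2) by (subst (asm) nth_eq_iff_index_eq) auto
    then show ?thesis using s(2) by (cases xs) auto
  qed
  then have ly: "length ys = length C - 1" using s(5) by simp
  have "is_path ys" using s by (simp add: is_path_append_iff)
  moreover have "u \<notin> set ys" "v \<notin> set ys" using s(4) uv by auto
  ultimately have "is_path (u # v # ys)"
    using s(3,8) a uv(1) adj_neq[OF uv(1)] by (auto simp: is_path_Cons_iff)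
  then have "is_cycle (u # v # ys)"
    using s(3,9) x(2) adj_sym ly length_C unfolding is_cycle_def by auto
  then show False using nolong ly length_C by auto
qed

text \<open>Distinct neighbours of \<open>u\<close> on the cycle are at distance at least 2,
  likewise those of \<open>v\<close>, and a neighbour of \<open>u\<close> is at distance at least 3
  from any other neighbour of \<open>v\<close>. With at least \<open>k - 1\<close> of each, this
  forces \<open>X = Y\<close>; then \<open>X\<close> and its two shifts are disjoint, so 3(k - 1)
  \<le> 2k.\<close>

lemma regular_edge:
  assumes conn: is_connected and n: "length C + 2 < card V" and L: "length C = 2 * k" and k: "2 \<le> k"
    and bound: "\<And>p. is_path p \<Longrightarrow> length p \<le> length C + 2"
    and nolong: "\<nexists>D. is_cycle D \<and> length D = Suc (length C)"
    and low: "at_most_one_low k"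
    and uv: "adj u v" "u \<notin> set C" "v \<notin> set C"
    and reg: "k \<le> card (nbrs u)" "k \<le> card (nbrs v)"
  shows "k \<le> 3 \<and> (\<exists>X\<subseteq>set C. card X = k - 1 \<and> nbrs u = insert v X \<and> nbrs v = insert u X)"
proof -
  define X where "X = nbrs u \<inter> set C"
  define Y where "Y = nbrs v \<inter> set C"
  have match: "y = z" if "adj x y" "adj x z" "x \<notin> set C" "y \<notin> set C" "z \<notin> set C" for x y z
    using outside_matching[OF conn bound low k] that by blast
  have nu: "nbrs u = insert v X" and nv: "nbrs v = insert u Y"
    using match[of u _ v] match[of v _ u] uv adj_sym[OF uv(1)] unfolding X_def Y_def nbrs_def by blast+
  have XC: "X \<subseteq> set C" "Y \<subseteq> set C" unfolding X_def Y_def by blast+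
  have fin: "finite X" "finite Y" using XC finite_subset by blast+
  have cX: "k - 1 \<le> card X" using reg(1) nu fin(1) by (simp add: card_insert_if split: if_splits)
  have cY: "k - 1 \<le> card Y" using reg(2) nv fin(2) by (simp add: card_insert_if split: if_splits)
  have XX: "\<sigma> x \<notin> X" if "x \<in> X" for x using outside_not_both[OF uv(2) _ _ nolong] that unfolding X_def by auto
  have YY: "\<sigma> x \<notin> Y" if "x \<in> Y" for x using outside_not_both[OF uv(3) _ _ nolong] that unfolding Y_def by auto
  have XY: "\<sigma> x \<notin> Y" "\<sigma> (\<sigma> x) \<notin> Y" if "x \<in> X" for x
    using edge_not_next[OF conn n bound uv] edge_not_next2[OF nolong uv] that unfolding X_def Y_def by auto
  have YX: "\<sigma> x \<notin> X" "\<sigma> (\<sigma> x) \<notin> X" if "x \<in> Y" for x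
    using edge_not_next[OF conn n bound adj_sym[OF uv(1)] uv(3,2)]
      edge_not_next2[OF nolong adj_sym[OF uv(1)] uv(3,2)] that unfolding X_def Y_def by auto
  let ?U = "X \<union> Y"
  have disj: "?U \<inter> \<sigma> ` ?U = {}" using XX YY XY YX by blast
  have UC: "?U \<subseteq> set C" "\<sigma> ` ?U \<subseteq> set C" using XC by auto
  have sum: "card (?U \<union> \<sigma> ` ?U) = 2 * card ?U"
    using disj card_next_image[OF UC(1)] fin by (simp add: card_Un_disjoint)
  have "card (?U \<union> \<sigma> ` ?U) \<le> 2 * k" using card_mono[of "set C" "?U \<union> \<sigma> ` ?U"] UC card_C L by simp
  then have cU: "card ?U \<le> k" using sum by simp
  have XU: "card X \<le> card ?U" "card Y \<le> card ?U" using fin by (auto intro: card_mono)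
  \<comment> \<open>If the union had \<open>k\<close> elements, it would alternate with the rest of
    the cycle. Two steps from \<open>X\<close> then stay in the union but avoid \<open>Y\<close>, so
    the sizes of \<open>X\<close> and \<open>Y\<close> add up to at most \<open>k\<close>. Only
    \<open>k = 2\<close> survives, where two steps would lead from the single vertex of
    \<open>X\<close> back to itself.\<close>
  have "card ?U \<noteq> k"
  proof
    assume c: "card ?U = k"
    then have all: "set C = ?U \<union> \<sigma> ` ?U"
      using card_subset_eq[of "set C" "?U \<union> \<sigma> ` ?U"] UC sum card_C L by auto
    have U2: "\<sigma> (\<sigma> x) \<in> ?U" if "x \<in> ?U" for x
      using alternate_next[OF all disj that] .
    have "\<sigma> ` \<sigma> ` X \<subseteq> ?U - Y" using U2 XY by blast
    then have "card (\<sigma> ` \<sigma> ` X) \<le> card (?U - Y)" using fin by (intro card_mono) auto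
    moreover have "card (\<sigma> ` \<sigma> ` X) = card X"
      by (rule card_next_next_image[OF XC(1)])
    moreover have "card (?U - Y) = k - card Y" using c fin by (simp add: card_Diff_subset)
    ultimately have k2: "k = 2" "card X = 1" "card Y = 1" using cX cY k by auto
    then obtain x where x: "X = {x}" by (auto simp: card_1_singleton_iff)
    then have "\<sigma> (\<sigma> x) \<in> X" using U2[of x] XY(2)[of x] by auto
    then show False using x next_step[of x] XC by auto
  qed
  then have eq: "card ?U = k - 1" using cU XU cX by simp
  then have "X = ?U" "Y = ?U"
    using card_subset_eq[of ?U X] card_subset_eq[of ?U Y] XU cX cY fin by auto
  then have XeY: "Y = X" and cXk: "card X = k - 1" using eq by simp_all
  have "card (X \<union> (\<sigma> ` X \<union> \<sigma> ` \<sigma> ` X)) = card X + (card (\<sigma> ` X) + card (\<sigma> ` \<sigma> ` X))"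
  proof -
    have "\<sigma> ` X \<inter> \<sigma> ` \<sigma> ` X = {}"
    proof -
      have "\<sigma> x \<noteq> \<sigma> (\<sigma> y)" if "x \<in> X" "y \<in> X" for x y
      proof
        assume "\<sigma> x = \<sigma> (\<sigma> y)"
        moreover have "x \<in> set C" "\<sigma> y \<in> set C" using that XC(1) by (blast intro: next_in)+
        ultimately have "x = \<sigma> y" using next_inj[of x "\<sigma> y"] by blast
        then show False using XX[OF that(2)] that(1) by blast
      qed
      then show ?thesis by blast
    qed
    moreover have "X \<inter> (\<sigma> ` X \<union> \<sigma> ` \<sigma> ` X) = {}" using XX XY XeY by blast
    ultimately show ?thesis using fin by (simp add: card_Un_disjoint)
  qed
  moreover have "card (\<sigma> ` X) = card X" "card (\<sigma> ` \<sigma> ` X) = card X"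
    using card_next_image[OF XC(1)] card_next_next_image[OF XC(1)] by blast+
  moreover have "card (X \<union> (\<sigma> ` X \<union> \<sigma> ` \<sigma> ` X)) \<le> 2 * k"
    using card_mono[of "set C" "X \<union> (\<sigma> ` X \<union> \<sigma> ` \<sigma> ` X)"] XC(1) card_C L
      next_image_subset[OF XC(1)] next_image_subset[OF next_image_subset[OF XC(1)]] by simp
  ultimately have "k \<le> 3" using cXk by simp
  then show ?thesis using XC(1) cXk nu nv XeY by blast
qed

text \<open>The only edge off the cycle, \<open>uv\<close>, becomes the exceptional edge. A further
  vertex \<open>r\<close> supplies the cover: its \<open>k\<close> neighbours \<open>A\<close>
  alternate with the rest of the cycle, and it remains to see that nothing off the cycle is adjacent
  to that rest.\<close>

lemma pendant_edge:
  assumes conn: is_connected and n: "length C + 2 < card V" and L: "length C = 2 * k" and k: "2 \<le> k"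
    and bound: "\<And>p. is_path p \<Longrightarrow> length p \<le> length C + 2"
    and nolong: "\<nexists>D. is_cycle D \<and> length D = Suc (length C)"
    and low: "at_most_one_low k"
    and uv: "adj u v" "u \<notin> set C" "v \<notin> set C" and v: "card (nbrs v) < k"
    and only: "\<And>x y. adj x y \<Longrightarrow> x \<notin> set C \<Longrightarrow> y \<notin> set C \<Longrightarrow> {x, y} = {u, v}"
  shows "covered_but_edge k"
proof -
  have UV: "u \<in> V" "v \<in> V" "u \<noteq> v" using adj_V[OF uv(1)] adj_neq[OF uv(1)] by auto
  have reg: "k \<le> card (nbrs x)" if "x \<in> V" "x \<noteq> v" for x
    using low_unique[OF low that(1) UV(2) that(2)] v by simp
  have "card (set C \<union> {u, v}) < card V"
    using card_Un_le[of "set C" "{u, v}"] card_C n UV(3) by simp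
  then have "\<not> V \<subseteq> set C \<union> {u, v}" using card_mono[of "set C \<union> {u, v}" V] by auto
  then obtain r where r: "r \<in> V" "r \<notin> set C" "r \<noteq> u" "r \<noteq> v" by blast
  have iso: "nbrs q \<subseteq> set C" if "q \<notin> set C" "q \<noteq> u" "q \<noteq> v" for q
    using only[of q] that unfolding nbrs_def by blast
  define A where "A = nbrs r"
  have AC: "A \<subseteq> set C" unfolding A_def using iso r by blast
  have rA: "adj r a" if "a \<in> A" for a using that by (simp add: A_def)
  have fin: "finite A" using AC finite_subset by blast
  have disj: "A \<inter> \<sigma> ` A = {}"
    using outside_not_both[OF r(2) _ _ nolong] AC unfolding A_def nbrs_def by blast
  have sub: "A \<union> \<sigma> ` A \<subseteq> set C" using AC by auto
  have sum: "card (A \<union> \<sigma> ` A) = 2 * card A"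
    using disj card_next_image[OF AC] fin by (simp add: card_Un_disjoint)
  have "2 * card A \<le> 2 * k" using card_mono[OF _ sub] sum card_C L by simp
  then have cA: "card A = k" using reg[of r] r unfolding A_def by simp
  then have all: "set C = A \<union> \<sigma> ` A" using card_subset_eq[OF _ sub] sum card_C L by simp
  have A2: "\<sigma> (\<sigma> x) \<in> A" if "x \<in> A" for x
    using alternate_next[OF all disj that] .
  \<comment> \<open>Opening the cycle at an edge and hanging three vertices in total on its ends
    exceeds the bound.\<close>
  have no: False if h: "x \<in> set C" "is_path p" "is_path q" "set p \<inter> set C = {}" "set q \<inter> set C = {}"
    "set p \<inter> set q = {}" "adj (last p) x" "adj (\<sigma> x) (hd q)" "length p + length q = 3" for x p q
  proof -
    obtain P where "is_path P" "length P = length p + length C + length q"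
      using path_through[OF h(1-8)] by blast
    then show False using bound[of P] h(9) by simp
  qed
  have XA: "x \<in> A" if x: "x \<in> set C" "adj u x \<or> adj v x" for x
  proof (rule ccontr)
    assume "x \<notin> A"
    then obtain a where a: "a \<in> A" "x = \<sigma> a" using all x(1) by blast
    have aC: "a \<in> set C" using a AC by blast
    have "adj (\<sigma> a) u \<or> adj (\<sigma> a) v" using x(2) a(2) adj_sym by blast
    then show False
    proof
      assume "adj (\<sigma> a) u"
      then show False using no[OF aC, of "[r]" "[u, v]"] r uv rA[OF a(1)] by simp
    next
      assume "adj (\<sigma> a) v"
      then show False using no[OF aC, of "[r]" "[v, u]"] r uv adj_sym[OF uv(1)] rA[OF a(1)] by simp
    qed
  qed
  define X where "X = nbrs u \<inter> set C"
  have XsubA: "X \<subseteq> A" using XA unfolding X_def nbrs_def by blast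
  have "x = v" if "adj u x" "x \<notin> set C" for x
    using only[OF that(1) uv(2) that(2)] UV(3) by (simp add: doubleton_eq_iff)
  then have "nbrs u \<subseteq> insert v X" unfolding X_def nbrs_def by blast
  then have "k \<le> card (insert v X)"
    using reg[OF UV(1,3)] card_mono[of "insert v X" "nbrs u"] by (simp add: X_def)
  then have cX: "k - 1 \<le> card X" by (simp add: card_insert_if X_def split: if_splits)
  have outA: "x \<in> A" if q: "q \<notin> set C" "q \<noteq> u" "q \<noteq> v" "adj q x" for q x
  proof (rule ccontr)
    assume "x \<notin> A"
    moreover have xC: "x \<in> set C" using iso[OF q(1-3)] q(4) by auto
    ultimately obtain a where a: "a \<in> A" "x = \<sigma> a" using all by blast
    have aC: "a \<in> set C" using a AC by blast
    have qV: "q \<in> V" using q(4) adj_V by blast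
    show False
    proof (cases "a \<in> X")
      case True
      then have "adj u a" by (simp add: X_def)
      moreover have "adj (\<sigma> a) q" using adj_sym[OF q(4)] a(2) by simp
      ultimately show False
        using no[OF aC, of "[v, u]" "[q]"] q(1-3) uv qV adj_sym[OF uv(1)] by simp
    next
      case False
      \<comment> \<open>\<open>X\<close> lies in \<open>A\<close> and has at least
        \<open>k - 1\<close> elements, so it contains one of \<open>a\<close> and
        \<open>\<sigma> (\<sigma> a)\<close>, the two neighbours of \<open>x\<close> along the
        cycle.\<close>
      have "\<sigma> (\<sigma> a) \<in> X"
      proof (rule ccontr)
        assume nX: "\<sigma> (\<sigma> a) \<notin> X"
        have ne: "\<sigma> (\<sigma> a) \<noteq> a" using next_step[OF aC] by blast
        have "X \<subseteq> A - {a, \<sigma> (\<sigma> a)}" using XsubA False nX by blast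
        then have "card X \<le> card (A - {a, \<sigma> (\<sigma> a)})" using fin by (intro card_mono) auto
        also have "\<dots> = k - 2"
          using A2[OF a(1)] a(1) ne cA fin by (subst card_Diff_subset) auto
        finally show False using cX k by simp
      qed
      then have "adj u (\<sigma> x)" using a(2) by (simp add: X_def)
      then have "adj (\<sigma> x) u" by (rule adj_sym)
      then show False
        using no[OF xC, of "[q]" "[u, v]"] q uv qV by simp
    qed
  qed
  have "x \<in> A \<or> y \<in> A \<or> {x, y} = {u, v}" if a: "adj x y" for x y
  proof (rule ccontr)
    assume neg: "\<not> (x \<in> A \<or> y \<in> A \<or> {x, y} = {u, v})"
    have out: "y \<in> A" if "adj x y" "x \<notin> set C" "y \<in> set C" for x y
      using XA[OF that(3)] outA[OF that(2)] that(1) by blast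
    have xy: "x \<in> set C" "y \<in> set C"
      using only[OF a] out[OF a] out[OF adj_sym[OF a]] neg by blast+
    then obtain b c where bc: "b \<in> A" "x = \<sigma> b" "c \<in> A" "y = \<sigma> c" using all neg by blast
    then have "b \<in> set C" "c \<in> set C" using AC by auto
    then show False using no_chord_next[OF r(2) _ _ rA[OF bc(1)] rA[OF bc(3)] nolong] a bc by blast
  qed
  moreover have "u \<notin> A" "v \<notin> A" using AC uv by auto
  moreover have "A \<subseteq> V" using AC C_V by blast
  ultimately show ?thesis unfolding covered_but_edge_def using cA UV by blast
qed

end

context simple_graph begin

text \<open>The distinction is whether some edge off the cycle has both ends of degree at least
  \<open>k\<close>. If none has, each of these edges contains the exceptional vertex, and since the
  edges off the cycle form a matching there is only one.\<close>

theorem cycle_edge_structure: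
  assumes conn: is_connected and cyc: "is_cycle C" and L: "length C = 2 * k"
    and n: "2 * k + 3 \<le> card V" and bound: "\<And>p. is_path p \<Longrightarrow> length p \<le> 2 * k + 2"
    and nolong: "\<nexists>D. is_cycle D \<and> length D = 2 * k + 1"
    and low: "at_most_one_low k"
    and uv: "adj u v" "u \<notin> set C" "v \<notin> set C"
  shows "covered_but_edge k \<or> k = 2 \<and> (block_cut 2 \<or> hub_star) \<or> k = 3 \<and> two_hubs"
proof -
  obtain \<sigma> where "oriented_cycle V adj C \<sigma>" using ex_oriented_cycle[OF cyc] by blast
  then interpret oriented_cycle V adj C \<sigma> .
  have k: "2 \<le> k" using L length_C by simp
  have n': "length C + 2 < card V" and bound': "\<And>p. is_path p \<Longrightarrow> length p \<le> length C + 2"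
    and nolong': "\<nexists>D. is_cycle D \<and> length D = Suc (length C)"
    using n bound nolong L by auto
  have match: "y = z" if "adj x y" "adj x z" "x \<notin> set C" "y \<notin> set C" "z \<notin> set C" for x y z
    using outside_matching[OF conn bound' low k] that by blast
  show ?thesis
  proof (cases "\<exists>u v. adj u v \<and> u \<notin> set C \<and> v \<notin> set C \<and> k \<le> card (nbrs u) \<and> k \<le> card (nbrs v)")
    case False
    have bad: "card (nbrs x) < k \<or> card (nbrs y) < k" if "adj x y" "x \<notin> set C" "y \<notin> set C" for x y
      using False that by (meson not_le)
    have ex: "\<exists>u v. adj u v \<and> u \<notin> set C \<and> v \<notin> set C \<and> card (nbrs v) < k"
      using bad[OF uv] uv adj_sym[OF uv(1)] by blast
    then obtain u v where w: "adj u v" "u \<notin> set C" "v \<notin> set C" "card (nbrs v) < k" by blast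
    have "{x, y} = {u, v}" if a: "adj x y" "x \<notin> set C" "y \<notin> set C" for x y
    proof -
      have eq: "x' = u" if "adj x' v" "x' \<notin> set C" for x'
        using match[OF adj_sym[OF that(1)] adj_sym[OF w(1)] w(3) that(2) w(2)] .
      have lw: "x' = v" if "x' \<in> V" "card (nbrs x') < k" for x'
      proof (rule ccontr)
        assume "x' \<noteq> v"
        then show False using low_unique[OF low, of x' v] that w(4) adj_V[OF w(1)] by simp
      qed
      have "x = v \<or> y = v" using bad[OF a] lw adj_V[OF a(1)] by blast
      then show ?thesis using eq[of x] eq[of y] a adj_sym[OF a(1)] by blast
    qed
    then have "covered_but_edge k"
      using pendant_edge[OF conn n' L k bound' nolong' low w] by blast
    then show ?thesis ..
  next
    case True
    then obtain u v where w: "adj u v" "u \<notin> set C" "v \<notin> set C" "k \<le> card (nbrs u)" "k \<le> card (nbrs v)" by blast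
    obtain X where k3: "k \<le> 3" and X: "X \<subseteq> set C" "card X = k - 1" "nbrs u = insert v X" "nbrs v = insert u X"
      using regular_edge[OF conn n' L k bound' nolong' low w] by blast
    \<comment> \<open>Starting the list at a common neighbour of \<open>u\<close> and
      \<open>v\<close> fixes the labels for the small cases.\<close>
    obtain c0 where c0: "c0 \<in> X" using X(2) k by fastforce
    have "c0 \<in> set C" using c0 X(1) by blast
    then obtain Q where Q: "is_path Q" "set Q = set C" "length Q = length C" "hd Q = c0" "last Q = \<sigma> c0"
      by (rule path_from)
    have cycQ: "is_cycle Q"
      using Q next_step[OF \<open>c0 \<in> set C\<close>] adj_sym length_C unfolding is_cycle_def by auto
    have k23: "k = 2 \<or> k = 3" using k k3 by auto
    then show ?thesis
    proof
      assume k2: "k = 2"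
      then obtain c1 c2 c3 where Qe: "Q = [c0, c1, c2, c3]"
        using Q(3,4) L by (auto simp: length_Suc_conv numeral_eq_Suc)
      have "X = {c0}" using X(2) c0 k2 by (auto simp: card_1_singleton_iff)
      moreover have sC: "set C = {c0, c1, c2, c3}" using Q(2) Qe by auto
      ultimately have "block_cut 2 \<or> hub_star"
        using w X bound k2 match
        by (intro four_cycle_structure[of c0 c1 c2 c3 u v]) (use cycQ Qe in auto)
      then show ?thesis using k2 by blast
    next
      assume k3: "k = 3"
      then obtain c1 c2 c3 c4 c5 where Qe: "Q = [c0, c1, c2, c3, c4, c5]"
        using Q(3,4) L by (auto simp: length_Suc_conv numeral_eq_Suc)
      have sC: "set C = {c0, c1, c2, c3, c4, c5}" using Q(2) Qe by auto
      have C: "distinct [c0, c1, c2, c3, c4, c5]" "{c0, c1, c2, c3, c4, c5} \<subseteq> V"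
        and A: "adj c0 c1" "adj c1 c2" "adj c2 c3" "adj c3 c4" "adj c4 c5" "adj c5 c0"
        using cycQ Qe by (auto simp: is_cycle_def is_path_def)
      note S = A A[THEN adj_sym]
      have uvV: "u \<in> V" "v \<in> V" "u \<noteq> v" using adj_V[OF w(1)] adj_neq[OF w(1)] by auto
      have out: "u \<notin> {c0, c1, c2, c3, c4, c5}" "v \<notin> {c0, c1, c2, c3, c4, c5}" using w sC by auto
      have u0: "adj u c0" "adj v c0" using X(3,4) c0 mem_nbrs by blast+
      note S' = S u0 u0[THEN adj_sym] w(1) adj_sym[OF w(1)]
      have nocyc: "\<not> is_cycle p" if "length p = 7" for p using nolong k3 that by auto
      \<comment> \<open>Any second neighbour except the opposite vertex \<open>c3\<close> closes a
        cycle on seven vertices, through \<open>u\<close> alone or through \<open>u\<close> and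
        \<open>v\<close>.\<close>
      have "adj u c1 \<Longrightarrow> is_cycle [u, c1, c2, c3, c4, c5, c0]"
        using C S' uvV out by (auto simp: is_cycle_def is_path_def)
      then have 1: "c1 \<notin> X" using nocyc X(3) by fastforce
      have "adj u c5 \<Longrightarrow> is_cycle [u, c5, c4, c3, c2, c1, c0]"
        using C S' uvV out by (auto simp: is_cycle_def is_path_def)
      then have 5: "c5 \<notin> X" using nocyc X(3) by fastforce
      have "adj u c2 \<Longrightarrow> is_cycle [u, c2, c3, c4, c5, c0, v]"
        using C S' uvV out by (auto simp: is_cycle_def is_path_def)
      then have 2: "c2 \<notin> X" using nocyc X(3) by fastforce
      have "adj u c4 \<Longrightarrow> is_cycle [u, c4, c3, c2, c1, c0, v]"
        using C S' uvV out by (auto simp: is_cycle_def is_path_def)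
      then have 4: "c4 \<notin> X" using nocyc X(3) by fastforce
      have "X \<subseteq> {c0, c3}" using 1 2 4 5 X(1) sC by blast
      moreover have "card {c0, c3} = 2" using C(1) by simp
      ultimately have Xe: "X = {c0, c3}" using X(2) k3 card_subset_eq[of "{c0, c3}" X] by simp
      have two_hubs
      proof (rule six_cycle_structure[of c0 c1 c2 c3 c4 c5 u v])
        show "is_cycle [c0, c1, c2, c3, c4, c5]" using cycQ Qe by simp
        show "length p \<le> 8" if "is_path p" for p using bound[OF that] k3 by simp
        show "y = z" if "adj x y" "adj x z" "{x, y, z} \<inter> {c0, c1, c2, c3, c4, c5} = {}" for x y z
          using match[OF that(1,2)] that(3) sC by blast
        show "nbrs u = {c0, c3, v}" "nbrs v = {c0, c3, u}" using X(3,4) Xe by auto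
        show "9 \<le> card V" "at_most_one_low 3" using n low k3 by simp_all
      qed (use w out conn in blast)+
      then show ?thesis using k3 by blast
    qed
  qed
qed

end

section \<open>Components after deleting cut vertices\<close>

context simple_graph begin

text \<open>Reachability avoiding \<open>Z\<close>; for a vertex off \<open>Z\<close> its component
  after deleting \<open>Z\<close>, and for \<open>x\<close> in \<open>Z\<close> just
  \<open>{x}\<close>.\<close>

definition component :: "'a set \<Rightarrow> 'a \<Rightarrow> 'a set" where
  "component Z x = {y. (x, y) \<in> {(a, b). adj a b \<and> a \<notin> Z \<and> b \<notin> Z}\<^sup>*}"

lemma component_refl [simp]: "x \<in> component Z x"
  by (simp add: component_def)

lemma component_sym: "y \<in> component Z x \<Longrightarrow> x \<in> component Z y"
proof -
  have "sym {(a, b). adj a b \<and> a \<notin> Z \<and> b \<notin> Z}" using adj_sym by (auto simp: sym_def)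
  then show "y \<in> component Z x \<Longrightarrow> x \<in> component Z y"
    unfolding component_def using sym_rtrancl[THEN symD] by fastforce
qed

lemma component_trans: "y \<in> component Z x \<Longrightarrow> z \<in> component Z y \<Longrightarrow> z \<in> component Z x"
  unfolding component_def by (auto intro: rtrancl_trans)

lemma component_eq: "y \<in> component Z x \<Longrightarrow> component Z y = component Z x"
  using component_trans component_sym by blast

lemma component_step:
  "y \<in> component Z x \<Longrightarrow> adj y z \<Longrightarrow> y \<notin> Z \<Longrightarrow> z \<notin> Z \<Longrightarrow> z \<in> component Z x"
  unfolding component_def by (auto intro: rtrancl_into_rtrancl)

lemma component_adj: "adj x y \<Longrightarrow> x \<notin> Z \<Longrightarrow> y \<notin> Z \<Longrightarrow> component Z x = component Z y"
  using component_step[of x Z x y] component_eq by simp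

lemma component_subset:
  assumes "x \<in> S" "\<And>a b. a \<in> S \<Longrightarrow> adj a b \<Longrightarrow> b \<notin> Z \<Longrightarrow> b \<in> S"
  shows "component Z x \<subseteq> S"
proof
  fix y assume "y \<in> component Z x"
  then have "(x, y) \<in> {(a, b). adj a b \<and> a \<notin> Z \<and> b \<notin> Z}\<^sup>*" by (simp add: component_def)
  then show "y \<in> S" by induction (use assms in auto)
qed

lemma component_in:
  assumes "x \<in> V - Z"
  shows "component Z x \<subseteq> V - Z"
  using assms adj_V by (intro component_subset) auto

text \<open>A component is itself connected, in the cut form that \<open>small_component\<close>
  expects.\<close>

lemma component_edge:
  assumes x: "x \<in> V - Z" and T: "T \<subseteq> component Z x" "T \<noteq> {}" "T \<noteq> component Z x"
  shows "\<exists>t\<in>T. \<exists>s\<in>component Z x - T. adj t s"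
proof (rule ccontr)
  assume neg: "\<not> ?thesis"
  obtain t where t: "t \<in> T" using T by blast
  have "component Z t \<subseteq> T"
  proof (rule component_subset[OF t])
    fix a b assume ab: "a \<in> T" "adj a b" "b \<notin> Z"
    have "a \<notin> Z" using ab(1) T(1) component_in[OF x] by blast
    then have "b \<in> component Z x" using component_step[of a Z x b] ab T(1) by blast
    then show "b \<in> T" using neg ab by blast
  qed
  moreover have "component Z t = component Z x" using component_eq t T(1) by blast
  ultimately show False using T by blast
qed

lemma component_path:
  assumes "y \<in> component Z x" "x \<in> V - Z"
  shows "\<exists>q. is_path q \<and> hd q = x \<and> last q = y \<and> set q \<subseteq> component Z x"
proof -
  have "(x, y) \<in> {(a, b). adj a b \<and> a \<notin> Z \<and> b \<notin> Z}\<^sup>*" using assms(1) by (simp add: component_def)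
  then show ?thesis
  proof induction
    case base
    show ?case using assms(2) by (intro exI[of _ "[x]"]) auto
  next
    case (step b d)
    then obtain q where q: "is_path q" "hd q = x" "last q = b" "set q \<subseteq> component Z x" by blast
    have ne: "q \<noteq> []" using q(1) by auto
    have bd: "adj b d" "b \<notin> Z" "d \<notin> Z" using step by auto
    have "b \<in> component Z x" using step(1) by (simp add: component_def)
    then have d: "d \<in> component Z x" using component_step bd by blast
    show ?case
    proof (cases "d \<in> set q")
      case True
      then obtain as bs where s: "q = (as @ [d]) @ bs" by (metis split_list append_Cons append_Nil append_assoc)
      then have "is_path (as @ [d])" using q(1) is_path_append_iff[of "as @ [d]" bs] by (cases "bs = []") auto
      moreover have "hd (as @ [d]) = x" using s q(2) by (cases as) auto
      ultimately show ?thesis using s q(4) by (intro exI[of _ "as @ [d]"]) auto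
    next
      case False
      then have "is_path (q @ [d])" using q bd ne by (simp add: is_path_snoc_iff)
      then show ?thesis using q d ne by (intro exI[of _ "q @ [d]"]) auto
    qed
  qed
qed

text \<open>Rotation at the far end: the tail from \<open>t\<close> on is reversed through an edge
  to its last vertex, so that \<open>t\<close> comes last and the path continues to
  \<open>s\<close>.\<close>

lemma reroute_path:
  assumes "is_path (c # as @ t # bs)" "adj (last (c # as)) (last (t # bs))"
    "adj t s" "s \<notin> set (c # as @ t # bs)"
  shows "is_path (c # as @ rev (t # bs) @ [s])"
proof -
  have 1: "is_path (c # as)" "is_path (t # bs)" "set (c # as) \<inter> set (t # bs) = {}"
    using assms(1) is_path_append_iff[of "c # as" "t # bs"] by auto
  have "is_path (rev (t # bs) @ [s])"
    using 1(2) assms(3,4) is_path_snoc_iff[of "rev (t # bs)" s] is_path_rev[of "t # bs"] by simp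
  moreover have "adj (last (c # as)) (hd (rev (t # bs) @ [s]))"
    using assms(2) hd_rev[of "t # bs"] by (simp del: last.simps rev.simps)
  moreover have "set (c # as) \<inter> set (rev (t # bs) @ [s]) = {}" using 1(3) assms(4) by auto
  ultimately have "is_path ((c # as) @ rev (t # bs) @ [s])"
    by (intro is_path_appendI[OF 1(1)])
  then show ?thesis by simp
qed

text \<open>The last vertex of a longest path from \<open>c\<close> into \<open>D\<close> has all
  its neighbours among \<open>c\<close> and the earlier path vertices, at most \<open>k\<close>
  candidates. Degree \<open>k\<close> makes it adjacent to all of them, so every path vertex can be
  rotated to the end and an edge leaving the path would lengthen it. Hence the path covers
  \<open>D\<close>.\<close>

lemma small_component_aux:
  assumes closed: "\<And>x y. x \<in> D \<Longrightarrow> adj x y \<Longrightarrow> y \<in> D \<or> y = c"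
    and connD: "\<And>T. T \<subseteq> D \<Longrightarrow> T \<noteq> {} \<Longrightarrow> T \<noteq> D \<Longrightarrow> \<exists>t\<in>T. \<exists>s\<in>D - T. adj t s"
    and p: "is_path (c # p)" "set p \<subseteq> D" "p \<noteq> []" "length p \<le> k" and c: "c \<notin> D"
    and max: "\<And>q. is_path (c # q) \<Longrightarrow> set q \<subseteq> D \<Longrightarrow> length q \<le> length p"
    and reg: "k \<le> card (nbrs (last p))"
  shows "card D \<le> k"
proof -
  have nb: "nbrs (last p) \<subseteq> set (c # butlast p)"
  proof
    fix y assume "y \<in> nbrs (last p)"
    then have y: "adj (last p) y" by simp
    have "y \<in> set (c # p)"
    proof (rule ccontr)
      assume n: "y \<notin> set (c # p)"
      moreover have "last p \<in> D" using p(2,3) last_in_set by blast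
      ultimately have "y \<in> D" using closed[OF _ y] by auto
      moreover have "is_path (c # p @ [y])" using is_path_snoc_iff[of "c # p" y] p y n by simp
      ultimately show False using max[of "p @ [y]"] p(2) by simp
    qed
    moreover have "set p = insert (last p) (set (butlast p))"
      using p(3) by (metis Un_insert_right append_butlast_last_id list.simps(15) set_append sup_bot.right_neutral list.set(1))
    ultimately show "y \<in> set (c # butlast p)" using adj_neq[OF y] by auto
  qed
  have len: "card (set (c # butlast p)) \<le> length p"
    using card_length[of "c # butlast p"] p(3) by simp
  moreover have "card (nbrs (last p)) \<le> card (set (c # butlast p))" using nb by (intro card_mono) auto
  ultimately have "nbrs (last p) = set (c # butlast p)"
    using reg p(4) by (intro card_subset_eq nb) auto
  then have full: "adj (last p) y" if "y \<in> set (c # butlast p)" for y using that by (metis mem_nbrs)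
  have "set p = D"
  proof (rule ccontr)
    assume "set p \<noteq> D"
    then obtain t s where ts: "t \<in> set p" "s \<in> D - set p" "adj t s" using connD[of "set p"] p by auto
    obtain as bs where s: "p = as @ t # bs" using ts(1) by (metis split_list)
    have "last (c # as) \<in> set (c # butlast p)" using s by (auto simp: butlast_append)
    then have "adj (last (c # as)) (last (t # bs))" using full adj_sym s by simp
    moreover have "s \<notin> set (c # p)" using ts(2) c by auto
    ultimately have "is_path (c # as @ rev (t # bs) @ [s])"
      using reroute_path[of c as t bs s] p(1) ts(3) s by simp
    moreover have "set (as @ rev (t # bs) @ [s]) \<subseteq> D" using s p(2) ts(2) by auto
    ultimately have "length (as @ rev (t # bs) @ [s]) \<le> length p" by (intro max) simp_all
    then show False using s by simp
  qed
  then show ?thesis using card_length[of p] p(4) by simp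
qed

text \<open>Reduces to a longest path whose last vertex is not exceptional. If the path ends in the
  exceptional vertex \<open>w\<close> and does not yet cover \<open>D\<close>, the vertex
  \<open>z\<close> before \<open>w\<close> either has a new neighbour, which replaces
  \<open>w\<close>, or is adjacent to the whole path, which permits rotations without
  \<open>w\<close>.\<close>

lemma small_component:
  assumes low: "at_most_one_low k" and k: "1 \<le> k"
    and D: "D \<subseteq> V" "c \<notin> D" "d \<in> D" "adj c d"
    and closed: "\<And>x y. x \<in> D \<Longrightarrow> adj x y \<Longrightarrow> y \<in> D \<or> y = c"
    and connD: "\<And>T. T \<subseteq> D \<Longrightarrow> T \<noteq> {} \<Longrightarrow> T \<noteq> D \<Longrightarrow> \<exists>t\<in>T. \<exists>s\<in>D - T. adj t s"
    and bound: "\<And>p. is_path (c # p) \<Longrightarrow> set p \<subseteq> D \<Longrightarrow> length p \<le> k"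
  shows "card D \<le> k"
proof -
  let ?P = "\<lambda>p. is_path (c # p) \<and> set p \<subseteq> D"
  have "?P [d]" using D by auto
  then obtain p where p: "is_path (c # p)" "set p \<subseteq> D" and max: "\<And>q. ?P q \<Longrightarrow> length q \<le> length p"
    using ex_has_greatest_nat[of ?P "[d]" length "Suc k"] bound by (auto simp: less_Suc_eq_le)
  have ne: "p \<noteq> []" using max[of "[d]"] \<open>?P [d]\<close> by auto
  have lenp: "length p \<le> k" using bound p by blast
  have aux: "card D \<le> k" if q: "is_path (c # q)" "set q \<subseteq> D" "length q = length p"
    "k \<le> card (nbrs (last q))" for q
  proof (rule small_component_aux[OF closed connD q(1,2) _ _ D(2) _ q(4)])
    show "q \<noteq> []" using q(3) ne by auto
    show "length q \<le> k" using q(3) lenp by simp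
    show "\<And>r. is_path (c # r) \<Longrightarrow> set r \<subseteq> D \<Longrightarrow> length r \<le> length q" using max q(3) by simp
  qed
  show ?thesis
  proof (cases "k \<le> card (nbrs (last p))")
    case True then show ?thesis using aux p by blast
  next
    case False
    define w where "w = last p"
    have w: "card (nbrs w) < k" "w \<in> D" using False ne p(2) unfolding w_def by auto
    have reg: "k \<le> card (nbrs x)" if "x \<in> D" "x \<noteq> w" for x
      using low_unique[OF low, of x w] that w D(1) by (meson not_le subsetD)
    define p' where "p' = butlast p"
    have pp: "p = p' @ [w]" using ne by (simp add: p'_def w_def)
    have longer: False if s: "s \<in> D - set p" "adj w s" for s
    proof -
      have "is_path (c # p @ [s])"
        using is_path_snoc_iff[of "c # p" s] p s ne D(2) by (auto simp: w_def)
      then show False using max[of "p @ [s]"] p(2) s by simp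
    qed
    have pD: "\<exists>t\<in>set p. \<exists>s\<in>D - set p. adj t s" if "set p \<noteq> D"
      using connD[of "set p"] p(2) ne that by simp
    have eqD: "card D \<le> k" if "set p = D" using card_length[of p] lenp that by simp
    show ?thesis
    proof (cases "p' = []")
      case True
      then have "set p = D" using pD longer pp by auto
      then show ?thesis by (rule eqD)
    next
      case p'ne: False
      define z where "z = last p'"
      have cp': "is_path (c # p')" using p(1) pp is_path_append_iff[of "c # p'" "[w]"] by simp
      have zw: "z \<in> set p'" "z \<noteq> w" "z \<in> D"
        using p'ne pp p(2) is_pathD(2)[OF p(1)] unfolding z_def by auto
      show ?thesis
      proof (cases "\<exists>s\<in>D - set p. adj z s")
        case True
        then obtain s where s: "s \<in> D" "s \<notin> set p" "adj z s" by blast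
        have "is_path (c # p' @ [s])"
          using is_path_snoc_iff[of "c # p'" s] cp' s p'ne D(2) pp by (auto simp: z_def)
        moreover have "s \<noteq> w" using s(2) pp by auto
        ultimately show ?thesis using aux[of "p' @ [s]"] reg[of s] s pp p(2) by simp
      next
        case noz: False
        have sub: "nbrs z \<subseteq> set (c # p) - {z}"
        proof
          fix y assume "y \<in> nbrs z"
          then have y: "adj z y" by simp
          then have "y \<in> D \<or> y = c" using closed zw(3) by blast
          then show "y \<in> set (c # p) - {z}" using noz y adj_neq[OF y] by auto
        qed
        have "card (set (c # p) - {z}) = length p"
          using distinct_card[OF is_pathD(2)[OF p(1)]] zw(1) pp by (subst card_Diff_singleton) auto
        moreover have "k \<le> card (nbrs z)" using reg zw by blast
        ultimately have "nbrs z = set (c # p) - {z}"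
          using lenp card_mono[OF _ sub] by (intro card_subset_eq sub) auto
        then have full: "adj z y" if "y \<in> set (c # p)" "y \<noteq> z" for y using that mem_nbrs by blast
        show ?thesis
        proof (cases "set p = D")
          case True then show ?thesis by (rule eqD)
        next
          case False
          \<comment> \<open>Dropping \<open>w\<close> and rotating the rest around \<open>z\<close>
            puts \<open>t\<close> last; appending \<open>s\<close> restores the length, now with a
            last vertex of degree at least \<open>k\<close>.\<close>
          then obtain t s where ts: "t \<in> set p" "s \<in> D - set p" "adj t s" using pD by blast
          have "t \<noteq> w" using longer ts by blast
          then have "t \<in> set p'" using ts(1) pp by auto
          then obtain as bs where ab: "p' = as @ t # bs" by (metis split_list)
          have "last (t # bs) = z" using ab by (simp add: z_def)
          moreover have "last (c # as) \<in> set (c # p)" using ab pp by auto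
          moreover have "last (c # as) \<noteq> z"
            using cp' ab is_path_append_iff[of "c # as" "t # bs"] calculation(1)
              last_in_set[of "c # as"] last_in_set[of "t # bs"] by auto
          ultimately have "adj (last (c # as)) (last (t # bs))" using full adj_sym by metis
          moreover have "s \<notin> set (c # p')" using ts(2) D(2) pp by auto
          ultimately have "is_path (c # as @ rev (t # bs) @ [s])"
            using reroute_path[of c as t bs s] cp' ab ts(3) by simp
          moreover have "s \<noteq> w" using ts(2) pp by auto
          ultimately show ?thesis
            using aux[of "as @ rev (t # bs) @ [s]"] reg[of s] ts(2) ab pp p(2) by simp
        qed
      qed
    qed
  qed
qed

lemma component_attached:
  assumes conn: is_connected and x: "x \<in> V - Z" and Z: "Z \<noteq> {}" "Z \<subseteq> V"
  shows "\<exists>d\<in>component Z x. \<exists>c\<in>Z. adj d c"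
proof -
  let ?K = "component Z x"
  have K: "?K \<subseteq> V - Z" by (rule component_in[OF x])
  then have "?K \<subseteq> V" "?K \<noteq> {}" "?K \<noteq> V" using Z component_refl[of x Z] by blast+
  then obtain d e where de: "d \<in> ?K" "e \<in> V - ?K" "adj d e" by (rule connectedE[OF conn])
  then have "e \<in> Z" using component_step[of d Z x e] K by blast
  then show ?thesis using de by blast
qed

text \<open>A component that misses \<open>D\<close> hangs at \<open>c\<close>, and paths from
  \<open>c\<close> into it avoid \<open>D\<close>, so the path bound applies to them.\<close>

lemma component_card_le:
  assumes conn: is_connected and low: "at_most_one_low k" and k: "1 \<le> k"
    and c: "c \<in> V" and closed: "\<And>x y. x \<in> D \<Longrightarrow> adj x y \<Longrightarrow> y \<in> D \<or> y = c"
    and bound: "\<And>p. is_path (c # p) \<Longrightarrow> set p \<inter> D = {} \<Longrightarrow> length p \<le> k"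
    and x: "x \<in> V - {c} - D"
  shows "card (component {c} x) \<le> k"
proof -
  let ?K = "component {c} x"
  have xV: "x \<in> V - {c}" using x by blast
  have K: "?K \<subseteq> V - {c}" by (rule component_in[OF xV])
  have KD: "?K \<inter> D = {}"
  proof -
    have "?K \<subseteq> - D - {c}"
    proof (rule component_subset)
      fix a b assume "a \<in> - D - {c}" "adj a b" "b \<notin> {c}"
      then show "b \<in> - D - {c}" using closed[of b a] adj_sym[of a b] by blast
    qed (use x in blast)
    then show ?thesis by blast
  qed
  obtain d where d: "d \<in> ?K" "adj d c" using component_attached[OF conn xV] c by auto
  show ?thesis
  proof (rule small_component[OF low k _ _ d(1) adj_sym[OF d(2)]])
    show "?K \<subseteq> V" "c \<notin> ?K" using K by auto
    show "y \<in> ?K \<or> y = c" if "z \<in> ?K" "adj z y" for z y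
      using component_step[of z "{c}" x y] that K by blast
    show "\<exists>t\<in>T. \<exists>s\<in>?K - T. adj t s" if "T \<subseteq> ?K" "T \<noteq> {}" "T \<noteq> ?K" for T
      using component_edge[OF xV that] .
    show "length p \<le> k" if "is_path (c # p)" "set p \<subseteq> ?K" for p
      using bound[OF that(1)] that(2) KD by blast
  qed
qed

lemma component_class_card_le:
  assumes "x \<in> V - Z" "card (component Z x) \<le> k"
  shows "card {y \<in> S. component Z y = component Z x} \<le> k"
proof -
  have "{y \<in> S. component Z y = component Z x} \<subseteq> component Z x" using component_refl by blast
  moreover have "finite (component Z x)" using component_in[OF assms(1)] finite_V finite_subset by blast
  ultimately show ?thesis using assms(2) card_mono by (meson order_trans)
qed

text \<open>In its use a path runs through all of \<open>D\<close> into \<open>c\<close>; this is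
  where the bound on continuations from \<open>c\<close> comes from.\<close>

lemma block_cutI:
  assumes conn: is_connected and low: "at_most_one_low k" and k: "1 \<le> k"
    and c: "c \<in> V" and D: "D \<subseteq> V - {c}" "card D \<le> k + 1"
    and closed: "\<And>x y. x \<in> D \<Longrightarrow> adj x y \<Longrightarrow> y \<in> D \<or> y = c"
    and bound: "\<And>p. is_path (c # p) \<Longrightarrow> set p \<inter> D = {} \<Longrightarrow> length p \<le> k"
  shows "block_cut k"
proof -
  have "card {y \<in> V - {c} - D. component {c} y = component {c} x} \<le> k"
    if x: "x \<in> V - {c} - D" for x
  proof (rule component_class_card_le)
    show "card (component {c} x) \<le> k"
      by (rule component_card_le[OF conn low k c _ _ x]) (use closed bound in blast)+
  qed (use x in blast)
  moreover have "(x \<in> D \<and> y \<in> D) \<or> (x \<notin> D \<and> y \<notin> D \<and> component {c} x = component {c} y)"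
    if "adj x y" "x \<noteq> c" "y \<noteq> c" for x y
    using closed[of x y] closed[of y x] component_adj[of x y "{c}"] that adj_sym by blast
  ultimately show ?thesis unfolding block_cut_def using c D by blast
qed

text \<open>Case (ii) without a block on \<open>k + 1\<close> vertices. The spare vertex is what
  \<open>leaf_target\<close> uses to put a deleted leaf back.\<close>

definition small_components :: "nat \<Rightarrow> bool" where
  "small_components k \<longleftrightarrow> (\<exists>c\<in>V. \<forall>x\<in>V - {c}. card (component {c} x) \<le> k)"

lemma small_componentsI:
  assumes conn: is_connected and low: "at_most_one_low k" and k: "1 \<le> k"
    and c: "c \<in> V" and D: "finite D" "card D \<le> k"
    and closed: "\<And>x y. x \<in> D \<Longrightarrow> adj x y \<Longrightarrow> y \<in> D \<or> y = c"
    and bound: "\<And>p. is_path (c # p) \<Longrightarrow> set p \<inter> D = {} \<Longrightarrow> length p \<le> k"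
  shows "small_components k"
proof -
  have "card (component {c} x) \<le> k" if x: "x \<in> V - {c}" for x
  proof (cases "x \<in> D")
    case True
    then have "component {c} x \<subseteq> D" using closed by (intro component_subset) auto
    then show ?thesis using D card_mono by (meson order_trans)
  next
    case False
    then have xD: "x \<in> V - {c} - D" using x by blast
    show ?thesis by (rule component_card_le[OF conn low k c _ _ xD]) (use closed bound in blast)+
  qed
  then show ?thesis unfolding small_components_def using c by blast
qed

lemma small_components_block_cut:
  assumes "small_components k"
  shows "block_cut k"
proof -
  obtain c where c: "c \<in> V" "\<And>x. x \<in> V - {c} \<Longrightarrow> card (component {c} x) \<le> k"
    using assms unfolding small_components_def by blast
  have "card {y \<in> V - {c} - {}. component {c} y = component {c} x} \<le> k" if "x \<in> V - {c} - {}" for x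
    using component_class_card_le[of x "{c}" k] c(2) that by blast
  moreover have "component {c} x = component {c} y" if "adj x y" "x \<noteq> c" "y \<noteq> c" for x y
    using component_adj[of x y "{c}"] that by blast
  ultimately show ?thesis
    unfolding block_cut_def using c(1) by (intro bexI[of _ c] exI[of _ "{}"] exI[of _ "component {c}"]) auto
qed

text \<open>Case (iii): \<open>side\<close> tells at which of the two centres a class hangs, and
  each class of \<open>l\<close> fits into a copy of K_k.\<close>

definition linked :: "nat \<Rightarrow> bool" where
  "linked k \<longleftrightarrow> (\<exists>c1\<in>V. \<exists>c2\<in>V - {c1}. \<exists>side. \<exists>l :: 'a \<Rightarrow> 'a set.
     (\<forall>x y. adj x y \<longrightarrow> {x, y} \<inter> {c1, c2} = {} \<longrightarrow> l x = l y \<and> (side x \<longleftrightarrow> side y)) \<and>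
     (\<forall>x. adj c1 x \<longrightarrow> x \<noteq> c2 \<longrightarrow> side x) \<and> (\<forall>x. adj c2 x \<longrightarrow> x \<noteq> c1 \<longrightarrow> \<not> side x) \<and>
     (\<forall>x\<in>V - {c1, c2}. card {y \<in> V - {c1, c2}. l y = l x} \<le> k))"

text \<open>The path already has the maximal order \<open>2 * k + 2\<close>. A component adjacent to
  both centres could be inserted between \<open>c1\<close> and \<open>c2\<close>; a component at one
  centre is short because the other half of the path can be put in front of it.\<close>

lemma linkedI:
  assumes conn: is_connected and low: "at_most_one_low k" and k: "1 \<le> k"
    and P: "is_path (p1 @ [c1, c2] @ p2)" "length p1 = k" "length p2 = k"
    and closed1: "\<And>x y. x \<in> set p1 \<Longrightarrow> adj x y \<Longrightarrow> y \<in> set p1 \<or> y = c1"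
    and closed2: "\<And>x y. x \<in> set p2 \<Longrightarrow> adj x y \<Longrightarrow> y \<in> set p2 \<or> y = c2"
    and bound: "\<And>p. is_path p \<Longrightarrow> length p \<le> 2 * k + 2"
  shows "linked k"
proof -
  have ne: "p1 \<noteq> []" "p2 \<noteq> []" using P k by auto
  have V: "c1 \<in> V" "c2 \<in> V" and dist: "distinct (p1 @ [c1, c2] @ p2)" and sub: "set p1 \<subseteq> V" "set p2 \<subseteq> V"
    using is_pathD[OF P(1)] by auto
  have "is_path p1 \<and> is_path ([c1, c2] @ p2) \<and> adj (last p1) c1"
    using P(1) is_path_append_iff[of p1 "[c1, c2] @ p2"] ne by simp
  moreover from this have "adj c1 c2" "is_path p2" "adj c2 (hd p2)"
    using is_path_append_iff[of "[c1, c2]" p2] ne by auto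
  ultimately have A: "is_path p1" "is_path p2" "adj (last p1) c1" "adj c1 c2" "adj c2 (hd p2)" by auto
  let ?Z = "{c1, c2}"
  let ?K = "component ?Z"
  have KV: "?K x \<subseteq> V - ?Z" if "x \<in> V - ?Z" for x using component_in[OF that] .
  have in1: "?K x \<subseteq> set p1" if "x \<in> set p1" for x
    using that closed1 by (intro component_subset) auto
  have in2: "?K x \<subseteq> set p2" if "x \<in> set p2" for x
    using that closed2 by (intro component_subset) auto
  have cases: "?K x \<subseteq> set p1 \<or> ?K x \<subseteq> set p2 \<or> ?K x \<inter> (set p1 \<union> set p2) = {}" for x
  proof -
    have "?K x \<subseteq> set p1" if "y \<in> ?K x" "y \<in> set p1" for y
      using in1[OF that(2)] component_eq[OF that(1)] by simp
    moreover have "?K x \<subseteq> set p2" if "y \<in> ?K x" "y \<in> set p2" for y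
      using in2[OF that(2)] component_eq[OF that(1)] by simp
    ultimately show ?thesis by blast
  qed
  have no1: "\<not> adj c2 y" if "y \<in> set p1" for y
    using closed1[OF that, of c2] adj_sym[of c2 y] dist by auto
  have no2: "\<not> adj c1 y" if "y \<in> set p2" for y
    using closed2[OF that, of c1] adj_sym[of c1 y] dist by auto
  have notboth: False if x: "x \<in> V - ?Z" and y: "y \<in> ?K x" "adj c1 y" and z: "z \<in> ?K x" "adj c2 z" for x y z
  proof -
    have dis: "?K x \<inter> (set p1 \<union> set p2) = {}" using cases[of x] no1 no2 y z by blast
    have yV: "y \<in> V - ?Z" using KV[OF x] y by blast
    have Ky: "?K y = ?K x" using component_eq y by blast
    obtain q where q: "is_path q" "hd q = y" "last q = z" "set q \<subseteq> ?K x"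
      using component_path[OF _ yV, of z] z(1) Ky by auto
    have qne: "q \<noteq> []" using q(1) by auto
    have qV: "set q \<subseteq> V - ?Z" using q(4) KV[OF x] by blast
    have c2p: "is_path (c2 # p2)" using A dist ne by (simp add: is_path_Cons_iff)
    have "is_path (q @ c2 # p2)"
      using q c2p dis qV adj_sym[OF z(2)] ne is_pathD(1) by (subst is_path_append_iff) auto
    then have "is_path (c1 # q @ c2 # p2)"
      using q qne qV dist y(2) by (subst is_path_Cons_iff) auto
    then have "is_path (p1 @ c1 # q @ c2 # p2)"
      using A dist dis q(4) ne is_pathD(1) by (subst is_path_append_iff) auto
    then have "length (p1 @ c1 # q @ c2 # p2) \<le> 2 * k + 2" by (rule bound)
    then show False using P qne by (cases q) auto
  qed
  have small: "card (?K x) \<le> k" if x: "x \<in> V - ?Z" for x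
  proof (cases "?K x \<inter> (set p1 \<union> set p2) = {}")
    case False
    then have "?K x \<subseteq> set p1 \<or> ?K x \<subseteq> set p2" using cases by blast
    then show ?thesis
      using card_mono[of "set p1" "?K x"] card_mono[of "set p2" "?K x"] card_length[of p1] card_length[of p2] P
      by fastforce
  next
    case dis: True
    have KVx: "?K x \<subseteq> V" "c1 \<notin> ?K x" "c2 \<notin> ?K x" using KV[OF x] by auto
    have step: "z \<in> ?K x \<or> z = c1 \<or> z = c2" if "y \<in> ?K x" "adj y z" for y z
      using component_step[of y ?Z x z] that KVx by blast
    note edge = component_edge[OF x]
    obtain d where d: "d \<in> ?K x" "adj d c1 \<or> adj d c2"
      using component_attached[OF conn x] V by auto
    from d(2) show ?thesis
    proof
      assume a: "adj d c1"
      show ?thesis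
      proof (rule small_component[OF low k KVx(1,2) d(1) adj_sym[OF a] _ edge])
        show "z \<in> ?K x \<or> z = c1" if "y \<in> ?K x" "adj y z" for y z
          using step[OF that] notboth[OF x d(1) adj_sym[OF a] that(1)] adj_sym[OF that(2)] by blast
        fix q assume q: "is_path (c1 # q)" "set q \<subseteq> ?K x"
        \<comment> \<open>The \<open>k + 2\<close> vertices of \<open>p2\<close>, \<open>c2\<close>
          and \<open>c1\<close> leave at most \<open>k\<close> for a path into the
          component.\<close>
        have "is_path (rev p2 @ [c2])"
          using A ne dist is_path_snoc_iff[of "rev p2" c2] adj_sym[OF A(5)] by (simp add: last_rev)
        then have "is_path ((rev p2 @ [c2]) @ c1 # q)"
          using q dis KVx dist adj_sym[OF A(4)] ne is_pathD(1) by (subst is_path_append_iff) auto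
        then have "length ((rev p2 @ [c2]) @ c1 # q) \<le> 2 * k + 2" by (rule bound)
        then show "length q \<le> k" using P by simp
      qed
    next
      assume a: "adj d c2"
      show ?thesis
      proof (rule small_component[OF low k KVx(1,3) d(1) adj_sym[OF a] _ edge])
        show "z \<in> ?K x \<or> z = c2" if "y \<in> ?K x" "adj y z" for y z
          using step[OF that] notboth[OF x that(1) _ d(1) adj_sym[OF a]] adj_sym[OF that(2)] by blast
        fix q assume q: "is_path (c2 # q)" "set q \<subseteq> ?K x"
        have "is_path (p1 @ [c1])"
          using A ne dist is_path_snoc_iff[of p1 c1] by simp
        then have "is_path ((p1 @ [c1]) @ c2 # q)"
          using q dis KVx dist A(4) ne is_pathD(1) by (subst is_path_append_iff) auto
        then have "length ((p1 @ [c1]) @ c2 # q) \<le> 2 * k + 2" by (rule bound)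
        then show "length q \<le> k" using P by simp
      qed
    qed
  qed
  define side where "side x \<longleftrightarrow> (\<exists>y\<in>?K x. adj c1 y)" for x
  have "?K x = ?K y \<and> (side x \<longleftrightarrow> side y)" if a: "adj x y" "{x, y} \<inter> ?Z = {}" for x y
  proof -
    have "?K x = ?K y" using component_adj[OF a(1), of ?Z] a(2) by blast
    then show ?thesis by (simp add: side_def)
  qed
  moreover have "side x" if "adj c1 x" "x \<noteq> c2" for x
    using that component_refl[of x ?Z] unfolding side_def by blast
  moreover have "\<not> side x" if a: "adj c2 x" "x \<noteq> c1" for x
  proof -
    have "x \<in> V - ?Z" using a adj_V adj_neq by blast
    then show ?thesis using notboth[of x _ x] a component_refl[of x ?Z] unfolding side_def by blast
  qed
  moreover have "card {y \<in> V - ?Z. ?K y = ?K x} \<le> k" if x: "x \<in> V - ?Z" for x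
  proof -
    have "{y \<in> V - ?Z. ?K y = ?K x} \<subseteq> ?K x" using component_refl by blast
    moreover have "finite (?K x)" using KV[OF x] finite_V finite_subset by blast
    ultimately show ?thesis using small[OF x] card_mono by (meson order_trans)
  qed
  moreover have "c1 \<noteq> c2" using dist by auto
  ultimately show ?thesis
    unfolding linked_def using V
    by (intro bexI[of _ c1] bexI[of _ c2] exI[of _ side] exI[of _ ?K]) auto
qed

end

section \<open>Longest paths and rotations\<close>

text \<open>\<open>S\<close> stands for the predecessors of neighbours of the first path vertex,
  \<open>T\<close> for the neighbours of the last, as positions, and \<open>M\<close> for the order
  of the path minus one. Between a closest pair t < s there is no element of either set; since the
  sets fill all but at most one place, the gap is one place. Without such a pair, all of
  \<open>S\<close> precedes \<open>T\<close>.\<close>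

lemma crossing_free_index_sets:
  fixes S T :: "nat set"
  assumes ST: "S \<subseteq> {..<M}" "T \<subseteq> {..<M}" "S \<inter> T = {}" "\<And>i. i \<in> T \<Longrightarrow> Suc i \<notin> S"
    and k: "k \<le> card S" "k \<le> card T" "1 \<le> k" and M: "M \<le> 2 * k + 1"
  shows "(M = 2 * k \<and> S = {..<k} \<and> T = {k..<M}) \<or>
    (M = 2 * k + 1 \<and>
      ((T = {k + 1..<M} \<and> S \<subseteq> {..<k + 1}) \<or> (S = {..<k} \<and> T \<subseteq> {k..<M}) \<or> (\<exists>t\<in>T. t + 2 \<in> S)))"
proof -
  have fin: "finite S" "finite T" using ST finite_subset by blast+
  have cU: "2 * k \<le> card (S \<union> T)" using k fin ST(3) by (simp add: card_Un_disjoint)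
  show ?thesis
  proof (cases "\<exists>t\<in>T. \<exists>s\<in>S. t < s")
    case True
    let ?P = "\<lambda>(t, s). t \<in> T \<and> s \<in> S \<and> t < s"
    obtain x0 where x0: "?P x0" using True by auto
    have "\<exists>x. ?P x \<and> (\<forall>y. ?P y \<longrightarrow> snd x - fst x \<le> snd y - fst y)"
      using ex_has_least_nat[of ?P x0 "\<lambda>x. snd x - fst x", OF x0] .
    then obtain t s where ts: "t \<in> T" "s \<in> S" "t < s"
      and min: "\<And>t' s'. t' \<in> T \<Longrightarrow> s' \<in> S \<Longrightarrow> t' < s' \<Longrightarrow> s - t \<le> s' - t'"
      by fastforce
    have "S \<union> T \<subseteq> {..<M} - {t<..<s}"
    proof
      fix u assume u: "u \<in> S \<union> T"
      have "\<not> (t < u \<and> u < s)"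
      proof
        assume b: "t < u \<and> u < s"
        show False
        proof (cases "u \<in> S")
          case True then have "s - t \<le> u - t" using min[OF ts(1) True] b by blast
          then show False using b by linarith
        next
          case False
          then have "u \<in> T" using u by blast
          then have "s - t \<le> s - u" using min[OF _ ts(2)] b by blast
          then show False using b by linarith
        qed
      qed
      then show "u \<in> {..<M} - {t<..<s}" using u ST by auto
    qed
    then have "card (S \<union> T) \<le> card ({..<M} - {t<..<s})" by (intro card_mono) auto
    also have "\<dots> = M - (s - t - 1)"
      using ts ST by (subst card_Diff_subset) auto
    finally have le: "2 * k \<le> M - (s - t - 1)" using cU by simp
    have "s \<noteq> Suc t" using ST(4) ts by blast
    then have "s = t + 2" "M = 2 * k + 1" using le M ts(3) k(3) by auto
    then show ?thesis using ts by blast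
  next
    case False
    have sep: "s < t" if "s \<in> S" "t \<in> T" for s t
    proof -
      have "s \<noteq> t" using ST(3) that by blast
      then show ?thesis using False that by (meson linorder_neqE_nat)
    qed
    have Tne: "T \<noteq> {}" using k by auto
    define b where "b = Min T"
    have bT: "b \<in> T" using Tne fin by (simp add: b_def)
    have Sb: "S \<subseteq> {..<b}" using sep bT by auto
    have Tb: "T \<subseteq> {b..<M}" using ST(2) fin Tne by (auto simp: b_def)
    have "k \<le> b" using card_mono[OF _ Sb] k by simp
    moreover have "k \<le> M - b" using card_mono[OF _ Tb] k by simp
    ultimately consider "M = 2 * k" "b = k" | "M = 2 * k + 1" "b = k" | "M = 2 * k + 1" "b = k + 1"
      using M k(3) by linarith
    then show ?thesis
    proof cases
      case 1
      have "S = {..<k}" using card_seteq[OF _ Sb] k 1 by simp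
      moreover have "T = {k..<M}" using card_seteq[OF _ Tb] k 1 by simp
      ultimately show ?thesis using 1 by simp
    next
      case 2
      have "S = {..<k}" using card_seteq[OF _ Sb] k 2 by simp
      then show ?thesis using 2 Tb by simp
    next
      case 3
      have "T = {k + 1..<M}" using card_seteq[OF _ Tb] k 3 by simp
      then show ?thesis using 3 Sb by simp
    qed
  qed
qed

lemma nth_mem_take: "i < length xs \<Longrightarrow> i < n \<Longrightarrow> xs ! i \<in> set (take n xs)"
  by (metis length_take min_less_iff_conj nth_mem nth_take)

lemma mem_take_nth: "x \<in> set (take n xs) \<Longrightarrow> \<exists>i<length xs. i < n \<and> x = xs ! i"
  using mem_set_nth[of x "take n xs"] by auto

text \<open>The situation once a cycle of length \<open>m - 1\<close> is excluded. \<open>m\<close>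
  and the graph are parameters because \<open>leaf_target\<close> enters the locale a second time,
  with one vertex deleted and \<open>m - 1\<close> as the bound.\<close>

locale path_bounded = simple_graph V adj for V :: "'a set" and adj +
  fixes m k :: nat
  assumes conn: is_connected
    and bound: "is_path q \<Longrightarrow> length q \<le> m"
    and less: "m < card V" and m3: "3 \<le> m"
    and no_cycle: "is_cycle D \<Longrightarrow> length D \<noteq> m - 1"
    and low: "at_most_one_low k" and k1: "1 \<le> k"
begin

lemma no_spanning_cycle: "is_cycle D \<Longrightarrow> length D \<noteq> m"
proof
  assume D: "is_cycle D" "length D = m"
  then obtain P where "is_path P" "length P = Suc m"
    using cycle_path_longer[OF conn D(1)] less by auto
  then show False using bound[of P] by simp
qed

lemma hd_nbrs:
  assumes p: "is_path p" "length p = m"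
  shows "nbrs (hd p) \<subseteq> set p"
proof
  fix y assume "y \<in> nbrs (hd p)"
  then have y: "adj y (hd p)" using adj_sym by simp
  show "y \<in> set p"
  proof (rule ccontr)
    assume "y \<notin> set p"
    then have "is_path (y # p)" using y p(1) is_pathD(1) is_path_Cons_iff by blast
    then show False using bound[of "y # p"] p(2) by simp
  qed
qed

lemma last_nbrs:
  assumes p: "is_path p" "length p = m"
  shows "nbrs (last p) \<subseteq> set p"
  using hd_nbrs[of "rev p"] assms is_pathD(1)[OF p(1)] by (simp add: hd_rev)

text \<open>A crossing of adjacent positions closes a cycle through the whole path.\<close>

lemma no_cross:
  assumes p: "is_path p" "length p = m" and i: "Suc i < m" "adj (hd p) (p ! Suc i)"
  shows "\<not> adj (last p) (p ! i)"
proof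
  assume a: "adj (last p) (p ! i)"
  let ?q = "rev (take (Suc i) p) @ drop (Suc i) p"
  have ne: "p \<noteq> []" using p(1) by auto
  have "is_path ?q" using rotate_path[OF p(1) i(2)] i(1) p(2) by simp
  moreover have "hd ?q = p ! i" using i p by (simp add: take_Suc_conv_app_nth)
  moreover have "last ?q = last p" using i p by simp
  ultimately have "is_cycle ?q" unfolding is_cycle_def using a m3 p i by simp
  then show False using no_spanning_cycle[of ?q] p i by simp
qed

text \<open>The crossing skips the \<open>d - 1\<close> vertices between positions \<open>i\<close>
  and \<open>i + d\<close>, and all others lie on the cycle. It serves with d = 2 to contradict
  \<open>no_cycle\<close> and with d = 3 to obtain a cycle that misses an edge.\<close>

lemma shortcut_cycle:
  assumes p: "is_path p" and i: "i + d < length p" "0 < d" "adj (hd p) (p ! (i + d))" "adj (last p) (p ! i)"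
    and len: "4 \<le> length p + 2 - d"
  shows "is_cycle (rev (take (Suc i) p) @ drop (i + d) p)"
    and "length (rev (take (Suc i) p) @ drop (i + d) p) = length p + 1 - d"
    and "set (rev (take (Suc i) p) @ drop (i + d) p) \<inter> set (take (d - 1) (drop (Suc i) p)) = {}"
proof -
  let ?q = "rev (take (Suc i) p) @ drop (i + d) p"
  have ne: "p \<noteq> []" using p by auto
  have dist: "distinct p" using is_pathD[OF p] by blast
  have disj: "set (take (Suc i) p) \<inter> set (drop (i + d) p) = {}"
    using dist i(2) by (intro set_take_disj_set_drop_if_distinct) auto
  have path: "is_path ?q"
  proof (rule is_path_appendI)
    show "is_path (rev (take (Suc i) p))" using p is_path_take by simp
    show "is_path (drop (i + d) p)" using p i is_path_drop by simp
    show "set (rev (take (Suc i) p)) \<inter> set (drop (i + d) p) = {}" using disj by simp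
    show "adj (last (rev (take (Suc i) p))) (hd (drop (i + d) p))"
      using i ne by (simp add: last_rev hd_drop_conv_nth)
  qed
  show l: "length ?q = length p + 1 - d" using i by simp
  have "hd ?q = p ! i" using i by (simp add: take_Suc_conv_app_nth)
  moreover have "last ?q = last p" using i by simp
  ultimately show "is_cycle ?q" unfolding is_cycle_def using path i(4) l len by simp
  have "set (take (d - 1) (drop (Suc i) p)) \<inter> set (take (Suc i) p) = {}"
    using dist set_take_disj_set_drop_if_distinct[of p "Suc i" "Suc i"] set_take_subset[of "d - 1" "drop (Suc i) p"] by auto
  moreover have "set (take (d - 1) (drop (Suc i) p)) \<inter> set (drop (i + d) p) = {}"
  proof -
    have "take (d - 1) (drop (Suc i) p) = drop (Suc i) (take (i + d) p)"
      using i(2) by (simp add: take_drop add.commute)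
    then have "set (take (d - 1) (drop (Suc i) p)) \<subseteq> set (take (i + d) p)" by (simp add: set_drop_subset)
    then show ?thesis using dist set_take_disj_set_drop_if_distinct[of p "i + d" "i + d"] by auto
  qed
  ultimately show "set ?q \<inter> set (take (d - 1) (drop (Suc i) p)) = {}" by auto
qed

lemma no_cross2:
  assumes p: "is_path p" "length p = m" and i: "i + 2 < m" "adj (hd p) (p ! (i + 2))"
  shows "\<not> adj (last p) (p ! i)"
proof
  assume a: "adj (last p) (p ! i)"
  show False
  proof (cases "m = 3")
    \<comment> \<open>For m = 3 the shortcut is too short to be a cycle, but the path itself closes
      to a triangle.\<close>
    case True
    then have "i = 0" using i by simp
    moreover have ne: "p \<noteq> []" using p(1) by auto
    ultimately have "is_cycle p" unfolding is_cycle_def using a p m3 by (simp add: hd_conv_nth)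
    then show False using no_spanning_cycle p by blast
  next
    case False
    then show False
      using shortcut_cycle(1,2)[OF p(1), of i 2] i a p m3 no_cycle by fastforce
  qed
qed

text \<open>Besides the new ends, the last two clauses matter: positions behind the rotated segment
  and longer initial segments, as sets, do not change, so statements about them survive a
  rotation.\<close>

lemma rotated:
  assumes p: "is_path p" "length p = m" and s: "Suc s < m" "adj (hd p) (p ! Suc s)"
  defines "q \<equiv> rev (take (Suc s) p) @ drop (Suc s) p"
  shows "is_path q" "length q = m" "hd q = p ! s" "last q = last p" "set q = set p"
    "\<And>i. Suc s \<le> i \<Longrightarrow> i < m \<Longrightarrow> q ! i = p ! i"
    "\<And>j. Suc s \<le> j \<Longrightarrow> set (take j q) = set (take j p)"
proof -
  have ne: "p \<noteq> []" using p(1) by auto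
  show "is_path q" using rotate_path[OF p(1) s(2)] s(1) p(2) by (simp add: q_def)
  show "length q = m" "last q = last p" using s p by (simp_all add: q_def)
  show "hd q = p ! s" using s p by (simp add: q_def take_Suc_conv_app_nth)
  show "set q = set p" unfolding q_def by (metis append_take_drop_id set_append set_rev)
  show "q ! i = p ! i" if "Suc s \<le> i" "i < m" for i
    using that p s by (simp add: q_def nth_append min_absorb2)
  show "set (take j q) = set (take j p)" if j: "Suc s \<le> j" for j
  proof -
    have "take j p = take (Suc s) p @ take (j - Suc s) (drop (Suc s) p)"
      using j by (metis take_add le_add_diff_inverse)
    moreover have "take j q = rev (take (Suc s) p) @ take (j - Suc s) (drop (Suc s) p)"
      using j s p by (simp add: q_def min_absorb2)
    ultimately show ?thesis by simp
  qed
qed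

text \<open>After \<open>p ! s\<close> is rotated to the front, a neighbour of it beyond position
  \<open>j\<close> would cross with the neighbour of the last vertex one place earlier.\<close>

lemma rotated_nbrs:
  assumes p: "is_path p" "length p = m" and s: "Suc s \<le> j" "j < m" "adj (hd p) (p ! Suc s)"
    and T: "\<And>i. j \<le> i \<Longrightarrow> Suc i < m \<Longrightarrow> adj (last p) (p ! i)"
  shows "nbrs (p ! s) \<subseteq> set (take (Suc j) p)"
proof
  fix y assume y: "y \<in> nbrs (p ! s)"
  have sm: "Suc s < m" using s by simp
  let ?q = "rev (take (Suc s) p) @ drop (Suc s) p"
  note q = rotated[OF p sm s(3)]
  have "y \<in> set ?q" using hd_nbrs[OF q(1,2)] y q(3) by auto
  then obtain i where i: "i < m" "y = ?q ! i" using mem_set_nth[of y ?q] q(2) by auto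
  have "i \<le> j"
  proof (rule ccontr)
    assume "\<not> i \<le> j"
    then obtain i' where i': "i = Suc i'" "j \<le> i'" by (cases i) auto
    have "\<not> adj (last ?q) (?q ! i')"
      using no_cross[OF q(1,2), of i'] i i' y q(3) by simp
    moreover have "?q ! i' = p ! i'" using q(6)[of i'] i i' s by simp
    ultimately show False using T[of i'] i i' q(4) by simp
  qed
  then have "y \<in> set (take (Suc j) ?q)"
    using nth_mem_take[of i ?q "Suc j"] i q(2) by (simp only: less_Suc_eq_le)
  then show "y \<in> set (take (Suc j) p)" using q(7)[OF le_SucI[OF s(1)]] by blast
qed

lemma card_nbr_indices:
  assumes p: "is_path p" "length p = m"
  shows "card {i. Suc i < m \<and> adj (hd p) (p ! Suc i)} = card (nbrs (hd p))"
proof -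
  have ne: "p \<noteq> []" using p(1) by auto
  have dist: "distinct p" using is_pathD[OF p(1)] by blast
  let ?S = "{i. Suc i < m \<and> adj (hd p) (p ! Suc i)}"
  have "inj_on (\<lambda>i. p ! Suc i) ?S"
    using dist p by (auto simp: inj_on_def nth_eq_iff_index_eq)
  moreover have "(\<lambda>i. p ! Suc i) ` ?S = nbrs (hd p)"
  proof
    show "nbrs (hd p) \<subseteq> (\<lambda>i. p ! Suc i) ` ?S"
    proof
      fix y assume y: "y \<in> nbrs (hd p)"
      then obtain i where i: "i < m" "y = p ! i" using hd_nbrs[OF p] mem_set_nth[of y p] p(2) by blast
      have "i \<noteq> 0"
      proof
        assume "i = 0"
        then have "y = hd p" using i ne by (simp add: hd_conv_nth)
        then show False using y adj_irrefl by simp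
      qed
      then obtain i' where "i = Suc i'" by (cases i) auto
      then show "y \<in> (\<lambda>i. p ! Suc i) ` ?S" using i y by auto
    qed
  qed auto
  ultimately show ?thesis using card_image[of "\<lambda>i. p ! Suc i" ?S] by simp
qed


lemma closed_takeI:
  assumes p: "is_path p" "length p = m" and j: "j < m"
    and nb: "\<And>s. s < j \<Longrightarrow> nbrs (p ! s) \<subseteq> set (take (Suc j) p)"
    and x: "x \<in> set (take j p)" "adj x y"
  shows "y \<in> set (take j p) \<or> y = p ! j"
proof -
  obtain s where "s < j" "x = p ! s" using mem_take_nth[OF x(1)] by blast
  then have "y \<in> set (take (Suc j) p)" using nb[of s] x(2) by auto
  then show ?thesis using j p by (auto simp: take_Suc_conv_app_nth)
qed

lemma prefix_bound:
  assumes p: "is_path p" "length p = m" and j: "0 < j" "j < m"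
    and q: "is_path (p ! j # q)" "set q \<inter> set (take j p) = {}"
  shows "j + Suc (length q) \<le> m"
proof -
  have dist: "distinct p" using is_pathD[OF p(1)] by blast
  have "is_path (take j p @ p ! j # q)"
  proof (rule is_path_appendI)
    show "is_path (take j p)" using p j is_path_take by blast
    have "p ! j \<notin> set (take j p)"
      using dist j p mem_take_nth[of "p ! j" j p] by (auto simp: nth_eq_iff_index_eq)
    then show "set (take j p) \<inter> set (p ! j # q) = {}" using q(2) by auto
    obtain i where i: "j = Suc i" using j by (cases j) auto
    then have "last (take j p) = p ! i" using j p by (simp add: take_Suc_conv_app_nth)
    then show "adj (last (take j p)) (hd (p ! j # q))" using is_path_nth[OF p(1), of i] i j p by simp
  qed (rule q(1))
  then have "length (take j p @ p ! j # q) \<le> m" by (rule bound)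
  then show ?thesis using j p by simp
qed

lemma nth_V: "is_path p \<Longrightarrow> i < length p \<Longrightarrow> p ! i \<in> V"
  using is_pathD(3) nth_mem by blast

text \<open>Each of the first \<open>k\<close> vertices can be rotated to the front, so none has a
  neighbour beyond position \<open>k\<close>, which makes \<open>p ! k\<close> the cut
  vertex.\<close>

lemma balanced_cut:
  assumes p: "is_path p" "length p = m" and m: "m = 2 * k + 1"
    and S: "\<And>i. i < k \<Longrightarrow> adj (hd p) (p ! Suc i)"
    and T: "\<And>i. k \<le> i \<Longrightarrow> Suc i < m \<Longrightarrow> adj (last p) (p ! i)"
  shows "small_components k"
proof (rule small_componentsI[OF conn low k1, of "p ! k" "set (take k p)"])
  show "p ! k \<in> V" using nth_V p m by simp
  show "card (set (take k p)) \<le> k" using card_length[of "take k p"] by simp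
  have "nbrs (p ! s) \<subseteq> set (take (Suc k) p)" if "s < k" for s
    by (rule rotated_nbrs[OF p _ _ S[OF that]]) (use that T m in auto)
  then show "y \<in> set (take k p) \<or> y = p ! k" if "x \<in> set (take k p)" "adj x y" for x y
    using closed_takeI[OF p _ _ that] m by simp
  show "length q \<le> k" if "is_path (p ! k # q)" "set q \<inter> set (take k p) = {}" for q
    using prefix_bound[OF p _ _ that] m k1 by simp
qed simp

end

text \<open>Positions are counted from 0; the vertex at position \<open>k + 1\<close> turns out to be a cut vertex.\<close>

locale unbalanced_path = path_bounded V adj m k for V :: "'a set" and adj m k +
  fixes p :: "'a list"
  assumes p: "is_path p" "length p = m" and m: "m = 2 * k + 2"
    and reg: "k \<le> card (nbrs (hd p))" and hc: "adj (hd p) (p ! Suc k)"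
    and T: "k < i \<Longrightarrow> i \<le> 2 * k \<Longrightarrow> adj (last p) (p ! i)"
begin

definition S where "S = {i. Suc i < length p \<and> adj (hd p) (p ! Suc i)}"

abbreviation "c \<equiv> p ! Suc k"
abbreviation "L \<equiv> set (take (Suc k) p)"
abbreviation "R \<equiv> set (drop (k + 2) p)"

lemma p_ne: "p \<noteq> []" and p_dist: "distinct p" and p_V: "set p \<subseteq> V"
  using is_pathD[OF p(1)] by auto

lemma hd_p: "hd p = p ! 0" using p_ne by (rule hd_conv_nth)

lemma S_sub: "S \<subseteq> {..k}"
proof
  fix i assume i: "i \<in> S"
  show "i \<in> {..k}"
  proof (rule ccontr)
    assume "i \<notin> {..k}"
    then have "adj (last p) (p ! i)" using T[of i] i m p(2) by (simp add: S_def)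
    then show False using no_cross[OF p] i p(2) by (simp add: S_def)
  qed
qed

lemma S_card: "k \<le> card S"
  using card_nbr_indices[OF p] reg p(2) by (simp add: S_def)

text \<open>\<open>S\<close> contains at least \<open>k\<close> of the \<open>k + 1\<close> indices
  up to \<open>k\<close>.\<close>

lemma S_two: "i \<le> k \<Longrightarrow> j \<le> k \<Longrightarrow> i \<notin> S \<Longrightarrow> j \<notin> S \<Longrightarrow> i = j"
proof (rule ccontr)
  assume a: "i \<le> k" "j \<le> k" "i \<notin> S" "j \<notin> S" "i \<noteq> j"
  then have "S \<subseteq> {..k} - {i, j}" using S_sub by blast
  then have "card S \<le> card ({..k} - {i, j})" by (intro card_mono) auto
  also have "\<dots> = k - 1" using a by (subst card_Diff_subset) auto
  finally show False using S_card k1 by simp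
qed

lemma k_S: "k \<in> S" using hc m p(2) k1 by (simp add: S_def)

lemma zero_S: "0 \<in> S"
  using is_path_nth[OF p(1), of 0] p m k1 by (simp add: S_def hd_p)

lemma S_nbrs:
  assumes "s \<in> S"
  shows "nbrs (p ! s) \<subseteq> set (take (k + 2) p)"
proof -
  have "nbrs (p ! s) \<subseteq> set (take (Suc (Suc k)) p)"
  proof (rule rotated_nbrs[OF p])
    show "Suc s \<le> Suc k" "Suc k < m" using assms S_sub m k1 by auto
    show "adj (hd p) (p ! Suc s)" using assms by (simp add: S_def)
    show "\<And>i. Suc k \<le> i \<Longrightarrow> Suc i < m \<Longrightarrow> adj (last p) (p ! i)" using T m by simp
  qed
  then show ?thesis by simp
qed

lemma take_c: "set (take (k + 2) p) = insert c L"
proof -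
  have "take (Suc (Suc k)) p = take (Suc k) p @ [c]"
    using p m k1 take_Suc_conv_app_nth[of "Suc k" p] by simp
  then show ?thesis by simp
qed

text \<open>Seen from the other end: if a vertex of \<open>R\<close>, rotated to the front of the
  reversed path, had a neighbour beyond \<open>c\<close>, then \<open>no_cross\<close> and
  \<open>no_cross2\<close> would remove two different indices from \<open>S\<close>, but at most one
  index up to \<open>k\<close> is missing.\<close>

lemma R_closed:
  assumes x: "x \<in> R" "adj x y"
  shows "y \<in> R \<or> y = c"
proof -
  let ?r = "rev p"
  have r: "is_path ?r" "length ?r = m" using p by auto
  have rn: "?r ! i = p ! (2 * k + 1 - i)" if "i < m" for i using that p m by (simp add: rev_nth)
  have rl: "hd ?r = last p" "last ?r = hd p" using p_ne by (auto simp: hd_rev last_rev)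
  have tk: "set (take k ?r) = R"
    using p m by (simp add: take_rev)
  have tk': "set (take (Suc k) ?r) = insert c R"
  proof -
    have "drop (Suc k) p = c # drop (k + 2) p" using p m k1 Cons_nth_drop_Suc[of "Suc k" p] by simp
    then show ?thesis using p m by (simp add: take_rev)
  qed
  obtain s where s: "s < k" "x = ?r ! s" using mem_take_nth[of x k ?r] x(1) tk by blast
  have adjs: "adj (hd ?r) (?r ! Suc s)" using T[of "2 * k - s"] s rn[of "Suc s"] rl m by simp
  have sm: "Suc s < m" using s m by simp
  define q where "q = rev (take (Suc s) ?r) @ drop (Suc s) ?r"
  note q = rotated[OF r sm adjs, folded q_def]
  have "y \<in> set q" using hd_nbrs[OF q(1,2)] x(2) q(3) s(2) by auto
  then obtain i where i: "i < m" "y = q ! i" using mem_set_nth[of y q] q(2) by blast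
  have "i \<le> k"
  proof (rule ccontr)
    assume "\<not> i \<le> k"
    then obtain i' where i': "i = Suc i'" "k \<le> i'" by (cases i) auto
    have ay: "adj (hd q) (q ! Suc i')" using x(2) q(3) s(2) i i' by simp
    have "\<not> adj (last q) (q ! i')" using no_cross[OF q(1,2) _ ay] i i' by simp
    moreover have "q ! i' = p ! Suc (2 * k - i')"
      using q(6)[of i'] rn[of i'] i i' s m by (simp add: Suc_diff_le)
    ultimately have n1: "2 * k - i' \<notin> S" using q(4) rl by (auto simp: S_def)
    have "i' \<noteq> k" using n1 k_S by auto
    then obtain i'' where i'': "i' = Suc i''" "k \<le> i''" using i' by (cases i') auto
    have "\<not> adj (last q) (q ! i'')" using no_cross2[OF q(1,2), of i''] ay i i' i'' by simp
    moreover have "q ! i'' = p ! Suc (2 * k - i'')"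
      using q(6)[of i''] rn[of i''] i i' i'' s m by (simp add: Suc_diff_le)
    ultimately have n2: "2 * k - i'' \<notin> S" using q(4) rl by (auto simp: S_def)
    have "2 * k - i' = 2 * k - i''" using S_two[OF _ _ n1 n2] i' i'' by simp
    then show False using i' i'' i m by simp
  qed
  then have "y \<in> set (take (Suc k) q)" using nth_mem_take[of i q "Suc k"] i q(2) by simp
  then have "y \<in> set (take (Suc k) ?r)" using q(7)[of "Suc k"] s by simp
  then show ?thesis using tk' by auto
qed

lemma p_split: "p = take (Suc k) p @ c # drop (k + 2) p"
  using p m k1 id_take_nth_drop[of "Suc k" p] by simp

lemma tail_path: "is_path (rev (c # drop (k + 2) p))"
proof -
  have "drop (Suc k) p = c # drop (k + 2) p" using p m k1 Cons_nth_drop_Suc[of "Suc k" p] by simp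
  moreover have "is_path (drop (Suc k) p)" using is_path_drop[OF p(1)] p m by simp
  ultimately show ?thesis by (simp del: rev.simps)
qed

lemma disj_LcR: "c \<notin> L" "c \<notin> R" "L \<inter> R = {}"
  using p_dist p_split by (metis distinct.simps(2) distinct_append disjoint_iff list.set_intros(1) list.set_intros(2))+

lemma set_p: "set p = insert c (L \<union> R)"
  using arg_cong[OF p_split, of set] by auto

text \<open>\<open>c\<close> and \<open>R\<close> form a tail of \<open>k + 1\<close> vertices, half
  of the maximal order \<open>2 * k + 2\<close>, which any such path could follow.\<close>

lemma head_bound:
  assumes q: "is_path q" "adj c (hd q)" "set q \<inter> insert c R = {}"
  shows "length q \<le> Suc k"
proof -
  have "is_path (rev (c # drop (k + 2) p) @ q)"
  proof (rule is_path_appendI[OF tail_path q(1)])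
    show "set (rev (c # drop (k + 2) p)) \<inter> set q = {}" using q(3) by auto
    show "adj (last (rev (c # drop (k + 2) p))) (hd q)" using q(2) by simp
  qed
  then have "length (rev (c # drop (k + 2) p) @ q) \<le> m" by (rule bound)
  then show ?thesis using p m by simp
qed

lemma L_index: "x \<in> L \<longleftrightarrow> (\<exists>i\<le>k. x = p ! i)"
  using mem_take_nth[of x "Suc k" p] nth_mem_take[of _ p "Suc k"] p m by (auto simp: less_Suc_eq_le)

end

lemma (in simple_graph) nbrs_subsetD: "nbrs x \<subseteq> S \<Longrightarrow> adj x y \<Longrightarrow> y \<in> S"
  by (auto simp: nbrs_def)

section \<open>A neighbour that escapes from the initial segment\<close>

context unbalanced_path begin

context
  fixes j q
  assumes j: "j \<le> k" "adj (p ! j) q" "q \<notin> insert c L"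
begin

text \<open>By \<open>S_nbrs\<close> a vertex with index in \<open>S\<close> has all its neighbours
  in \<open>L\<close> and \<open>c\<close>; hence an escape happens at the one index that
  \<open>S\<close> misses.\<close>

lemma escape_notin_S: "j \<notin> S"
  using nbrs_subsetD[OF S_nbrs[of j] j(2)] take_c j(3) by blast

lemma escape_range: "0 < j" "j < k"
  using escape_notin_S zero_S k_S j(1) by (auto intro: gr0I le_neq_implies_less)

lemma others_S: "i \<le> k \<Longrightarrow> i \<noteq> j \<Longrightarrow> i \<in> S"
  using S_two[of i j] escape_notin_S j(1) by blast

lemma others_nbrs: "i \<le> k \<Longrightarrow> i \<noteq> j \<Longrightarrow> nbrs (p ! i) \<subseteq> insert c L"
  using S_nbrs[OF others_S] take_c by blast

lemma hd_adj: "i \<le> k \<Longrightarrow> i \<noteq> j \<Longrightarrow> adj (p ! 0) (p ! Suc i)"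
  using others_S[of i] hd_p by (simp add: S_def)

lemma hd_not_adj: "\<not> adj (p ! 0) (p ! Suc j)"
  using escape_notin_S escape_range p m hd_p by (simp add: S_def)

lemma L_nth: "i \<le> k \<Longrightarrow> p ! i \<in> L" using L_index by blast

lemma nth_neq: "i < m \<Longrightarrow> i' < m \<Longrightarrow> i \<noteq> i' \<Longrightarrow> p ! i \<noteq> p ! i'"
  using p_dist p by (simp add: nth_eq_iff_index_eq)

lemma adj_L_out:
  assumes "x \<in> L" "adj x y" "y \<notin> insert c L"
  shows "x = p ! j"
  using assms others_nbrs L_index[of x] by fastforce

lemma q_fresh: "q \<notin> set p"
proof
  assume "q \<in> set p"
  then have "q \<in> R" using j(3) set_p by auto
  then have "p ! j \<in> R \<or> p ! j = c" using R_closed adj_sym[OF j(2)] by blast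
  then show False using disj_LcR L_nth[OF j(1)] by auto
qed

lemma L_path: "is_path (take (Suc k) p)"
  using is_path_take[OF p(1)] by simp

text \<open>The vertex after the escape point has its neighbours in \<open>L\<close> and
  \<open>c\<close>, but \<open>p ! 0\<close> is not among them, so degree \<open>k\<close> makes it
  adjacent to everything else there. This allows a path that starts next to \<open>c\<close>, uses
  all of \<open>L\<close> and ends with \<open>p ! j\<close>, \<open>q\<close>: one vertex more than
  \<open>head_bound\<close> permits.\<close>

lemma escape_regular_False:
  assumes k3: "3 \<le> k" and reg': "k \<le> card (nbrs (p ! Suc j))"
  shows False
proof -
  note r = escape_range
  have sub: "nbrs (p ! Suc j) \<subseteq> insert c L - {p ! 0, p ! Suc j}"
  proof -
    have "nbrs (p ! Suc j) \<subseteq> insert c L" using others_nbrs[of "Suc j"] r by simp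
    moreover have "p ! 0 \<notin> nbrs (p ! Suc j)" using hd_not_adj adj_sym by auto
    moreover have "p ! Suc j \<notin> nbrs (p ! Suc j)" using adj_irrefl by simp
    ultimately show ?thesis by blast
  qed
  have cL: "card L = Suc k" using distinct_card[of "take (Suc k) p"] p_dist p m by simp
  have in0: "p ! 0 \<in> L" "p ! Suc j \<in> L" using L_nth r by auto
  have ne0: "p ! 0 \<noteq> p ! Suc j" using nth_neq[of 0 "Suc j"] r m by simp
  have "card (insert c L - {p ! 0, p ! Suc j}) = k"
    using cL disj_LcR(1) in0 ne0 by (subst card_Diff_subset) auto
  then have eq: "nbrs (p ! Suc j) = insert c L - {p ! 0, p ! Suc j}"
    using reg' card_mono[OF _ sub] by (intro card_subset_eq sub) auto
  have full: "adj (p ! Suc j) y" if "y \<in> insert c L" "y \<noteq> p ! 0" "y \<noteq> p ! Suc j" for y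
    using eq that mem_nbrs by blast
  have V: "q \<in> V" using j(2) adj_V by blast
  show False
  proof (cases "Suc j = k")
    case False
    \<comment> \<open>The order is: positions \<open>Suc j\<close> to \<open>k\<close>, then 0 to
      \<open>j\<close>, then \<open>q\<close>.\<close>
    let ?A = "take (Suc j) p" and ?B = "take (k - j) (drop (Suc j) p)"
    have AB: "take (Suc k) p = ?A @ ?B" using r by (metis Suc_diff_le add_Suc_right diff_Suc_Suc le_add_diff_inverse less_imp_le_nat take_add add_Suc)
    have ne: "?A \<noteq> []" "?B \<noteq> []" using r p m by auto
    have paths: "is_path ?A" "is_path ?B" "set ?A \<inter> set ?B = {}"
      using L_path AB is_path_append_iff[OF ne] by auto
    have lB: "last ?B = p ! k"
    proof -
      have "last (take (Suc k) p) = p ! k" using p m by (simp add: take_Suc_conv_app_nth)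
      then show ?thesis using AB ne by simp
    qed
    have hA: "hd ?A = p ! 0" using p_ne by (simp add: hd_conv_nth)
    have "adj (last ?B) (hd ?A)" using hd_adj[of "k - 1"] False r lB hA adj_sym by auto
    then have "is_path (?B @ ?A)" using paths by (intro is_path_appendI) auto
    moreover have "last (?B @ ?A) = p ! j" using ne r p m by (simp add: take_Suc_conv_app_nth)
    moreover have "q \<notin> set (?B @ ?A)"
      using q_fresh set_take_subset[of "Suc k" p] AB by (metis Un_iff in_mono set_append)
    ultimately have "is_path ((?B @ ?A) @ [q])" using is_path_snoc_iff[of "?B @ ?A" q] ne j(2) by simp
    moreover have "adj c (hd ((?B @ ?A) @ [q]))"
    proof -
      have "hd ?B = p ! Suc j" using r p m by (simp add: hd_drop_conv_nth)
      moreover have "adj (p ! Suc j) c"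
        using full[of c] nth_neq[of "Suc k" 0] nth_neq[of "Suc k" "Suc j"] r m by simp
      ultimately show ?thesis using ne adj_sym by simp
    qed
    moreover have "set ((?B @ ?A) @ [q]) \<inter> insert c R = {}"
    proof -
      have "set ((?B @ ?A) @ [q]) = insert q L" using AB by auto
      then show ?thesis using disj_LcR q_fresh set_p by auto
    qed
    ultimately have "length ((?B @ ?A) @ [q]) \<le> Suc k" by (rule head_bound)
    then show False using r p m by simp
  next
    case True
    \<comment> \<open>The escape point is next to the end of \<open>L\<close>. The order is:
      positions 0 to \<open>j - 1\<close>, then \<open>k\<close>, then \<open>j\<close>, then
      \<open>q\<close>. The edge between \<open>j - 1\<close> and \<open>k\<close> is available
      because \<open>j - 1\<close> is not 0, and here \<open>k \<ge> 3\<close> enters.\<close>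
    let ?A = "take j p"
    have t: "take (Suc k) p = ?A @ [p ! j, p ! k]"
      using True r p m by (simp add: take_Suc_conv_app_nth flip: True)
    have ne: "?A \<noteq> []" using r p m by auto
    have pA: "is_path ?A" using is_path_take[OF p(1)] r by simp
    obtain i where i: "j = Suc i" using r by (cases j) auto
    have lA: "last ?A = p ! (j - 1)" using r p m by (simp add: i take_Suc_conv_app_nth)
    have "adj (p ! Suc j) (p ! (j - 1))"
      using full[of "p ! (j - 1)"] L_nth[of "j - 1"] nth_neq[of "j - 1" 0] nth_neq[of "j - 1" "Suc j"] r k3 True m
      by auto
    then have e1: "adj (last ?A) (p ! k)" using lA True adj_sym by simp
    have e2: "adj (p ! k) (p ! j)" using is_path_nth[OF p(1), of j] True p m adj_sym by auto
    have d: "distinct (?A @ [p ! j, p ! k])" using t p_dist distinct_take by metis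
    have inL: "set (?A @ [p ! j, p ! k]) = L" using t by simp
    have "is_path [p ! k, p ! j, q]"
      using e2 j(2) q_fresh L_nth[of k] set_p by (auto simp: is_path3)
    then have "is_path (?A @ [p ! k, p ! j, q])"
      using pA d e1 q_fresh set_take_subset[of j p] by (intro is_path_appendI) auto
    moreover have "adj c (hd (?A @ [p ! k, p ! j, q]))"
      using adj_sym[OF hc] ne r by simp
    moreover have "set (?A @ [p ! k, p ! j, q]) \<inter> insert c R = {}"
    proof -
      have "set (?A @ [p ! k, p ! j, q]) = insert q L" using inL by auto
      then show ?thesis using disj_LcR q_fresh set_p by auto
    qed
    ultimately have "length (?A @ [p ! k, p ! j, q]) \<le> Suc k" by (rule head_bound)
    then show False using True r p m by simp
  qed
qed

text \<open>Now \<open>p ! Suc j\<close> is the exceptional vertex, so the end of a longest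
  excursion \<open>e\<close> from \<open>p ! j\<close> off the path has degree at least
  \<open>k\<close>, with neighbours among \<open>c\<close>, \<open>p ! j\<close> and the rest of
  \<open>e\<close>; thus \<open>length e \<ge> k - 1\<close>. Entering \<open>L\<close> from
  \<open>c\<close> at either of its ends bounds \<open>length e\<close> by \<open>k - j\<close> and
  by \<open>j\<close>. Together k \<le> 2.\<close>

lemma escape_low_False:
  assumes k3: "3 \<le> k" and lw: "card (nbrs (p ! Suc j)) < k"
  shows False
proof -
  note r = escape_range
  let ?P = "\<lambda>e. is_path (p ! j # e) \<and> set e \<inter> set p = {}"
  have "?P [q]" using j(2) q_fresh by simp
  then obtain e where e: "is_path (p ! j # e)" "set e \<inter> set p = {}" and max: "\<And>e'. ?P e' \<Longrightarrow> length e' \<le> length e"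
    using ex_has_greatest_nat[of ?P "[q]" length "Suc m"] bound
    by (metis (no_types, lifting) Suc_leD le_imp_less_Suc length_Cons)
  have ne: "e \<noteq> []" using max[of "[q]"] \<open>?P [q]\<close> by auto
  have ej: "adj (p ! j) (hd e)" "is_path e" using e(1) ne by (simp_all add: is_path_Cons_iff)
  define z where "z = last e"
  have z: "z \<in> set e" "z \<notin> set p" "z \<in> V" 
    using last_in_set[OF ne] e(2) is_pathD(3)[OF ej(2)] unfolding z_def by blast+
  have sub: "nbrs z \<subseteq> insert c (insert (p ! j) (set e - {z}))"
  proof
    fix y assume "y \<in> nbrs z"
    then have y: "adj z y" by simp
    have "y \<in> insert c (insert (p ! j) (set e))"
    proof (cases "y \<in> set p")
      case True
      have "y \<notin> R" using R_closed[of y z] adj_sym[OF y] z(2) set_p by blast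
      moreover have "y = p ! j" if "y \<in> L" using adj_L_out[OF that adj_sym[OF y]] z(2) set_p by blast
      ultimately show ?thesis using True set_p by blast
    next
      case False
      show ?thesis
      proof (rule ccontr)
        assume n: "y \<notin> insert c (insert (p ! j) (set e))"
        then have "is_path (p ! j # e @ [y])"
          using is_path_snoc_iff[of "p ! j # e" y] e(1) ne y by (simp add: z_def)
        then show False using max[of "e @ [y]"] e(2) False by simp
      qed
    qed
    then show "y \<in> insert c (insert (p ! j) (set e - {z}))" using adj_neq[OF y] by blast
  qed
  have "p ! Suc j \<in> set p" using r p m by (intro nth_mem) simp
  then have "z \<noteq> p ! Suc j" using z(2) by blast
  then have "k \<le> card (nbrs z)"
    using low_unique[OF low z(3), of "p ! Suc j"] lw nth_V[OF p(1), of "Suc j"] r p m by simp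
  also have "\<dots> \<le> card (insert c (insert (p ! j) (set e - {z})))" using sub by (intro card_mono) auto
  also have "\<dots> \<le> Suc (Suc (card (set e - {z})))" by (simp add: card_insert_if)
  also have "card (set e - {z}) = length e - 1"
    using z(1) distinct_card[OF is_pathD(2)[OF ej(2)]] by simp
  finally have le: "k \<le> length e + 1" using ne by (cases e) auto
  let ?A = "take (Suc j) p"
  have disj: "set e \<inter> insert c (L \<union> R) = {}" using e(2) set_p by simp
  have AL: "set ?A \<subseteq> L" using r by (simp add: set_take_subset_set_take)
  have "is_path (?A @ e)"
  proof (rule is_path_appendI[OF _ ej(2)])
    show "is_path ?A" using is_path_take[OF p(1)] by simp
    show "set ?A \<inter> set e = {}" using AL disj by blast
    show "adj (last ?A) (hd e)" using ej(1) r p m by (simp add: take_Suc_conv_app_nth)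
  qed
  moreover have "adj c (hd (?A @ e))"
    using hc hd_p adj_sym p_ne by (simp add: hd_conv_nth hd_append)
  moreover have "set (?A @ e) \<inter> insert c R = {}" using AL disj disj_LcR by auto
  ultimately have "length (?A @ e) \<le> Suc k" by (rule head_bound)
  then have 1: "j + length e \<le> k" using r p m by simp
  let ?B = "drop j (take (Suc k) p)"
  have BL: "set ?B \<subseteq> L" by (rule set_drop_subset)
  have Bne: "?B \<noteq> []" using r p m by simp
  have "is_path (rev ?B @ e)"
  proof (rule is_path_appendI[OF _ ej(2)])
    show "is_path (rev ?B)" using is_path_drop[OF L_path] r p m by simp
    show "set (rev ?B) \<inter> set e = {}" using BL disj by auto
    have "last (rev ?B) = p ! j" using Bne r p m by (simp add: last_rev hd_drop_conv_nth)
    then show "adj (last (rev ?B)) (hd e)" using ej(1) by simp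
  qed
  moreover have "adj c (hd (rev ?B @ e))"
  proof -
    have "last ?B = last (take (Suc k) p)" using Bne by (intro last_drop) (simp del: length_take)
    also have "\<dots> = p ! k" using p m by (simp add: take_Suc_conv_app_nth)
    finally have "last ?B = p ! k" .
    then have "hd (rev ?B @ e) = p ! k" using Bne by (simp add: hd_rev)
    then show ?thesis using is_path_nth[OF p(1), of k] p m k1 adj_sym by simp
  qed
  moreover have "set (rev ?B @ e) \<inter> insert c R = {}" using BL disj disj_LcR by auto
  ultimately have "length (rev ?B @ e) \<le> Suc k" by (rule head_bound)
  then have 2: "length e \<le> j" using r p m by simp
  show False using le 1 2 k3 by simp
qed

text \<open>For \<open>k = 2\<close> the escape point \<open>a\<close> is the middle one of the
  three vertices of \<open>L\<close>. Neighbours of \<open>a\<close> other than \<open>c\<close> see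
  at most \<open>a\<close> and \<open>c\<close>: a further edge would extend \<open>p ! 0\<close>,
  \<open>a\<close> to a path on four vertices, against \<open>head_bound\<close>. What remains
  splits at \<open>c\<close> into components of at most two vertices.\<close>

lemma escape_star:
  assumes k2: "k = 2"
  shows hub_star
proof -
  note r = escape_range
  have j1: "j = 1" using r k2 by simp
  have mm: "m = 6" using m k2 by simp
  define a where "a = p ! 1"
  define Lf where "Lf = nbrs a - {c}"
  have c: "c = p ! 3" using k2 by (simp add: numeral_eq_Suc)
  have Lset: "L = {p ! 0, a, p ! 2}"
  proof -
    have "i \<le> 2 \<longleftrightarrow> i = 0 \<or> i = 1 \<or> i = 2" for i :: nat by auto
    then show ?thesis using L_index k2 unfolding a_def by auto
  qed
  have neq: "p ! 0 \<noteq> p ! 2" "a \<noteq> c" "a \<noteq> p ! 0" "a \<noteq> p ! 2" "p ! 0 \<noteq> c" "p ! 2 \<noteq> c"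
    unfolding a_def c using nth_neq mm by auto
  have n02: "\<not> adj (p ! 0) (p ! 2)" using hd_not_adj j1 by (simp add: numeral_eq_Suc)
  have nb0: "nbrs (p ! 0) \<subseteq> {a, c}" using others_nbrs[of 0] n02 adj_irrefl j1 Lset by auto
  have nb2: "nbrs (p ! 2) \<subseteq> {a, c}" using others_nbrs[of 2] n02 adj_sym adj_irrefl j1 k2 Lset by auto
  have e: "adj (p ! 0) a" "adj c (p ! 0)" "adj a (p ! 2)" "adj (p ! 2) c"
    using is_path_nth[OF p(1)] hc hd_p adj_sym p mm unfolding a_def c
    by (auto simp: numeral_eq_Suc k2)
  have Lf_nbrs: "nbrs x \<subseteq> {a, c}" if x: "x \<in> Lf" for x
  proof (cases "x \<in> L")
    case True
    then have "x = p ! 0 \<or> x = p ! 2" using x Lset adj_irrefl unfolding Lf_def by auto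
    then show ?thesis using nb0 nb2 by auto
  next
    case False
    have ax: "adj a x" "x \<noteq> c" using x unfolding Lf_def by auto
    have xR: "x \<notin> R"
    proof
      assume "x \<in> R"
      then have "a \<in> R \<or> a = c" using R_closed adj_sym[OF ax(1)] by blast
      then show False using disj_LcR Lset neq by auto
    qed
    show ?thesis
    proof (rule ccontr)
      assume "\<not> nbrs x \<subseteq> {a, c}"
      then obtain y where y: "adj x y" "y \<noteq> a" "y \<noteq> c" unfolding nbrs_def by blast
      have "y \<notin> R" using R_closed[of y x] adj_sym[OF y(1)] xR ax(2) by blast
      moreover have "y \<noteq> p ! 0" "y \<noteq> p ! 2"
        using nb0 nb2 adj_sym[OF y(1)] False Lset ax(2) by auto
      moreover have "is_path [p ! 0, a, x, y]"
        using e(1) ax(1) y False Lset neq calculation adj_neq[OF y(1)] adj_neq[OF ax(1)]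
        by (auto simp: is_path_Cons_iff)
      moreover have "adj c (hd [p ! 0, a, x, y])" using e by simp
      moreover have "set [p ! 0, a, x, y] \<inter> insert c R = {}"
        using disj_LcR Lset xR ax(2) y calculation(1) neq by auto
      ultimately have "length [p ! 0, a, x, y] \<le> Suc k" using head_bound by blast
      then show False using k2 by simp
    qed
  qed
  define D where "D = insert a Lf"
  have closed: "y \<in> D \<or> y = c" if "x \<in> D" "adj x y" for x y
  proof (cases "x = a")
    case True then show ?thesis using that by (simp add: D_def Lf_def)
  next
    case False
    then have "x \<in> Lf" using that(1) by (simp add: D_def)
    from nbrs_subsetD[OF Lf_nbrs[OF this] that(2)] show ?thesis by (auto simp: D_def)
  qed
  have pV: "c \<in> V" "a \<in> V" using e adj_V by blast+
  have small: "card (component {c} x) \<le> k" if x: "x \<in> V - {c} - D" for x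
  proof (rule component_card_le[OF conn low k1 pV(1) _ _ x])
    show "y \<in> D \<or> y = c" if "z \<in> D" "adj z y" for z y using closed that by blast
    fix r assume r: "is_path (c # r)" "set r \<inter> D = {}"
    have L_D: "L \<subseteq> D" using Lset e neq adj_sym unfolding D_def Lf_def by auto
    have "Suc k + Suc (length r) \<le> m"
      by (rule prefix_bound[OF p _ _ r(1)]) (use r(2) L_D m in auto)
    then show "length r \<le> k" using m by simp
  qed
  define M where "M = V - {c, a} - Lf"
  have 1: "(x \<in> M \<and> y \<in> M) \<or> (x = a \<and> y \<notin> M) \<or> (y = a \<and> x \<notin> M)" if xy: "adj x y" "x \<noteq> c" "y \<noteq> c" for x y
  proof -
    have V: "x \<in> V" "y \<in> V" using adj_V[OF xy(1)] by auto
    have yx: "adj y x" using adj_sym[OF xy(1)] .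
    consider "x = a" | "y = a" | "x \<noteq> a" "y \<noteq> a" by blast
    then show ?thesis
    proof cases
      case 1 then show ?thesis using xy by (simp add: M_def Lf_def)
    next
      case 2 then show ?thesis using xy yx by (simp add: M_def Lf_def)
    next
      case 3
      then have "x \<notin> Lf" "y \<notin> Lf"
        using nbrs_subsetD[OF Lf_nbrs xy(1)] nbrs_subsetD[OF Lf_nbrs yx] xy by blast+
      then show ?thesis using 3 xy V by (simp add: M_def)
    qed
  qed
  have 2: "y = z" if xyz: "x \<in> M" "y \<in> M" "z \<in> M" "adj x y" "adj x z" for x y z
  proof (rule ccontr)
    assume "y \<noteq> z"
    then have c3: "card {x, y, z} = 3" using adj_neq[OF xyz(4)] adj_neq[OF xyz(5)] by simp
    have xD: "x \<in> V - {c} - D" using xyz(1) by (auto simp: M_def D_def)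
    have "{x, y, z} \<subseteq> component {c} x"
      using component_step[of x "{c}" x] xyz by (auto simp: M_def)
    moreover have "finite (component {c} x)"
      using component_in[of x "{c}"] xD finite_V finite_subset by blast
    ultimately have "3 \<le> card (component {c} x)" using c3 card_mono by metis
    then show False using small[OF xD] k2 by simp
  qed
  have 3: "M \<subseteq> V - {c, a}" "a \<in> V - {c}" using pV neq by (auto simp: M_def)
  show ?thesis
    unfolding hub_star_def
    by (rule bexI[OF _ pV(1)], rule bexI[OF _ 3(2)], rule exI[of _ M], intro conjI allI ballI impI)
      (fact 3(1), rule 1, assumption+, rule 2, assumption+)
qed

end

text \<open>If nothing escapes from \<open>L\<close>, its \<open>k + 1\<close> vertices are the
  large block at \<open>c\<close>.\<close>

theorem unbalanced_structure: "block_cut k \<or> k = 2 \<and> hub_star"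
proof (cases "\<forall>x\<in>L. nbrs x \<subseteq> insert c L")
  case True
  have "block_cut k"
  proof (rule block_cutI[OF conn low k1, of c L])
    show "c \<in> V" using nth_V[OF p(1)] p m k1 by simp
    show "L \<subseteq> V - {c}" using set_p p_V disj_LcR by blast
    show "card L \<le> k + 1" using card_length[of "take (Suc k) p"] by simp
    show "y \<in> L \<or> y = c" if "x \<in> L" "adj x y" for x y
      using True nbrs_subsetD[OF _ that(2)] that(1) by blast
    fix r assume r: "is_path (c # r)" "set r \<inter> L = {}"
    have "Suc k + Suc (length r) \<le> m" by (rule prefix_bound[OF p _ _ r(1)]) (use r(2) m in auto)
    then show "length r \<le> k" using m by simp
  qed
  then show ?thesis ..
next
  case False
  then obtain x q where x: "x \<in> L" "adj x q" "q \<notin> insert c L" unfolding nbrs_def by blast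
  then obtain j where j: "j \<le> k" "adj (p ! j) q" "q \<notin> insert c L" using L_index by auto
  have "0 < j" "j < k" using escape_range[OF j] by auto
  then have "k = 2 \<or> 3 \<le> k" by linarith
  moreover have "\<not> 3 \<le> k"
    using escape_regular_False[OF j] escape_low_False[OF j] by (meson not_le)
  ultimately show ?thesis using escape_star[OF j] by blast
qed

end

section \<open>Longest paths with both ends of large degree\<close>

context path_bounded begin

text \<open>If one of the first \<open>k\<close> vertices sees beyond position \<open>k\<close>, it
  sees position \<open>Suc k\<close> and nothing further; rotating it to the front produces an
  \<open>unbalanced_path\<close>.\<close>

lemma linked_half:
  assumes p: "is_path p" "length p = m" and m: "m = 2 * k + 2"
    and S: "\<And>i. i < k \<Longrightarrow> adj (hd p) (p ! Suc i)"
    and T: "\<And>i. k < i \<Longrightarrow> i \<le> 2 * k \<Longrightarrow> adj (last p) (p ! i)"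
  shows "(block_cut k \<or> k = 2 \<and> hub_star) \<or> (\<forall>s<k. nbrs (p ! s) \<subseteq> set (take (Suc k) p))"
proof (cases "\<forall>s<k. nbrs (p ! s) \<subseteq> set (take (Suc k) p)")
  case False
  then obtain s y where s: "s < k" "adj (p ! s) y" "y \<notin> set (take (Suc k) p)" unfolding nbrs_def by blast
  have sm: "Suc s < m" using s m by simp
  have "nbrs (p ! s) \<subseteq> set (take (Suc (Suc k)) p)"
    by (rule rotated_nbrs[OF p _ _ S[OF s(1)]]) (use s(1) T m k1 in auto)
  then have "y \<in> set (take (Suc (Suc k)) p)" using nbrs_subsetD s(2) by blast
  then have y: "y = p ! Suc k" using s(3) p m k1 take_Suc_conv_app_nth[of "Suc k" p] by simp
  define q where "q = rev (take (Suc s) p) @ drop (Suc s) p"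
  note q = rotated[OF p sm S[OF s(1)], folded q_def]
  have qn: "q ! i = p ! i" if "k \<le> i" "i < m" for i using q(6)[of i] that s by simp
  have hq: "adj (hd q) (q ! Suc k)" using s(2) y q(3) qn[of "Suc k"] m k1 by simp
  have Tq: "adj (last q) (q ! i)" if "k < i" "i \<le> 2 * k" for i
    using T[OF that] q(4) qn[of i] that m by simp
  show ?thesis
  proof (cases "k \<le> card (nbrs (hd q))")
    case True
    then have "unbalanced_path V adj m k q"
      using q(1,2) m hq Tq by unfold_locales auto
    then show ?thesis using unbalanced_path.unbalanced_structure by blast
  next
    \<comment> \<open>The vertex \<open>p ! s\<close> has degree below \<open>k\<close>. A second
      rotation, over its edge to position \<open>Suc k\<close>, brings \<open>p ! k\<close> to the
      front, which is then not exceptional.\<close>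
    case low_s: False
    have km: "Suc k < m" using m k1 by simp
    define r where "r = rev (take (Suc k) q) @ drop (Suc k) q"
    note r = rotated[OF q(1,2) km hq, folded r_def]
    have rn: "r ! i = p ! i" if "Suc k \<le> i" "i < m" for i using r(6)[of i] qn[of i] that by simp
    have hr: "hd r = p ! k" using r(3) qn[of k] km by simp
    have ne: "p ! k \<noteq> hd q"
      using q(3) s(1) is_pathD(2)[OF p(1)] p m by (simp add: nth_eq_iff_index_eq)
    have "k \<le> card (nbrs (hd r))"
      using low_unique[OF low nth_V[OF p(1)] nth_V[OF p(1)], of k s] ne q(3) low_s hr s(1) p km by simp
    moreover have "adj (hd r) (r ! Suc k)"
      using hr rn[of "Suc k"] is_path_nth[OF p(1), of k] p km by simp
    moreover have "adj (last r) (r ! i)" if "k < i" "i \<le> 2 * k" for i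
      using T[OF that] q(4) r(4) rn[of i] that m by simp
    ultimately have "unbalanced_path V adj m k r"
      using r(1,2) m by unfold_locales auto
    then show ?thesis using unbalanced_path.unbalanced_structure by blast
  qed
qed simp

text \<open>\<open>linked_half\<close>, applied to the path and to its reverse, closes both halves,
  so positions \<open>k\<close> and \<open>Suc k\<close> are the two centres.\<close>

lemma bridge_structure:
  assumes p: "is_path p" "length p = m" and m: "m = 2 * k + 2"
    and S: "\<And>i. i < k \<Longrightarrow> adj (hd p) (p ! Suc i)"
    and T: "\<And>i. k < i \<Longrightarrow> i \<le> 2 * k \<Longrightarrow> adj (last p) (p ! i)"
  shows "block_cut k \<or> k = 2 \<and> hub_star \<or> linked k"
proof (rule ccontr)
  assume neg: "\<not> ?thesis"
  have ne: "p \<noteq> []" using p(1) by auto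
  have L: "nbrs (p ! s) \<subseteq> set (take (Suc k) p)" if "s < k" for s
    using linked_half[OF p m S T] neg that by blast
  let ?r = "rev p"
  have r: "is_path ?r" "length ?r = m" using p by auto
  have rn: "?r ! i = p ! (2 * k + 1 - i)" if "i < m" for i using that p m by (simp add: rev_nth)
  have R: "nbrs (?r ! s) \<subseteq> set (take (Suc k) ?r)" if s: "s < k" for s
  proof -
    have "adj (hd ?r) (?r ! Suc i)" if "i < k" for i
      using T[of "2 * k - i"] that rn[of "Suc i"] ne m by (simp add: hd_rev)
    moreover have "adj (last ?r) (?r ! i)" if "k < i" "i \<le> 2 * k" for i
      using S[of "2 * k - i"] that rn[of i] ne m by (simp add: last_rev Suc_diff_le)
    ultimately show ?thesis using linked_half[OF r m] neg s by blast
  qed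
  have split: "p = take k p @ [p ! k, p ! Suc k] @ drop (k + 2) p"
  proof -
    have "p = take k p @ p ! k # drop (Suc k) p" using p m by (intro id_take_nth_drop) simp
    moreover have "drop (Suc k) p = p ! Suc k # drop (k + 2) p"
      using p m k1 Cons_nth_drop_Suc[of "Suc k" p] by simp
    ultimately show ?thesis by simp
  qed
  have "linked k"
  proof (rule linkedI[OF conn low k1])
    show "is_path (take k p @ [p ! k, p ! Suc k] @ drop (k + 2) p)" using p(1) split by simp
    show "length (take k p) = k" "length (drop (k + 2) p) = k" using p m by auto
    show "y \<in> set (take k p) \<or> y = p ! k" if "x \<in> set (take k p)" "adj x y" for x y
      using closed_takeI[OF p _ L that] m by simp
    have tk: "set (take k ?r) = set (drop (k + 2) p)" using p m by (simp add: take_rev)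
    have rk: "?r ! k = p ! Suc k" using rn[of k] m by simp
    show "y \<in> set (drop (k + 2) p) \<or> y = p ! Suc k" if "x \<in> set (drop (k + 2) p)" "adj x y" for x y
    proof -
      have "x \<in> set (take k ?r)" using that(1) tk by simp
      from closed_takeI[OF r _ R this that(2)] show ?thesis using tk rk m by simp
    qed
    show "length q \<le> 2 * k + 2" if "is_path q" for q using bound[OF that] m by simp
  qed
  then show False using neg by blast
qed

theorem both_ends_regular:
  assumes p: "is_path p" "length p = m" and m: "m \<le> 2 * k + 2"
    and reg: "k \<le> card (nbrs (hd p))" "k \<le> card (nbrs (last p))"
  shows "(m = 2 * k + 1 \<and> small_components k) \<or>
    (m = 2 * k + 2 \<and> (block_cut k \<or> k = 2 \<and> hub_star \<or> linked k \<or> covered_but_edge k \<or> k = 3 \<and> two_hubs))"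
proof -
  have ne: "p \<noteq> []" using p(1) by auto
  have dist: "distinct p" using is_pathD[OF p(1)] by blast
  define S where "S = {i. Suc i < m \<and> adj (hd p) (p ! Suc i)}"
  define T where "T = {i. Suc i < m \<and> adj (last p) (p ! i)}"
  have cS: "k \<le> card S" using card_nbr_indices[OF p] reg by (simp add: S_def)
  have cT: "k \<le> card T"
  proof -
    have "nbrs (last p) \<subseteq> (\<lambda>i. p ! i) ` T"
    proof
      fix y assume y: "y \<in> nbrs (last p)"
      then obtain i where i: "i < m" "y = p ! i" using last_nbrs[OF p] mem_set_nth[of y p] p(2) by blast
      have "i \<noteq> m - 1"
      proof
        assume "i = m - 1"
        then have "y = last p" using i ne p by (simp add: last_conv_nth)
        then show False using y adj_irrefl by simp
      qed
      then have "i \<in> T" using i y by (auto simp: T_def)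
      then show "y \<in> (\<lambda>i. p ! i) ` T" using i by blast
    qed
    moreover have finT: "finite T" by (rule finite_subset[of _ "{..<m}"]) (auto simp: T_def)
    ultimately have "card (nbrs (last p)) \<le> card ((\<lambda>i. p ! i) ` T)" by (intro card_mono) auto
    also have "\<dots> \<le> card T" using finT by (rule card_image_le)
    finally show ?thesis using reg by simp
  qed
  have disj: "S \<inter> T = {}" using no_cross[OF p] by (auto simp: S_def T_def)
  have cross: "Suc i \<notin> S" if "i \<in> T" for i
    using no_cross2[OF p, of i] that by (auto simp: S_def T_def)
  have ran: "S \<subseteq> {..<m - 1}" "T \<subseteq> {..<m - 1}" by (auto simp: S_def T_def)
  have "m - 1 \<le> 2 * k + 1" using m by simp
  from crossing_free_index_sets[OF ran disj cross cS cT k1 this]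
  \<comment> \<open>A is the balanced case, B and C have one set filled and one index of slack in
    the other, D is the crossing that leaves a cycle of length \<open>2 * k\<close>.\<close>
  consider (A) "m = 2 * k + 1" "S = {..<k}" "T = {k..<m - 1}"
    | (B) "m = 2 * k + 2" "T = {k + 1..<m - 1}" "S \<subseteq> {..<k + 1}"
    | (C) "m = 2 * k + 2" "S = {..<k}" "T \<subseteq> {k..<m - 1}"
    | (D) t where "m = 2 * k + 2" "t \<in> T" "t + 2 \<in> S"
    using m3 k1 by auto
  then show ?thesis
  proof cases
    case A
    have "small_components k"
    proof (rule balanced_cut[OF p A(1)])
      show "adj (hd p) (p ! Suc i)" if "i < k" for i using that A(2) by (auto simp: S_def)
      show "adj (last p) (p ! i)" if "k \<le> i" "Suc i < m" for i
      proof -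
        have "i \<in> T" using that A(3) by auto
        then show ?thesis by (simp add: T_def)
      qed
    qed
    then show ?thesis using A(1) by simp
  next
    case B
    have T: "adj (last p) (p ! i)" if "k < i" "i \<le> 2 * k" for i
    proof -
      have "i \<in> T" using that B(1,2) by auto
      then show ?thesis by (simp add: T_def)
    qed
    show ?thesis
    proof (cases "k \<in> S")
      case True
      then have "unbalanced_path V adj m k p"
        using p B(1) reg T by unfold_locales (auto simp: S_def)
      then show ?thesis using unbalanced_path.unbalanced_structure B(1) by blast
    next
      case False
      have "S \<subseteq> {..<k}"
      proof
        fix i assume "i \<in> S"
        then have "i < k + 1" "i \<noteq> k" using B(3) False by auto
        then show "i \<in> {..<k}" by simp
      qed
      then have "S = {..<k}" using card_seteq[of "{..<k}" S] cS by simp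
      then have "adj (hd p) (p ! Suc i)" if "i < k" for i using that by (auto simp: S_def)
      then show ?thesis using bridge_structure[OF p B(1) _ T] B(1) by blast
    qed
  next
    case C
    have S: "adj (hd p) (p ! Suc i)" if "i < k" for i using that C(2) by (auto simp: S_def)
    show ?thesis
    proof (cases "k \<in> T")
      \<comment> \<open>With the slack index in \<open>T\<close> the reversed path is an
        \<open>unbalanced_path\<close>.\<close>
      case True
      let ?r = "rev p"
      have rn: "?r ! i = p ! (2 * k + 1 - i)" if "i < m" for i using that p C(1) by (simp add: rev_nth)
      have "adj (last ?r) (?r ! i)" if "k < i" "i \<le> 2 * k" for i
        using S[of "2 * k - i"] that rn[of i] ne C(1) by (simp add: last_rev Suc_diff_le)
      moreover have "adj (hd ?r) (?r ! Suc k)"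
        using True rn[of "Suc k"] ne C(1) k1 by (simp add: T_def hd_rev)
      ultimately have "unbalanced_path V adj m k ?r"
        using p C(1) reg ne by unfold_locales (auto simp: hd_rev)
      then show ?thesis using unbalanced_path.unbalanced_structure C(1) by blast
    next
      case False
      have sub: "T \<subseteq> {k + 1..<m - 1}"
      proof
        fix i assume "i \<in> T"
        then have "k \<le> i" "i < m - 1" "i \<noteq> k" using C(3) False by auto
        then show "i \<in> {k + 1..<m - 1}" by simp
      qed
      then have Teq: "T = {k + 1..<m - 1}" using card_seteq[OF _ sub] cT C(1) by simp
      have "adj (last p) (p ! i)" if "k < i" "i \<le> 2 * k" for i
      proof -
        have "i \<in> T" using that Teq C(1) by auto
        then show ?thesis by (simp add: T_def)
      qed
      then show ?thesis using bridge_structure[OF p C(1) S] C(1) by blast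
    qed
  next
    case D
    have t: "t + 3 < m" "adj (hd p) (p ! (t + 3))" "adj (last p) (p ! t)"
      using D(2,3) by (auto simp: S_def T_def numeral_eq_Suc)
    \<comment> \<open>For \<open>k = 1\<close> the path has four vertices and \<open>t\<close> is 0;
      but 0 is in \<open>S\<close> through the first edge of the path, hence not in
      \<open>T\<close>.\<close>
    have "2 \<le> k"
    proof (rule ccontr)
      assume "\<not> 2 \<le> k"
      then have "t = 0" using t(1) D(1) k1 by simp
      then have "0 \<in> T" using D(2) by simp
      moreover have "0 \<in> S" using is_path_nth[OF p(1), of 0] p m3 ne by (simp add: S_def hd_conv_nth)
      ultimately show False using disj by blast
    qed
    let ?C = "rev (take (Suc t) p) @ drop (t + 3) p"
    have len: "4 \<le> length p + 2 - 3" using p D(1) \<open>2 \<le> k\<close> by simp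
    note C = shortcut_cycle[OF p(1) _ _ t(2,3) len]
    have cyc: "is_cycle ?C" "length ?C = 2 * k" using C(1,2) t(1) p D(1) by simp_all
    have "take 2 (drop (Suc t) p) = [p ! (t + 1), p ! (t + 2)]"
      using t(1) p by (simp add: numeral_2_eq_2 take_Suc_conv_app_nth)
    then have out: "p ! (t + 1) \<notin> set ?C" "p ! (t + 2) \<notin> set ?C"
      using C(3) t(1) p by auto
    have e: "adj (p ! (t + 1)) (p ! (t + 2))" using is_path_nth[OF p(1), of "t + 1"] t(1) p by simp
    have "covered_but_edge k \<or> k = 2 \<and> (block_cut 2 \<or> hub_star) \<or> k = 3 \<and> two_hubs"
    proof (rule cycle_edge_structure[OF conn cyc _ _ _ low e out])
      show "2 * k + 3 \<le> card V" using less D(1) by simp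
      show "length q \<le> 2 * k + 2" if "is_path q" for q using bound[OF that] D(1) by simp
      show "\<nexists>D. is_cycle D \<and> length D = 2 * k + 1" using no_cycle D(1) by fastforce
    qed
    then show ?thesis using D(1) by blast
  qed
qed

end

section \<open>A leaf at the end of every longest path\<close>

context path_bounded begin

text \<open>\<open>covered_but_edge\<close> carries a bound on \<open>card V\<close> because (i)
  offers H(n, 2k + 2, k) under that bound.\<close>

definition target :: bool where
  "target \<longleftrightarrow> (2 * k + 3 \<le> card V \<and> covered_but_edge k) \<or> block_cut k \<or> linked k \<or>
     k = 2 \<and> hub_star \<or> k = 3 \<and> two_hubs"

lemma four_cycle_target:
  assumes "k = 2" "m = 6" and C: "is_cycle [a, b, c, d]" and uv: "adj u v" "{u, v} \<inter> {a, b, c, d} = {}"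
  shows target
proof -
  have "covered_but_edge k \<or> k = 2 \<and> (block_cut 2 \<or> hub_star) \<or> k = 3 \<and> two_hubs"
  proof (rule cycle_edge_structure[OF conn C _ _ _ _ low uv(1)])
    show "length [a, b, c, d] = 2 * k" "2 * k + 3 \<le> card V" using assms(1,2) less by auto
    show "length q \<le> 2 * k + 2" if "is_path q" for q using bound[OF that] assms(1,2) by simp
    show "\<nexists>D. is_cycle D \<and> length D = 2 * k + 1" using no_cycle assms(1,2) by fastforce
  qed (use uv(2) in auto)
  then show ?thesis using less assms(1,2) unfolding target_def by auto
qed

text \<open>The last two vertices see nothing but their neighbours on the path, so everything
  depends on a second neighbour of the first vertex, which can be at position 2 or 3.\<close>

lemma pendant_path_target:
  assumes k2: "k = 2" and m6: "m \<le> 6"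
    and p: "is_path p" "length p = m" and reg: "k \<le> card (nbrs (hd p))"
    and w: "nbrs (last p) = {p ! (m - 2)}"
    and z: "nbrs (p ! (m - 2)) \<subseteq> {last p, p ! (m - 3)}"
  shows target
proof -
  have ne: "p \<noteq> []" and dist: "distinct p" using is_pathD[OF p(1)] by auto
  have lst: "last p = p ! (m - 1)" using ne p by (simp add: last_conv_nth)
  have neq: "p ! i \<noteq> p ! i'" if "i < m" "i' < m" "i \<noteq> i'" for i i'
    using dist p that by (simp add: nth_eq_iff_index_eq)
  have nw: "\<not> adj x (last p)" if "x \<noteq> p ! (m - 2)" for x
    using w adj_sym[of x "last p"] that mem_nbrs by blast
  have nz: "\<not> adj x (p ! (m - 2))" if "x \<noteq> last p" "x \<noteq> p ! (m - 3)" for x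
    using nbrs_subsetD[OF z] adj_sym[of x "p ! (m - 2)"] that by blast
  have hd0: "hd p = p ! 0" using ne by (rule hd_conv_nth)
  have "\<exists>y. adj (p ! 0) y \<and> y \<noteq> p ! 1"
  proof (rule ccontr)
    assume "\<not> ?thesis"
    then have "nbrs (p ! 0) \<subseteq> {p ! 1}" unfolding nbrs_def by blast
    then have "card (nbrs (p ! 0)) \<le> 1" using card_mono[of "{p ! 1}" "nbrs (p ! 0)"] by simp
    then show False using reg k2 hd0 by simp
  qed
  then obtain y where y: "adj (p ! 0) y" "y \<noteq> p ! 1" by blast
  obtain i where i: "i < m" "y = p ! i"
    using nbrs_subsetD[OF hd_nbrs[OF p]] hd0 y(1) mem_set_nth[of y p] p(2) by force
  have i2: "2 \<le> i"
  proof -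
    have "i \<noteq> 0" using i y(1) adj_irrefl by metis
    moreover have "i \<noteq> 1" using i y(2) by auto
    ultimately show ?thesis by simp
  qed
  have i3: "i \<noteq> m - 1"
  proof
    assume "i = m - 1"
    then have "adj (p ! 0) (last p)" using y i lst by simp
    then have "p ! 0 = p ! (m - 2)" using nw by blast
    then show False using neq[of 0 "m - 2"] m3 by simp
  qed
  have i4: "i \<noteq> m - 2"
  proof
    assume im: "i = m - 2"
    then have a: "adj (p ! 0) (p ! (m - 2))" using y i by simp
    have "p ! 0 \<noteq> last p" "p ! 0 \<noteq> p ! (m - 3)"
      using neq[of 0 "m - 1"] neq[of 0 "m - 3"] lst m3 im i2 by auto
    then show False using nz a by blast
  qed
  have "5 \<le> m" "i \<le> m - 3" using i i2 i3 i4 by auto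
  then consider "m = 5" "i = 2" | "m = 6" "i = 2 \<or> i = 3" using m6 i2 by linarith
  then show ?thesis
  proof cases
    case 1
    then obtain a b c d e where pe: "p = [a, b, c, d, e]"
      using p(2) by (auto simp: length_Suc_conv numeral_eq_Suc)
    have W: "nbrs e = {d}" "nbrs d \<subseteq> {e, c}" using w z 1 pe by (auto simp: numeral_eq_Suc)
    have A: "adj a b" "adj b c" "adj c d" "adj d e" using p(1) pe by (auto simp: is_path_def)
    have D: "distinct [a, b, c, d, e]" using dist pe by simp
    have ac: "adj a c" using y i 1 pe by simp
    have "is_path [b, a, c, d, e]"
      using A ac D p(1) pe adj_sym[OF A(1)] by (auto simp: is_path_def)
    then have nb: "nbrs b \<subseteq> {a, b, c, d, e}" using hd_nbrs[of "[b, a, c, d, e]"] 1 by auto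
    have na: "nbrs a \<subseteq> {a, b, c, d, e}" using hd_nbrs[OF p] pe by auto
    have no: "\<not> adj x e" "\<not> adj x d" if "x = a \<or> x = b" for x
      using W adj_sym[of x e] adj_sym[of x d] nbrs_subsetD[OF W(2)] mem_nbrs that D by auto
    have cl: "y \<in> {a, b} \<or> y = c" if "x \<in> {a, b}" "adj x y" for x y
      using that nbrs_subsetD[OF na] nbrs_subsetD[OF nb] no[of x] by auto
    have "small_components k"
    proof (rule small_componentsI[OF conn low k1, of c "{a, b}"])
      show "c \<in> V" using A adj_V by blast
      show "card {a, b} \<le> k" using k2 by (simp add: card_insert_if)
      show "y \<in> {a, b} \<or> y = c" if "x \<in> {a, b}" "adj x y" for x y using cl that by blast
      fix q assume q: "is_path (c # q)" "set q \<inter> {a, b} = {}"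
      have "2 + Suc (length q) \<le> m"
        by (rule prefix_bound[OF p]) (use q pe 1 in \<open>auto simp: numeral_eq_Suc\<close>)
      then show "length q \<le> k" using 1 k2 by simp
    qed simp
    then show ?thesis using small_components_block_cut unfolding target_def by blast
  next
    case 2
    then obtain a b c d e f where pe: "p = [a, b, c, d, e, f]"
      using p(2) by (auto simp: length_Suc_conv numeral_eq_Suc)
    have W: "nbrs f = {e}" "nbrs e \<subseteq> {f, d}" using w z 2 pe by (auto simp: numeral_eq_Suc)
    have A: "adj a b" "adj b c" "adj c d" "adj d e" "adj e f" using p(1) pe by (auto simp: is_path_def)
    have D: "distinct [a, b, c, d, e, f]" using dist pe by simp
    have V: "{a, b, c, d, e, f} \<subseteq> V" using is_pathD(3)[OF p(1)] pe by simp
    have ef: "adj e f" "{e, f} \<inter> {a, b, c, d} = {}" "{e, f} \<inter> {b, a, c, d} = {}" using A D by auto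
    show ?thesis
    proof (cases "adj a d")
      case True
      have "is_cycle [a, b, c, d]"
        unfolding is_cycle_def is_path_def using A D V adj_sym[OF True] by auto
      then show ?thesis using four_cycle_target[OF k2 2(1) _ ef(1,2)] by blast
    next
      \<comment> \<open>Without the edge \<open>ad\<close> the first three vertices form a triangle.
        If \<open>b\<close> is not adjacent to \<open>d\<close> either, \<open>a\<close> and
        \<open>b\<close> hang at \<open>c\<close>, and \<open>e\<close> and \<open>f\<close> hang at
        \<open>d\<close>.\<close>
      case nad: False
      then have ac: "adj a c" using y(1) i(2) 2(2) pe by (auto simp: numeral_eq_Suc)
      have bp: "is_path [b, a, c, d, e, f]"
        using A ac D V adj_sym[OF A(1)] by (auto simp: is_path_def)
      show ?thesis
      proof (cases "adj b d")
        case True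
        have "is_cycle [b, a, c, d]"
          unfolding is_cycle_def is_path_def using A D V ac adj_sym[OF True] adj_sym[OF A(1)] by auto
        then show ?thesis using four_cycle_target[OF k2 2(1) _ ef(1,3)] by blast
      next
        case nbd: False
        have nb: "nbrs b \<subseteq> {a, b, c, d, e, f}" using hd_nbrs[OF bp] 2 by auto
        have na: "nbrs a \<subseteq> {a, b, c, d, e, f}" using hd_nbrs[OF p] pe by auto
        have no: "\<not> adj x f" "\<not> adj x e" if "x = a \<or> x = b" for x
          using W adj_sym[of x f] adj_sym[of x e] nbrs_subsetD[OF W(2)] mem_nbrs that D by auto
        have cl: "y \<in> {a, b} \<or> y = c" if "x \<in> {a, b}" "adj x y" for x y
          using that nbrs_subsetD[OF na] nbrs_subsetD[OF nb] no[of x] nad nbd by auto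
        have "linked k"
        proof (rule linkedI[OF conn low k1])
          show "is_path ([a, b] @ [c, d] @ [e, f])" using p(1) pe by simp
          show "length [a, b] = k" "length [e, f] = k" using k2 by simp_all
          show "y \<in> set [a, b] \<or> y = c" if "x \<in> set [a, b]" "adj x y" for x y using cl that by auto
          show "y \<in> set [e, f] \<or> y = d" if xy: "x \<in> set [e, f]" "adj x y" for x y
          proof (cases "x = e")
            case True then show ?thesis using nbrs_subsetD[OF W(2)] xy(2) by auto
          next
            case False
            then have "y \<in> nbrs f" using xy by auto
            then show ?thesis using W(1) by auto
          qed
          show "length q \<le> 2 * k + 2" if "is_path q" for q using bound[OF that] 2 k2 by simp
        qed
        then show ?thesis unfolding target_def by blast
      qed
    qed
  qed
qed

end

context simple_graph begin

lemma remove_vertex: "simple_graph (V - {w}) (\<lambda>x y. adj x y \<and> x \<noteq> w \<and> y \<noteq> w)"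
  using finite_V adj_V adj_irrefl adj_sym by unfold_locales auto

end

context path_bounded begin

text \<open>Every longest path has the exceptional vertex as an end. If it had a neighbour beyond
  the second position, a rotation would give a longest path with both ends of degree at least
  \<open>k\<close>.\<close>

lemma leaf_ex:
  assumes ex: "is_path p" "length p = m"
    and noreg: "\<And>q. is_path q \<Longrightarrow> length q = m \<Longrightarrow> \<not> (k \<le> card (nbrs (hd q)) \<and> k \<le> card (nbrs (last q)))"
  shows "\<exists>r. is_path r \<and> length r = m \<and> card (nbrs (hd r)) < k \<and> nbrs (hd r) = {r ! 1}"
proof -
  obtain r where r: "is_path r" "length r = m" "card (nbrs (hd r)) < k"
  proof (cases "k \<le> card (nbrs (hd p))")
    case True
    then have "card (nbrs (last p)) < k" using noreg[OF ex] by simp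
    then show ?thesis using that[of "rev p"] ex is_pathD(1)[OF ex(1)] by (simp add: hd_rev)
  qed (use ex that in simp)
  have ne: "r \<noteq> []" and dist: "distinct r" using is_pathD[OF r(1)] by auto
  have reg: "k \<le> card (nbrs (r ! i))" if "0 < i" "i < m" for i
  proof -
    have "r ! i \<noteq> hd r" using that dist r ne by (simp add: hd_conv_nth nth_eq_iff_index_eq)
    moreover have "r ! i \<in> V" "hd r \<in> V" using is_pathD(3)[OF r(1)] ne that r(2) by auto
    ultimately show ?thesis using low_unique[OF low, of "r ! i" "hd r"] r(3) by simp
  qed
  have "y = r ! 1" if y: "adj (hd r) y" for y
  proof -
    obtain i where i: "i < m" "y = r ! i"
      using nbrs_subsetD[OF hd_nbrs[OF r(1,2)] y] mem_set_nth[of y r] r(2) by blast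
    have "i \<noteq> 0" using i y adj_irrefl hd_conv_nth[OF ne] by metis
    then obtain s where s: "i = Suc s" by (cases i) auto
    have "s = 0"
    proof (rule ccontr)
      assume s0: "s \<noteq> 0"
      have "adj (hd r) (r ! Suc s)" "Suc s < m" using y i s by auto
      note q = rotated[OF r(1,2) this(2,1)]
      have "last r = r ! (m - 1)" using ne r by (simp add: last_conv_nth)
      then have "k \<le> card (nbrs (last r))" "k \<le> card (nbrs (r ! s))" using reg m3 s0 i s by auto
      then show False using noreg[OF q(1,2)] q(3,4) by simp
    qed
    then show ?thesis using i s by simp
  qed
  moreover have "adj (hd r) (r ! 1)" using is_path_nth[OF r(1), of 0] r(2) m3 ne by (simp add: hd_conv_nth)
  ultimately have "nbrs (hd r) = {r ! 1}" unfolding nbrs_def by blast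
  then show ?thesis using r by blast
qed

text \<open>The leaf \<open>w\<close> is deleted. A path avoiding \<open>w\<close> has at most
  \<open>m - 1\<close> vertices, since one on \<open>m\<close> would have both ends of degree at
  least \<open>k\<close>. So the earlier structure theorems apply to the smaller graph, where
  \<open>z\<close> alone has lost a neighbour and takes the exceptional place.\<close>

lemma leaf_target:
  assumes m: "m \<le> 2 * k + 2" and ex: "is_path p" "length p = m"
    and noreg: "\<And>q. is_path q \<Longrightarrow> length q = m \<Longrightarrow> \<not> (k \<le> card (nbrs (hd q)) \<and> k \<le> card (nbrs (last q)))"
  shows target
proof -
  obtain r where r: "is_path r" "length r = m" "card (nbrs (hd r)) < k" "nbrs (hd r) = {r ! 1}"
    using leaf_ex[OF ex noreg] by blast
  have ne: "r \<noteq> []" and dist: "distinct r" using is_pathD[OF r(1)] by auto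
  define w where "w = hd r"
  define z where "z = r ! 1"
  have w0: "w = r ! 0" using ne by (simp add: w_def hd_conv_nth)
  have nw: "nbrs w = {z}" using r(4) by (simp add: w_def z_def)
  have wz: "adj w z" using nw mem_nbrs by blast
  have wV: "w \<in> V" "z \<in> V" "w \<noteq> z" using adj_V[OF wz] adj_neq[OF wz] by auto
  have k2: "2 \<le> k" using r(3,4) by simp
  have onlyz: "x = z" if "adj x w" for x using nw adj_sym[OF that] mem_nbrs by blast
  have reg: "k \<le> card (nbrs x)" if "x \<in> V" "x \<noteq> w" for x
    using low_unique[OF low that(1) wV(1) that(2)] r(3) by (simp add: w_def)
  define adj' where "adj' = (\<lambda>x y. adj x y \<and> x \<noteq> w \<and> y \<noteq> w)"
  interpret G': simple_graph "V - {w}" adj' unfolding adj'_def by (rule remove_vertex)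
  have nb': "G'.nbrs x = nbrs x - {w}" if "x \<noteq> w" for x
  proof -
    have "G'.nbrs x = {y. adj' x y}" by (rule G'.nbrs_def)
    also have "\<dots> = nbrs x - {w}" using that by (auto simp: adj'_def)
    finally show ?thesis .
  qed
  have reg': "k \<le> card (G'.nbrs x)" if "x \<in> V - {w}" "x \<noteq> z" for x
  proof -
    have "w \<notin> nbrs x" using onlyz that by auto
    then show ?thesis using nb'[of x] reg[of x] that by auto
  qed
  have pathI: "is_path q \<and> w \<notin> set q" if q: "G'.is_path q" for q
  proof -
    have "successively adj q"
      using G'.is_path_def q successively_mono[of adj' q adj] unfolding adj'_def by blast
    then show ?thesis using q unfolding G'.is_path_def is_path_def by blast
  qed
  have pathD: "G'.is_path q" if q: "is_path q" "w \<notin> set q" for q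
  proof -
    have "successively adj' q"
      by (rule successively_mono[of adj q adj']) (use q in \<open>auto simp: is_path_def adj'_def\<close>)
    then show ?thesis using q unfolding G'.is_path_def is_path_def by blast
  qed
  have conn': "G'.is_connected"
    unfolding G'.is_connected_def
  proof (intro allI impI)
    fix S assume S: "S \<subseteq> V - {w}" "S \<noteq> {}" "S \<noteq> V - {w}"
    show "\<exists>x\<in>S. \<exists>y\<in>V - {w} - S. adj' x y"
    proof (cases "z \<in> S")
      case True
      have "insert w S \<subseteq> V" "insert w S \<noteq> {}" "insert w S \<noteq> V" using S wV by auto
      then obtain x y where xy: "x \<in> insert w S" "y \<in> V - insert w S" "adj x y" by (rule connectedE[OF conn])
      have "x \<noteq> w"
      proof
        assume "x = w"
        then have "y = z" using xy(3) onlyz adj_sym by blast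
        then show False using xy(2) True by blast
      qed
      then show ?thesis using xy unfolding adj'_def by blast
    next
      case False
      have "S \<subseteq> V" "S \<noteq> V" using S wV by auto
      then obtain x y where xy: "x \<in> S" "y \<in> V - S" "adj x y" using S(2) connectedE[OF conn] by metis
      have "y \<noteq> w" using onlyz xy(1,3) False by blast
      then show ?thesis using xy S(1) unfolding adj'_def by blast
    qed
  qed
  have low': "G'.at_most_one_low k"
    unfolding G'.at_most_one_low_def using reg' by (metis not_le)
  have bound': "length q \<le> m - 1" if q: "G'.is_path q" for q
  proof (rule ccontr)
    assume n: "\<not> length q \<le> m - 1"
    have q': "is_path q" "w \<notin> set q" using pathI[OF q] by auto
    then have lq: "length q = m" using bound[of q] n by simp
    have "hd q \<in> V" "last q \<in> V" "hd q \<noteq> w" "last q \<noteq> w"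
      using is_pathD[OF q'(1)] q'(2) hd_in_set last_in_set by (metis subsetD)+
    then show False using noreg[OF q'(1) lq] reg by blast
  qed
  have card': "card (V - {w}) = card V - 1" using wV by simp
  have r'_eq: "r = w # tl r" using ne by (simp add: w_def)
  define r' where "r' = tl r"
  have r'ne: "r' \<noteq> []" using r(2) m3 by (cases r) (auto simp: r'_def)
  have pr': "is_path r'" "w \<notin> set r'"
    using r(1) r'_eq r'ne is_path_Cons_iff[of r' w] unfolding r'_def by auto
  have Gr': "G'.is_path r'" by (rule pathD[OF pr'])
  have lr': "length r' = m - 1" using r(2) by (simp add: r'_def)
  have r'n: "r' ! i = r ! Suc i" if "i < m - 1" for i using that r(2) by (simp add: r'_def nth_tl)
  have hr': "hd r' = z" using r'n[of 0] r'ne m3 by (simp add: z_def hd_conv_nth)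
  have zk: "k \<le> card (nbrs z)" using reg wV by auto
  show ?thesis
  proof (cases "2 \<le> card (G'.nbrs z)")
    case True
    have "\<exists>y. adj' z y \<and> y \<noteq> r' ! 1"
    proof (rule ccontr)
      assume "\<not> ?thesis"
      then have "G'.nbrs z \<subseteq> {r' ! 1}" unfolding G'.nbrs_def by blast
      then have "card (G'.nbrs z) \<le> 1" using card_mono[of "{r' ! 1}" "G'.nbrs z"] by simp
      then show False using True by simp
    qed
    then obtain y where y: "adj' z y" "y \<noteq> r' ! 1" by blast
    have "y \<in> set r'"
    proof (rule ccontr)
      assume "y \<notin> set r'"
      then have "G'.is_path (y # r')"
        using G'.is_path_Cons_iff[OF r'ne] Gr' G'.adj_sym[OF y(1)] hr' by simp
      then show False using bound'[of "y # r'"] lr' by simp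
    qed
    then obtain i where i: "i < m - 1" "y = r' ! i" using mem_set_nth[of y r'] lr' by auto
    have "i \<noteq> 0" using i y(1) hr' hd_conv_nth[OF r'ne] G'.adj_irrefl by metis
    moreover have "i \<noteq> 1" using i y(2) by auto
    ultimately obtain s where s: "i = Suc s" "0 < s" by (cases i) auto
    have m4: "3 \<le> m - 1" using i s by simp
    show ?thesis
    proof (cases "\<exists>D. G'.is_cycle D \<and> length D = m - 1 - 1")
      case True
      then obtain D where D: "G'.is_cycle D" "length D = m - 2" by auto
      have D3: "3 \<le> length D" using D(1) by (simp add: G'.is_cycle_def)
      \<comment> \<open>\<open>length D\<close> is \<open>m - 2\<close>, at most
        \<open>2 * k\<close>, so the first alternative holds.\<close>
      have "length D = 2 * k \<and> G'.covered k \<or> length D = 2 * k + 1 \<and> G'.covered_but_edge k"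
      proof (rule G'.long_cycle_structure[OF conn' D(1) _ _ _ low'])
        show "length q \<le> Suc (length D)" if "G'.is_path q" for q using bound'[OF that] D(2) D3 by simp
        show "length D \<le> 2 * k + 1" using D(2) m by simp
        show "length D + 2 \<le> card (V - {w})" using D(2) D3 card' less by simp
      qed
      then have cov: "G'.covered k" "m = 2 * k + 2" using D(2) D3 m by auto
      then obtain A where A: "A \<subseteq> V - {w}" "card A = k" "\<And>x y. adj' x y \<Longrightarrow> x \<in> A \<or> y \<in> A"
        unfolding G'.covered_def by blast
      have n: "2 * k + 3 \<le> card V" using less cov(2) by simp
      \<comment> \<open>The exceptional edge has to absorb \<open>wz\<close> when \<open>z\<close>
        is not in the cover; otherwise any other vertex off the cover can be its second end.\<close>
      have "\<exists>u. u \<in> V - A \<and> u \<noteq> w \<and> (z \<notin> A \<longrightarrow> u = z)"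
      proof (cases "z \<in> A")
        case True
        have "card (insert w A) < card V" using n A(2) card_insert_le_m1[of "Suc k" A w] k2
          by (simp add: card_insert_if finite_subset[OF A(1)] finite_V)
        then have "\<not> V \<subseteq> insert w A" using card_mono[of "insert w A" V] finite_subset[OF A(1)] finite_V
          by (metis finite_Diff finite_insert linorder_not_le)
        then show ?thesis using True by blast
      next
        case False then show ?thesis using wV by blast
      qed
      then obtain u where u: "u \<in> V - A" "u \<noteq> w" "z \<notin> A \<Longrightarrow> u = z" by blast
      have "x \<in> A \<or> y \<in> A \<or> {x, y} = {u, w}" if xy: "adj x y" for x y
      proof -
        consider "x = w" | "y = w" | "x \<noteq> w" "y \<noteq> w" by blast
        then show ?thesis
        proof cases
          case 1
          then have "y = z" using onlyz adj_sym[OF xy] by blast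
          then show ?thesis using 1 u(3) by blast
        next
          case 2
          then have "x = z" using onlyz xy by blast
          then show ?thesis using 2 u(3) by blast
        next
          case 3
          then show ?thesis using A(3) xy unfolding adj'_def by blast
        qed
      qed
      moreover have "A \<subseteq> V" "w \<in> V - A" using A(1) wV by auto
      ultimately have "covered_but_edge k"
        unfolding covered_but_edge_def using A(2) u(1,2) by blast
      then show ?thesis using n unfolding target_def by blast
    next
      case False
      interpret P': path_bounded "V - {w}" adj' "m - 1" k
        using conn' bound' low' k1 m4 False card' less by unfold_locales auto
      have sm: "Suc s < m - 1" "adj' (hd r') (r' ! Suc s)" using i s y(1) hr' by auto
      \<comment> \<open>The rotation moves \<open>z\<close> away from the front, so both ends have
        degree at least \<open>k\<close> in the smaller graph.\<close>
      note q = P'.rotated[OF Gr' lr' sm]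
      have last: "last r' = r' ! (m - 2)" using r'ne lr' by (simp add: last_conv_nth numeral_2_eq_2)
      have regi: "k \<le> card (G'.nbrs (r' ! j))" if j: "0 < j" "j < m - 1" for j
      proof (rule reg')
        show "r' ! j \<in> V - {w}" using P'.nth_V[OF Gr'] j lr' by simp
        have "distinct r'" using is_pathD[OF pr'(1)] by blast
        then have "r' ! j \<noteq> r' ! 0" using j lr' by (simp add: nth_eq_iff_index_eq)
        then show "r' ! j \<noteq> z" using hr' r'ne by (simp add: hd_conv_nth)
      qed
      have "(m - 1 = 2 * k + 1 \<and> G'.small_components k) \<or> m - 1 = 2 * k + 2"
        using P'.both_ends_regular[OF q(1,2)] q(3,4) regi[of s] regi[of "m - 2"] last s sm m m4 by auto
      then have "G'.small_components k" using m by auto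
      then obtain c where c: "c \<in> V - {w}" "\<And>x. x \<in> V - {w} - {c} \<Longrightarrow> card (G'.component {c} x) \<le> k"
        unfolding G'.small_components_def by blast
      let ?K = "G'.component {c}"
      \<comment> \<open>The leaf rejoins the component of its neighbour, which then has at most
        \<open>k + 1\<close> vertices; if its neighbour is the cut vertex, the leaf stands
        alone.\<close>
      define D where "D = (if z = c then {w} else insert w (?K z))"
      have KV: "?K x \<subseteq> V - {w} - {c}" if "x \<in> V - {w} - {c}" for x using G'.component_in[OF that] .
      have DV: "D \<subseteq> V - {c}" using KV[of z] wV c(1) unfolding D_def by auto
      have "card D \<le> k + 1"
      proof (cases "z = c")
        case False
        have "card (insert w (?K z)) \<le> Suc (card (?K z))" by (rule card_insert_le_m1) auto
        then show ?thesis using c(2)[of z] False wV by (simp add: D_def)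
      qed (simp add: D_def)
      moreover have "(x \<in> D \<and> y \<in> D) \<or> (x \<notin> D \<and> y \<notin> D \<and> ?K x = ?K y)" if xy: "adj x y" "x \<noteq> c" "y \<noteq> c" for x y
      proof -
        have wD: "u \<in> D" if "adj w u" "u \<noteq> c" for u
        proof -
          have "u = z" using onlyz adj_sym[OF that(1)] by blast
          then show ?thesis using that(2) by (simp add: D_def)
        qed
        have w_in: "w \<in> D" by (simp add: D_def)
        show ?thesis
        proof (cases "x = w \<or> y = w")
          case True
          then show ?thesis using wD[of x] wD[of y] w_in xy adj_sym[OF xy(1)] by blast
        next
          case False
          then have a: "adj' x y" using xy by (simp add: adj'_def)
          have eq: "?K x = ?K y" using G'.component_adj[OF a, of "{c}"] xy by blast
          have "x \<in> ?K z \<longleftrightarrow> y \<in> ?K z"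
            using eq G'.component_eq[of x "{c}" z] G'.component_eq[of y "{c}" z]
              G'.component_refl[of x "{c}"] G'.component_refl[of y "{c}"] by blast
          then have "x \<in> D \<longleftrightarrow> y \<in> D" using False by (simp add: D_def)
          then show ?thesis using eq by blast
        qed
      qed
      moreover have "card {y \<in> V - {c} - D. ?K y = ?K x} \<le> k" if x: "x \<in> V - {c} - D" for x
      proof -
        have "x \<in> V - {w} - {c}" using x by (auto simp: D_def split: if_splits)
        then show ?thesis using c(2) by (intro G'.component_class_card_le) auto
      qed
      moreover have "c \<in> V" using c(1) by blast
      ultimately have "block_cut k"
        unfolding block_cut_def using DV
        by (intro bexI[of _ c] exI[of _ D] exI[of _ ?K] conjI allI ballI impI)
      then show ?thesis unfolding target_def by blast
    qed
  next
    \<comment> \<open>Now \<open>z\<close> has no neighbour but \<open>w\<close> and the next path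
      vertex, so \<open>k = 2\<close>, and reversing the path puts this pendant piece at its
      end.\<close>
    case False
    have cz: "card (nbrs z) \<le> 2"
    proof -
      have "w \<in> nbrs z" using adj_sym[OF wz] by simp
      then have "card (G'.nbrs z) = card (nbrs z) - 1" using nb'[of z] wV by simp
      then show ?thesis using False by simp
    qed
    then have keq: "k = 2" using zk k2 by simp
    define q where "q = rev r"
    have qn: "q ! i = r ! (m - 1 - i)" if "i < m" for i using that r(2) by (simp add: q_def rev_nth)
    have q: "is_path q" "length q = m" "last q = w" using r ne by (simp_all add: q_def last_rev w_def)
    have q2: "q ! (m - 2) = z" "q ! (m - 3) = r ! 2" using qn[of "m - 2"] qn[of "m - 3"] m3 by (simp_all add: z_def)
    have z2: "adj z (r ! 2)" using is_path_nth[OF r(1), of 1] r(2) m3 by (simp add: z_def numeral_2_eq_2)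
    have "r ! 2 \<noteq> w" using w0 dist r(2) m3 by (simp add: nth_eq_iff_index_eq)
    then have c2: "card {w, r ! 2} = 2" by simp
    have "{w, r ! 2} \<subseteq> nbrs z" using z2 adj_sym[OF wz] by simp
    then have nz: "nbrs z = {w, r ! 2}"
      using card_seteq[of "nbrs z" "{w, r ! 2}"] cz c2 by simp
    have hq: "hd q = r ! (m - 1)" using ne r(2) by (simp add: q_def hd_rev last_conv_nth)
    have "hd q \<noteq> w" using hq w0 dist r(2) m3 by (simp add: nth_eq_iff_index_eq)
    moreover have "hd q \<in> V" using hd_in_set[OF is_pathD(1)[OF q(1)]] is_pathD(3)[OF q(1)] by blast
    ultimately have "k \<le> card (nbrs (hd q))" using reg by blast
    then show ?thesis
      using pendant_path_target[OF keq _ q(1,2)] m keq nw nz q(3) q2 by simp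
  qed
qed

end

context simple_graph begin

theorem no_long_path_structure:
  assumes conn: is_connected and low: "at_most_one_low k" and k: "1 \<le> k" and ne: "V \<noteq> {}"
    and nop: "\<nexists>p. is_path p \<and> length p = min (card V) (2 * k + 3)"
  shows "(2 * k + 2 \<le> card V \<and> covered k) \<or> (2 * k + 3 \<le> card V \<and> covered_but_edge k) \<or>
    block_cut k \<or> linked k \<or> k = 2 \<and> hub_star \<or> k = 3 \<and> two_hubs"
proof -
  obtain v where "v \<in> V" using ne by blast
  then have v: "is_path [v]" by simp
  obtain p where p: "is_path p" and max: "\<And>q. is_path q \<Longrightarrow> length q \<le> length p"
    using ex_has_greatest_nat[of is_path "[v]" length "Suc (card V)", OF v] length_path_le
    by (metis le_imp_less_Suc)
  define m where "m = length p"
  have bound: "length q \<le> m" if "is_path q" for q using max that by (simp add: m_def)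
  have cV: "0 < card V" using ne finite_V by (simp add: card_gt_0_iff)
  have "\<not> min (card V) (2 * k + 3) \<le> m"
    using exists_path_of_length[OF p, of "min (card V) (2 * k + 3)"] nop cV by (auto simp: m_def)
  then have less: "m < card V" and mk: "m \<le> 2 * k + 2" by auto
  have pne: "p \<noteq> []" using p by auto
  \<comment> \<open>On a path with at most two vertices every vertex is an end, so an edge leaving
    it would extend it.\<close>
  have m3: "3 \<le> m"
  proof (rule ccontr)
    assume m2: "\<not> 3 \<le> m"
    have "set p \<noteq> V" using card_length[of p] less by (auto simp: m_def)
    then obtain x y where xy: "x \<in> set p" "y \<in> V - set p" "adj x y"
      using connectedE[OF conn, of "set p"] is_pathD[OF p] pne by auto
    have "x = hd p \<or> x = last p"
    proof -
      consider a where "p = [a]" | a b where "p = [a, b]"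
        using m2 pne by (cases p; cases "tl p"; cases "tl (tl p)") (auto simp: m_def)
      then show ?thesis using xy(1) by cases auto
    qed
    then show False
    proof
      assume "x = hd p"
      then have "is_path (y # p)" using is_path_Cons_iff[OF pne] p xy adj_sym by blast
      then show False using bound[of "y # p"] by (simp add: m_def)
    next
      assume "x = last p"
      then have "is_path (p @ [y])" using is_path_snoc_iff[OF pne] p xy by blast
      then show False using bound[of "p @ [y]"] by (simp add: m_def)
    qed
  qed
  show ?thesis
  proof (cases "\<exists>C. is_cycle C \<and> length C = m - 1")
    case True
    then obtain C where C: "is_cycle C" "length C = m - 1" by blast
    have "length C = 2 * k \<and> covered k \<or> length C = 2 * k + 1 \<and> covered_but_edge k"
    proof (rule long_cycle_structure[OF conn C(1) _ _ _ low])
      show "length q \<le> Suc (length C)" if "is_path q" for q using bound[OF that] C(2) m3 by simp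
      show "length C \<le> 2 * k + 1" using C(2) mk by simp
      show "length C + 2 \<le> card V" using C(2) m3 less by simp
    qed
    then show ?thesis using C(2) m3 less by auto
  next
    case False
    interpret P: path_bounded V adj m k
      using conn bound less m3 False low k by unfold_locales auto
    show ?thesis
    proof (cases "\<exists>q. is_path q \<and> length q = m \<and> k \<le> card (nbrs (hd q)) \<and> k \<le> card (nbrs (last q))")
      case True
      then obtain q where q: "is_path q" "length q = m" "k \<le> card (nbrs (hd q))" "k \<le> card (nbrs (last q))" by blast
      from P.both_ends_regular[OF q(1,2) mk q(3,4)] show ?thesis
      proof
        assume "m = 2 * k + 1 \<and> small_components k"
        then show ?thesis using small_components_block_cut by blast
      next
        assume a: "m = 2 * k + 2 \<and> (block_cut k \<or> k = 2 \<and> hub_star \<or> linked k \<or> covered_but_edge k \<or> k = 3 \<and> two_hubs)"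
        then have "2 * k + 3 \<le> card V" using less by simp
        then show ?thesis using a by blast
      qed
    next
      case False
      then have P.target using P.leaf_target[OF mk p] by (simp add: m_def)
      then show ?thesis unfolding P.target_def by blast
    qed
  qed
qed

end

section \<open>Embeddings into the extremal graphs\<close>

text \<open>\<open>h\<close> numbers the classes and \<open>F\<close> the vertices within each
  class, so the pairs address the copies of K_k.\<close>

lemma class_embedding:
  fixes l :: "'a \<Rightarrow> 'b"
  assumes "finite X" "\<forall>x\<in>X. card {y \<in> X. l y = l x} \<le> k"
  shows "\<exists>(t :: nat) (g :: 'a \<Rightarrow> nat \<times> nat). 1 \<le> t \<and> inj_on g X \<and> g ` X \<subseteq> {..<t} \<times> {..<k} \<and>
    (\<forall>x\<in>X. \<forall>y\<in>X. l x = l y \<longrightarrow> fst (g x) = fst (g y))"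
proof -
  obtain h where h: "bij_betw h (l ` X) {0..<card (l ` X)}"
    using ex_bij_betw_finite_nat[of "l ` X"] assms(1) by blast
  have "\<forall>c\<in>l ` X. \<exists>f. inj_on f {y \<in> X. l y = c} \<and> f ` {y \<in> X. l y = c} \<subseteq> {..<k}"
    using assms inj_on_iff_card_le[of "{y \<in> X. l y = c}" "{..<k}" for c] by auto
  from bchoice[OF this] obtain F where F: "\<forall>c\<in>l ` X.
      inj_on (F c) {y \<in> X. l y = c} \<and> F c ` {y \<in> X. l y = c} \<subseteq> {..<k}" ..
  define g where "g x = (h (l x), F (l x) x)" for x
  have hinj: "h (l x) = h (l y) \<Longrightarrow> l x = l y" if "x \<in> X" "y \<in> X" for x y
    using h that by (auto simp: bij_betw_def inj_on_def)
  have "inj_on g X"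
  proof (rule inj_onI)
    fix x y assume xy: "x \<in> X" "y \<in> X" "g x = g y"
    then have "l x = l y" using hinj by (simp add: g_def)
    then show "x = y"
      using F[rule_format, of "l x"] xy by (auto simp: g_def inj_on_def)
  qed
  \<comment> \<open>One more than the number of classes, so that there is a copy even when
    \<open>X\<close> is empty.\<close>
  moreover have "g ` X \<subseteq> {..<Suc (card (l ` X))} \<times> {..<k}"
  proof
    fix z assume "z \<in> g ` X"
    then obtain x where x: "x \<in> X" "z = g x" by blast
    have "h (l x) < card (l ` X)" using h x(1) by (auto simp: bij_betw_def)
    moreover have "F (l x) x < k" using F[rule_format, of "l x"] x(1) by auto
    ultimately show "z \<in> {..<Suc (card (l ` X))} \<times> {..<k}" using x(2) by (simp add: g_def)
  qed
  moreover have "\<forall>x\<in>X. \<forall>y\<in>X. l x = l y \<longrightarrow> fst (g x) = fst (g y)" by (simp add: g_def)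
  moreover have "1 \<le> Suc (card (l ` X))" by simp
  ultimately show ?thesis by blast
qed

lemma parcs_copies: "((i, u), (j, v)) \<in> parcs (copies t H) \<longleftrightarrow> i = j \<and> i < t \<and> (u, v) \<in> parcs H"
  by (auto simp: copies_def)

lemma parcs_complete_graph: "(u, v) \<in> parcs (complete_graph k) \<longleftrightarrow> u < k \<and> v < k \<and> u \<noteq> v"
  by (auto simp: complete_graph_def)

lemma pverts_copies: "(i, u) \<in> pverts (copies t H) \<longleftrightarrow> i < t \<and> u \<in> pverts H"
  by (auto simp: copies_def)

lemma pverts_complete_graph: "u \<in> pverts (complete_graph k) \<longleftrightarrow> u < k"
  by (simp add: complete_graph_def)

lemma graph_union_iff:
  "Inl u \<in> pverts (graph_union G H) \<longleftrightarrow> u \<in> pverts G"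
  "Inr v \<in> pverts (graph_union G H) \<longleftrightarrow> v \<in> pverts H"
  "(Inl u, Inl u') \<in> parcs (graph_union G H) \<longleftrightarrow> (u, u') \<in> parcs G"
  "(Inr v, Inr v') \<in> parcs (graph_union G H) \<longleftrightarrow> (v, v') \<in> parcs H"
  by (auto simp: graph_union_def)

lemma graph_join_iff:
  "Inl u \<in> pverts (graph_join G H) \<longleftrightarrow> u \<in> pverts G"
  "Inr v \<in> pverts (graph_join G H) \<longleftrightarrow> v \<in> pverts H"
  "(Inl u, Inl u') \<in> parcs (graph_join G H) \<longleftrightarrow> (u, u') \<in> parcs G"
  "(Inr v, Inr v') \<in> parcs (graph_join G H) \<longleftrightarrow> (v, v') \<in> parcs H"
  "(Inl u, Inr v) \<in> parcs (graph_join G H) \<longleftrightarrow> u \<in> pverts G \<and> v \<in> pverts H"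
  "(Inr v, Inl u) \<in> parcs (graph_join G H) \<longleftrightarrow> u \<in> pverts G \<and> v \<in> pverts H"
  by (auto simp: graph_join_def graph_union_def)

lemmas graph_simps = graph_union_iff graph_join_iff pverts_copies pverts_complete_graph
  parcs_copies parcs_complete_graph

lemma arcs_copies_complete:
  assumes "inj_on g X" "g ` X \<subseteq> {..<t} \<times> {..<k}" "x \<in> X" "y \<in> X" "x \<noteq> y" "fst (g x) = fst (g y)"
  shows "(g x, g y) \<in> parcs (copies t (complete_graph k))"
proof -
  obtain i u where gx: "g x = (i, u)" by (cases "g x")
  obtain v where gy: "g y = (i, v)" using assms(6) gx by (cases "g y") auto
  have "u \<noteq> v" using assms(1,3,4,5) gx gy by (auto simp: inj_on_def)
  moreover have "g x \<in> {..<t} \<times> {..<k}" "g y \<in> {..<t} \<times> {..<k}"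
    using subsetD[OF assms(2) imageI[OF assms(3)]] subsetD[OF assms(2) imageI[OF assms(4)]] .
  ultimately show ?thesis by (simp add: gx gy parcs_copies parcs_complete_graph)
qed

lemma exists_inj_on:
  assumes "finite A" "finite B" "card A \<le> card B"
  obtains f where "inj_on f A" "f ` A \<subseteq> B"
  using card_le_inj[OF assms] that by blast

lemma is_subgraph_ofI:
  assumes "pair_graph G" "pair_graph H" "inj_on f (pverts G)" "f ` pverts G \<subseteq> pverts H"
    "\<And>u v. (u, v) \<in> parcs G \<Longrightarrow> (f u, f v) \<in> parcs H"
  shows "is_subgraph_of G H"
proof -
  interpret G: pair_graph G by (rule assms(1))
  interpret H: pair_graph H by (rule assms(2))
  have "pair_wf_digraph G" "pair_wf_digraph H" by unfold_locales
  then show ?thesis using is_subgraph_of_iff assms(3-5) by blast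
qed

section \<open>From pair graphs to symmetric relations\<close>

locale pair_simple_graph =
  fixes G :: "'a pair_pre_digraph"
  assumes G: "pair_graph G"

sublocale pair_simple_graph \<subseteq> simple_graph "pverts G" "\<lambda>u v. (u, v) \<in> parcs G"
  using pair_graphD'[OF G] by unfold_locales auto

context pair_simple_graph begin

abbreviation adj where "adj u v \<equiv> (u, v) \<in> parcs G"
abbreviation V where "V \<equiv> pverts G"

lemma out_degree_eq: "out_degree (with_proj G) v = card (nbrs v)"
proof -
  have "out_arcs (with_proj G) v = Pair v ` nbrs v"
    by (auto simp: out_arcs_def nbrs_def)
  then show ?thesis by (simp add: out_degree_def card_image inj_on_def)
qed

lemma vpath_is_path: "is_path p \<longleftrightarrow> vpath p (with_proj G)"
proof -
  have "set (vwalk_arcs p) \<subseteq> parcs G \<longleftrightarrow> successively adj p" for p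
    by (induction p rule: vwalk_arcs.induct) auto
  then show ?thesis
    by (auto simp: is_path_def vpath_def vwalk_def arcs_ends_conv)
qed

lemma connected_is_connected:
  assumes "connected (with_proj G)"
  shows "is_connected" "V \<noteq> {}"
proof -
  have mk: "pverts (mk_symmetric (with_proj G)) = V"
    "parcs (mk_symmetric (with_proj G)) = parcs G"
    using adj_sym by (auto simp: mk_symmetric_def)
  have reach: "(u, v) \<in> rtrancl_on V (parcs G)" if "u \<in> V" "v \<in> V" for u v
    using assms that mk unfolding connected_def strongly_connected_def reachable_def
    by (simp add: arcs_ends_conv)
  show "V \<noteq> {}"
    using assms mk unfolding connected_def strongly_connected_def by simp
  show is_connected
    unfolding is_connected_def
  proof (intro allI impI)
    fix S assume S: "S \<subseteq> V" "S \<noteq> {}" "S \<noteq> V"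
    show "\<exists>x\<in>S. \<exists>y\<in>V - S. adj x y"
    proof (rule ccontr)
      assume neg: "\<not> (\<exists>x\<in>S. \<exists>y\<in>V - S. adj x y)"
      obtain u v where uv: "u \<in> S" "v \<in> V - S" using S by blast
      have "(u, v) \<in> rtrancl_on V (parcs G)" using reach uv S by blast
      then have "v \<in> S" using uv(1)
        by induction (use neg in blast)+
      then show False using uv by blast
    qed
  qed
qed

text \<open>Order \<open>2 * k + 2\<close> is the case needed here: larger graphs go through
  \<open>covered_imp_covered_but_edge\<close>.\<close>

lemma covered_subgraph:
  assumes "covered k" and n: "card V = 2 * k + 2"
  shows "is_subgraph_of G (H_graph (2 * k + 2) (2 * k + 1) k)"
proof -
  obtain A where A: "A \<subseteq> V" "card A = k" "\<And>x y. adj x y \<Longrightarrow> x \<in> A \<or> y \<in> A"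
    using assms unfolding covered_def by blast
  have fin: "finite A" using A(1) finite_V finite_subset by blast
  obtain f where f: "inj_on f A" "f ` A \<subseteq> {..<k}" using exists_inj_on[OF fin, of "{..<k}"] A(2) by auto
  have "card (V - A) = k + 2" using card_Diff_subset[OF fin A(1)] A(2) n by simp
  then obtain g where g: "inj_on g (V - A)" "g ` (V - A) \<subseteq> {k..<2 * k + 2}"
    using exists_inj_on[of "V - A" "{k..<2 * k + 2}"] finite_V by auto
  define h where "h x = (if x \<in> A then f x else g x)" for x
  have hA: "h x < k" if "x \<in> A" for x using f(2) that by (auto simp: h_def)
  have hB: "k \<le> h x \<and> h x < 2 * k + 2" if "x \<in> V - A" for x using g(2) that by (auto simp: h_def)
  show ?thesis
  proof (rule is_subgraph_ofI[OF G pair_graph_H_graph])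
    show "inj_on h V"
    proof (rule inj_onI)
      fix x y assume xy: "x \<in> V" "y \<in> V" "h x = h y"
      consider "x \<in> A" "y \<in> A" | "x \<notin> A" "y \<notin> A" | "x \<in> A" "y \<notin> A" | "x \<notin> A" "y \<in> A" by blast
      then show "x = y"
      proof cases
        case 1 then show ?thesis using xy f(1) by (auto simp: h_def inj_on_def)
      next
        case 2 then show ?thesis using xy g(1) by (auto simp: h_def inj_on_def)
      next
        case 3 then show ?thesis using xy hA[of x] hB[of y] by auto
      next
        case 4 then show ?thesis using xy hA[of y] hB[of x] by auto
      qed
    qed
    have "h x < 2 * k + 2" if "x \<in> V" for x
      using hA[of x] hB[of x] that by (cases "x \<in> A") auto
    then show "h ` V \<subseteq> pverts (H_graph (2 * k + 2) (2 * k + 1) k)"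
      by (subst pverts_H_graph) auto
    fix x y assume xy: "adj x y"
    have V: "x \<in> V" "y \<in> V" "x \<noteq> y" using adj_V[OF xy] adj_neq[OF xy] by auto
    have neq: "h x \<noteq> h y" using \<open>inj_on h V\<close> V by (auto simp: inj_on_def)
    consider "x \<in> A" "y \<in> A" | "x \<in> A" "y \<in> V - A" | "x \<in> V - A" "y \<in> A" using A(3)[OF xy] V by blast
    then show "(h x, h y) \<in> parcs (H_graph (2 * k + 2) (2 * k + 1) k)"
    proof cases
      case 1 then show ?thesis using hA[of x] hA[of y] neq by (auto simp: H_graph_def Let_def)
    next
      case 2 then show ?thesis using hA[of x] hB[of y] neq by (auto simp: H_graph_def Let_def)
    next
      case 3 then show ?thesis using hA[of y] hB[of x] neq by (auto simp: H_graph_def Let_def)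
    qed
  qed simp_all
qed

text \<open>\<open>u\<close> and \<open>v\<close> are sent to \<open>k\<close> and
  \<open>k + 1\<close>, which form the part C of \<open>H_graph\<close>.\<close>

lemma covered_but_edge_subgraph:
  assumes "covered_but_edge k" and n: "card V = n" "2 * k + 3 \<le> n"
  shows "is_subgraph_of G (H_graph n (2 * k + 2) k)"
proof -
  obtain A u v where A: "A \<subseteq> V" "card A = k" "u \<in> V - A" "v \<in> V - A" "u \<noteq> v"
    "\<And>x y. adj x y \<Longrightarrow> x \<in> A \<or> y \<in> A \<or> {x, y} = {u, v}"
    using assms unfolding covered_but_edge_def by blast
  have fin: "finite A" using A(1) finite_V finite_subset by blast
  obtain f where f: "inj_on f A" "f ` A \<subseteq> {..<k}" using exists_inj_on[OF fin, of "{..<k}"] A(2) by auto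
  let ?B = "V - A - {u, v}"
  have "card (V - A) = n - k" using card_Diff_subset[OF fin A(1)] A(2) n by simp
  then have "card ?B = n - k - 2" using A(3-5) finite_V by (subst card_Diff_subset) auto
  then obtain g where g: "inj_on g ?B" "g ` ?B \<subseteq> {k + 2..<n}"
    using exists_inj_on[of ?B "{k + 2..<n}"] finite_V by auto
  define h where "h x = (if x \<in> A then f x else if x = u then k else if x = v then k + 1 else g x)" for x
  have hA: "h x < k" if "x \<in> A" for x using f(2) that by (auto simp: h_def)
  have hu: "h u = k" "h v = k + 1" using A by (auto simp: h_def)
  have hB: "k + 2 \<le> h x \<and> h x < n" if "x \<in> ?B" for x using g(2) that by (auto simp: h_def)
  have cases: "x \<in> A \<or> x = u \<or> x = v \<or> x \<in> ?B" if "x \<in> V" for x using that by blast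
  show ?thesis
  proof (rule is_subgraph_ofI[OF G pair_graph_H_graph])
    show inj: "inj_on h V"
    proof (rule inj_onI)
      fix x y assume xy: "x \<in> V" "y \<in> V" "h x = h y"
      have fi: "x = y" if "x \<in> A" "y \<in> A" using xy(3) that inj_onD[OF f(1)] by (simp add: h_def)
      have gi: "x = y" if "x \<in> ?B" "y \<in> ?B" using xy(3) that inj_onD[OF g(1)] by (simp add: h_def)
      from cases[OF xy(1)] cases[OF xy(2)] show "x = y"
        using xy(3) hA[of x] hA[of y] hu hB[of x] hB[of y] fi gi by (elim disjE) auto
    qed
    have rng: "h x < n" if "x \<in> V" for x
      using hA[of x] hB[of x] hu n cases[OF that] by (elim disjE) auto
    then show "h ` V \<subseteq> pverts (H_graph n (2 * k + 2) k)"
      using n by (subst pverts_H_graph) auto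
    fix x y assume xy: "adj x y"
    have V: "x \<in> V" "y \<in> V" "x \<noteq> y" using adj_V[OF xy] adj_neq[OF xy] by auto
    have neq: "h x \<noteq> h y" using inj V by (auto simp: inj_on_def)
    consider "x \<in> A" | "y \<in> A" | "{x, y} = {u, v}" using A(6)[OF xy] by blast
    then show "(h x, h y) \<in> parcs (H_graph n (2 * k + 2) k)"
    proof cases
      case 1 then show ?thesis using hA[of x] rng[OF V(2)] neq by (auto simp: H_graph_def Let_def)
    next
      case 2 then show ?thesis using hA[of y] rng[OF V(1)] neq by (auto simp: H_graph_def Let_def)
    next
      case 3 then show ?thesis using hu neq by (auto simp: H_graph_def Let_def doubleton_eq_iff)
    qed
  qed (use n in simp_all)
qed

text \<open>Any two vertices off the cover can serve as the exceptional pair, which need not be an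
  edge.\<close>

lemma covered_imp_covered_but_edge:
  assumes "covered k" "k + 2 \<le> card V"
  shows "covered_but_edge k"
proof -
  obtain A where A: "A \<subseteq> V" "card A = k" "\<And>x y. adj x y \<Longrightarrow> x \<in> A \<or> y \<in> A"
    using assms unfolding covered_def by blast
  have fin: "finite A" using A(1) finite_V finite_subset by blast
  have "2 \<le> card (V - A)" using card_Diff_subset[OF fin A(1)] A(2) assms(2) by simp
  then obtain T where T: "T \<subseteq> V - A" "card T = 2" by (rule obtain_subset_with_card_n)
  then obtain u v where uv: "T = {u, v}" "u \<noteq> v" by (auto simp: card_2_iff)
  then have "u \<in> V - A" "v \<in> V - A" using T(1) by auto
  moreover have "\<forall>x y. adj x y \<longrightarrow> x \<in> A \<or> y \<in> A \<or> {x, y} = {u, v}" using A(3) by blast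
  ultimately show ?thesis unfolding covered_but_edge_def using A(1,2) uv(2) by (intro exI conjI)
qed

lemma block_cut_subgraph:
  assumes "block_cut k"
  shows "\<exists>t\<ge>1. is_subgraph_of G (graph_join (complete_graph 1)
          (graph_union (copies t (complete_graph k))
            (graph_union (complete_graph (k + 1)) (complete_graph 1))))"
proof -
  obtain c D l where c: "c \<in> V" and D: "D \<subseteq> V - {c}" "card D \<le> k + 1"
    and e': "\<forall>x y. adj x y \<longrightarrow> x \<noteq> c \<longrightarrow> y \<noteq> c \<longrightarrow> (x \<in> D \<and> y \<in> D) \<or> (x \<notin> D \<and> y \<notin> D \<and> l x = l y)"
    and l': "\<forall>x\<in>V - {c} - D. card {y \<in> V - {c} - D. l y = (l x :: 'a set)} \<le> k"
    using assms unfolding block_cut_def by (elim bexE exE conjE)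
  note e = e'[rule_format]
  let ?X = "V - {c} - D"
  have finX: "finite ?X" using finite_V by blast
  obtain t :: nat and g :: "'a \<Rightarrow> nat \<times> nat" where t: "1 \<le> t" and g: "inj_on g ?X" "g ` ?X \<subseteq> {..<t} \<times> {..<k}"
    "\<forall>x\<in>?X. \<forall>y\<in>?X. l x = l y \<longrightarrow> fst (g x) = fst (g y)"
    using class_embedding[OF finX, where l = l and k = k, OF l'] by (elim exE conjE)
  have finD: "finite D" using D(1) finite_V finite_subset by blast
  obtain f where f: "inj_on f D" "f ` D \<subseteq> {..<k + 1}"
    using exists_inj_on[OF finD, of "{..<k + 1}"] D(2) by auto
  define h :: "'a \<Rightarrow> nat + (nat \<times> nat + (nat + nat))" where
    "h x = (if x = c then Inl 0 else if x \<in> D then Inr (Inr (Inl (f x))) else Inr (Inl (g x)))" for x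
  let ?H = "graph_join (complete_graph 1) (graph_union (copies t (complete_graph k))
            (graph_union (complete_graph (k + 1)) (complete_graph 1)))"
  have "is_subgraph_of G ?H"
  proof (rule is_subgraph_ofI[OF G])
    show "pair_graph ?H"
      by (intro pair_graph_graph_join pair_graph_graph_union pair_graph_copies pair_graph_complete_graph)
    show "inj_on h V"
      using f(1) g(1) by (auto simp: h_def inj_on_def split: if_splits)
    show "h ` V \<subseteq> pverts ?H"
      using f(2) g(2) by (auto simp: h_def graph_join_def graph_union_def complete_graph_def copies_def image_subset_iff)
    fix x y assume xy: "adj x y"
    have V: "x \<in> V" "y \<in> V" "x \<noteq> y" using adj_V[OF xy] adj_neq[OF xy] by auto
    have vert: "h z \<in> Inr ` pverts (graph_union (copies t (complete_graph k))
            (graph_union (complete_graph (k + 1)) (complete_graph 1)))" if "z \<in> V" "z \<noteq> c" for z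
      using f(2) g(2) that by (auto simp: h_def graph_union_def complete_graph_def copies_def image_subset_iff)
    have hc: "h c \<in> Inl ` pverts (complete_graph 1)" by (simp add: h_def complete_graph_def)
    consider "x = c" | "y = c" | "x \<noteq> c" "y \<noteq> c" "x \<in> D" "y \<in> D" | "x \<in> ?X" "y \<in> ?X" "l x = l y"
      using e[OF xy] V by blast
    then show "(h x, h y) \<in> parcs ?H"
    proof cases
      case 1 then show ?thesis using hc vert[OF V(2)] V by (simp add: graph_join_def)
    next
      case 2 then show ?thesis using hc vert[OF V(1)] V by (simp add: graph_join_def)
    next
      case 3
      then have "(f x, f y) \<in> parcs (complete_graph (k + 1))"
        using f V(3) by (auto simp: complete_graph_def inj_on_def)
      then show ?thesis using 3 by (simp add: h_def graph_union_iff graph_join_iff)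
    next
      case 4
      then have "(g x, g y) \<in> parcs (copies t (complete_graph k))"
        using arcs_copies_complete[OF g(1,2) 4(1,2) V(3)] g(3)[rule_format, OF 4] by blast
      then show ?thesis using 4 by (simp add: h_def graph_union_iff graph_join_iff)
    qed
  qed
  then show ?thesis using t by blast
qed

lemma linked_subgraph:
  assumes "linked k"
  shows "\<exists>s\<ge>1. \<exists>t\<ge>1. is_subgraph_of G (linked_graph k s t)"
proof -
  obtain c1 c2 side l where c: "c1 \<in> V" "c2 \<in> V - {c1}"
    and e': "\<forall>x y. adj x y \<longrightarrow> {x, y} \<inter> {c1, c2} = {} \<longrightarrow> l x = l y \<and> side x = side y"
    and e1': "\<forall>x. adj c1 x \<longrightarrow> x \<noteq> c2 \<longrightarrow> side x" and e2': "\<forall>x. adj c2 x \<longrightarrow> x \<noteq> c1 \<longrightarrow> \<not> side x"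
    and l': "\<forall>x\<in>V - {c1, c2}. card {y \<in> V - {c1, c2}. l y = (l x :: 'a set)} \<le> k"
    using assms unfolding linked_def by (elim bexE exE conjE)
  note e = e'[rule_format] and e1 = e1'[rule_format] and e2 = e2'[rule_format] and l = l'[rule_format]
  let ?X = "{x \<in> V - {c1, c2}. side x}" and ?Y = "{x \<in> V - {c1, c2}. \<not> side x}"
  have fin: "finite ?X" "finite ?Y" using finite_V by auto
  have lX: "\<forall>x\<in>?X. card {y \<in> ?X. l y = l x} \<le> k"
  proof
    fix x assume "x \<in> ?X"
    then have "card {y \<in> V - {c1, c2}. l y = l x} \<le> k" using l[of x] by simp
    moreover have "card {y \<in> ?X. l y = l x} \<le> card {y \<in> V - {c1, c2}. l y = l x}"
      using finite_V by (intro card_mono) auto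
    ultimately show "card {y \<in> ?X. l y = l x} \<le> k" by linarith
  qed
  have lY: "\<forall>x\<in>?Y. card {y \<in> ?Y. l y = l x} \<le> k"
  proof
    fix x assume "x \<in> ?Y"
    then have "card {y \<in> V - {c1, c2}. l y = l x} \<le> k" using l[of x] by simp
    moreover have "card {y \<in> ?Y. l y = l x} \<le> card {y \<in> V - {c1, c2}. l y = l x}"
      using finite_V by (intro card_mono) auto
    ultimately show "card {y \<in> ?Y. l y = l x} \<le> k" by linarith
  qed
  obtain s :: nat and f :: "'a \<Rightarrow> nat \<times> nat" where s: "1 \<le> s" and f: "inj_on f ?X" "f ` ?X \<subseteq> {..<s} \<times> {..<k}"
    "\<forall>x\<in>?X. \<forall>y\<in>?X. l x = l y \<longrightarrow> fst (f x) = fst (f y)"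
    using class_embedding[OF fin(1), where l = l and k = k, OF lX] by (elim exE conjE)
  obtain t :: nat and g :: "'a \<Rightarrow> nat \<times> nat" where t: "1 \<le> t" and g: "inj_on g ?Y" "g ` ?Y \<subseteq> {..<t} \<times> {..<k}"
    "\<forall>x\<in>?Y. \<forall>y\<in>?Y. l x = l y \<longrightarrow> fst (g x) = fst (g y)"
    using class_embedding[OF fin(2), where l = l and k = k, OF lY] by (elim exE conjE)
  define h :: "'a \<Rightarrow> (nat + nat \<times> nat) + (nat + (nat \<times> nat + nat))" where
    "h x = (if x = c1 then Inl (Inl 0) else if x = c2 then Inr (Inl 0)
       else if side x then Inl (Inr (f x)) else Inr (Inr (Inl (g x))))" for x
  have fX: "f x \<in> {..<s} \<times> {..<k}" if "x \<in> ?X" for x using f(2) that by blast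
  have gY: "g x \<in> {..<t} \<times> {..<k}" if "x \<in> ?Y" for x using g(2) that by blast
  have hX: "h x = Inl (Inr (f x))" if "x \<in> ?X" for x using that by (simp add: h_def)
  have hY: "h x = Inr (Inr (Inl (g x)))" if "x \<in> ?Y" for x using that by (simp add: h_def)
  have hc: "h c1 = Inl (Inl 0)" "h c2 = Inr (Inl 0)" using c by (auto simp: h_def)
  let ?H = "linked_graph k s t"
  have arc12: "(Inl (Inl 0), Inr (Inl 0)) \<in> parcs ?H" by (simp add: linked_graph_def add_edge_def)
  have arc1X: "(Inl (Inl 0), Inl (Inr z)) \<in> parcs ?H" if "z \<in> {..<s} \<times> {..<k}" for z
    using that by (auto simp: linked_graph_def add_edge_def graph_simps)
  have arc2Y: "(Inr (Inl 0), Inr (Inr (Inl z))) \<in> parcs ?H" if "z \<in> {..<t} \<times> {..<k}" for z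
    using that by (auto simp: linked_graph_def add_edge_def graph_simps)
  have arcX: "(Inl (Inr y), Inl (Inr z)) \<in> parcs ?H" if "(y, z) \<in> parcs (copies s (complete_graph k))" for y z
    using that by (simp add: linked_graph_def add_edge_def graph_union_iff graph_join_iff)
  have arcY: "(Inr (Inr (Inl y)), Inr (Inr (Inl z))) \<in> parcs ?H"
    if "(y, z) \<in> parcs (copies t (complete_graph k))" for y z
    using that by (simp add: linked_graph_def add_edge_def graph_union_iff graph_join_iff)
  note symH = pair_graphD'(2)[OF pair_graph_linked_graph]
  have sH: "(v, u) \<in> parcs ?H" if "(u, v) \<in> parcs ?H" for u v using symH[OF that] by blast
  have one: "(h c1, h y) \<in> parcs ?H" if "adj c1 y" for y
  proof (cases "y = c2")
    case True then show ?thesis using hc arc12 by simp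
  next
    case False
    then have "y \<in> ?X" using e1[OF that] adj_V[OF that] adj_neq[OF that] False by auto
    then show ?thesis using hc hX arc1X fX by simp
  qed
  have two: "(h c2, h y) \<in> parcs ?H" if "adj c2 y" for y
  proof (cases "y = c1")
    case True then show ?thesis using hc sH[OF arc12] by simp
  next
    case False
    then have "y \<in> ?Y" using e2[OF that] adj_V[OF that] adj_neq[OF that] False by auto
    then show ?thesis using hc hY arc2Y gY by simp
  qed
  have "is_subgraph_of G ?H"
  proof (rule is_subgraph_ofI[OF G pair_graph_linked_graph])
    have "x = y" if xy: "x \<in> V" "y \<in> V" "h x = h y" for x y
    proof -
      have cs: "z = c1 \<or> z = c2 \<or> z \<in> ?X \<or> z \<in> ?Y" if "z \<in> V" for z using that by blast
      have fi: "f x = f y \<Longrightarrow> x = y" if "x \<in> ?X" "y \<in> ?X" using f(1) that by (meson inj_onD)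
      have gi: "g x = g y \<Longrightarrow> x = y" if "x \<in> ?Y" "y \<in> ?Y" using g(1) that by (meson inj_onD)
      from cs[OF xy(1)] cs[OF xy(2)] show ?thesis
        using xy(3) hc hX hY fi gi by (elim disjE) (simp_all del: mem_Collect_eq)
    qed
    then show "inj_on h V" by (rule inj_onI)
    have cV: "Inl (Inl 0) \<in> pverts ?H" "Inr (Inl 0) \<in> pverts ?H"
      using symH[OF arc12] by blast+
    have "h x \<in> pverts ?H" if x: "x \<in> V" for x
    proof -
      consider "x = c1" | "x = c2" | "x \<in> ?X" | "x \<in> ?Y" using x by blast
      then show ?thesis
      proof cases
        case 3 then show ?thesis using symH[OF arc1X[OF fX[OF 3]]] hX[OF 3] by simp
      next
        case 4 then show ?thesis using symH[OF arc2Y[OF gY[OF 4]]] hY[OF 4] by simp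
      qed (use hc cV in simp_all)
    qed
    then show "h ` V \<subseteq> pverts ?H" by blast
    fix x y assume xy: "adj x y"
    have V: "x \<in> V" "y \<in> V" "x \<noteq> y" using adj_V[OF xy] adj_neq[OF xy] by auto
    have yx: "adj y x" using adj_sym[OF xy] .
    consider "x = c1" | "x = c2" | "y = c1" | "y = c2" | "{x, y} \<inter> {c1, c2} = {}" by blast
    then show "(h x, h y) \<in> parcs ?H"
    proof cases
      case 1 then show ?thesis using one xy by blast
    next
      case 2 then show ?thesis using two xy by blast
    next
      case 3 then show ?thesis using one[of x] yx sH by blast
    next
      case 4 then show ?thesis using two[of x] yx sH by blast
    next
      case 5
      have ll: "l x = l y" "side x = side y" using e[OF xy 5] by auto
      show ?thesis
      proof (cases "side x")
        case True
        then have m: "x \<in> ?X" "y \<in> ?X" using 5 V ll by auto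
        have "(f x, f y) \<in> parcs (copies s (complete_graph k))"
          using arcs_copies_complete[OF f(1,2) m V(3) f(3)[rule_format, OF m ll(1)]] .
        then show ?thesis using arcX hX[OF m(1)] hX[OF m(2)] by simp
      next
        case False
        then have m: "x \<in> ?Y" "y \<in> ?Y" using 5 V ll by auto
        have "(g x, g y) \<in> parcs (copies t (complete_graph k))"
          using arcs_copies_complete[OF g(1,2) m V(3) g(3)[rule_format, OF m ll(1)]] .
        then show ?thesis using arcY hY[OF m(1)] hY[OF m(2)] by simp
      qed
    qed
  qed
  then show ?thesis using s t by blast
qed

text \<open>A vertex together with its only neighbour in \<open>M\<close> forms a class of at most
  two vertices, and disjoint copies of K_2 are a matching.\<close>

lemma matching_embedding:
  assumes M: "M \<subseteq> V" and u: "\<forall>x\<in>M. \<forall>y\<in>M. \<forall>z\<in>M. adj x y \<longrightarrow> adj x z \<longrightarrow> y = z"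
  shows "\<exists>t g. 7 \<le> t \<and> inj_on g M \<and> g ` M \<subseteq> {..<t} \<and>
    (\<forall>x\<in>M. \<forall>y\<in>M. adj x y \<longrightarrow> (g x, g y) \<in> parcs (matching_graph t))"
proof -
  have fin: "finite M" using M finite_V finite_subset by blast
  define l where "l x = insert x (nbrs x \<inter> M)" for x
  have l2: "l x = {x, y}" if "x \<in> M" "y \<in> M" "adj x y" for x y
    using u that unfolding l_def nbrs_def by blast
  have small: "\<forall>x\<in>M. card {y \<in> M. l y = l x} \<le> 2"
  proof
    fix x assume x: "x \<in> M"
    have "\<exists>y. l x \<subseteq> {x, y}"
    proof (cases "nbrs x \<inter> M = {}")
      case True then show ?thesis by (auto simp: l_def)
    next
      case False
      then obtain y where "y \<in> M" "adj x y" unfolding nbrs_def by blast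
      then show ?thesis using l2[OF x] by blast
    qed
    then obtain y where y: "l x \<subseteq> {x, y}" by blast
    have "z \<in> l x" if "l z = l x" for z using that by (auto simp: l_def)
    then have "{z \<in> M. l z = l x} \<subseteq> {x, y}" using y by blast
    then have "card {z \<in> M. l z = l x} \<le> card {x, y}" by (intro card_mono) auto
    also have "\<dots> \<le> 2" by (simp add: card_insert_if)
    finally show "card {y \<in> M. l y = l x} \<le> 2" .
  qed
  obtain t :: nat and g :: "'a \<Rightarrow> nat \<times> nat" where g: "inj_on g M" "g ` M \<subseteq> {..<t} \<times> {..<2}"
    "\<forall>x\<in>M. \<forall>y\<in>M. l x = l y \<longrightarrow> fst (g x) = fst (g y)"
    using class_embedding[OF fin, where l = l and k = 2, OF small] by (elim exE conjE)
  \<comment> \<open>Copy \<open>i\<close> of K_2 goes to \<open>2 * i\<close> and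
    \<open>2 * i + 1\<close>, in accordance with the \<open>div 2\<close> in
    \<open>matching_graph\<close>.\<close>
  define h where "h x = 2 * fst (g x) + snd (g x)" for x
  have rng: "fst (g x) < t" "snd (g x) < 2" if "x \<in> M" for x using g(2) that by (auto simp: image_subset_iff mem_Times_iff)
  have hd: "h x div 2 = fst (g x)" "h x mod 2 = snd (g x)" if "x \<in> M" for x
    using rng[OF that] by (auto simp: h_def)
  have inj: "inj_on h M"
  proof (rule inj_onI)
    fix x y assume xy: "x \<in> M" "y \<in> M" "h x = h y"
    then have "g x = g y" using hd[OF xy(1)] hd[OF xy(2)] by (simp add: prod_eq_iff)
    then show "x = y" using g(1) xy by (meson inj_onD)
  qed
  \<comment> \<open>The added 7 meets the lower bounds 6 and 7 on sizes in case (iv).\<close>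
  have lt: "h x < 2 * t + 7" if "x \<in> M" for x using rng[OF that] by (simp add: h_def)
  have "(h x, h y) \<in> parcs (matching_graph (2 * t + 7))" if xy: "x \<in> M" "y \<in> M" "adj x y" for x y
  proof -
    have "l x = l y" using l2[OF xy] l2[OF xy(2,1) adj_sym[OF xy(3)]] by auto
    then have "h x div 2 = h y div 2" using g(3)[rule_format, OF xy(1,2)] hd[OF xy(1)] hd[OF xy(2)] by simp
    moreover have "h x \<noteq> h y" using inj xy adj_neq[OF xy(3)] by (meson inj_onD)
    ultimately show ?thesis using lt xy by (simp add: matching_graph_def)
  qed
  then show ?thesis using inj lt by (intro exI[of _ "2 * t + 7"] exI[of _ h]) auto
qed

lemma hub_star_subgraph:
  assumes hub_star
  shows "\<exists>s t. s \<ge> 1 \<and> s + t \<ge> 6 \<and> is_subgraph_of G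
    (graph_join (complete_graph 1) (graph_union (star_graph s) (matching_graph t)))"
proof -
  obtain c a M where c: "c \<in> V" "a \<in> V - {c}" "M \<subseteq> V - {c, a}"
    and e': "\<forall>x y. adj x y \<longrightarrow> x \<noteq> c \<longrightarrow> y \<noteq> c \<longrightarrow>
        (x \<in> M \<and> y \<in> M) \<or> (x = a \<and> y \<notin> M) \<or> (y = a \<and> x \<notin> M)"
    and u: "\<forall>x\<in>M. \<forall>y\<in>M. \<forall>z\<in>M. adj x y \<longrightarrow> adj x z \<longrightarrow> y = z"
    using assms unfolding hub_star_def by (elim bexE exE conjE)
  note e = e'[rule_format]
  have MV: "M \<subseteq> V" using c by blast
  obtain t g where t: "7 \<le> t" and g: "inj_on g M" "g ` M \<subseteq> {..<t}"
    "\<forall>x\<in>M. \<forall>y\<in>M. adj x y \<longrightarrow> (g x, g y) \<in> parcs (matching_graph t)"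
    using matching_embedding[OF MV u] by (elim exE conjE)
  let ?L = "V - {c, a} - M"
  \<comment> \<open>One vertex for the centre \<open>a\<close>, the others for the leaves.\<close>
  define s where "s = Suc (card ?L)"
  obtain f where f: "inj_on f ?L" "f ` ?L \<subseteq> {1..<s}"
    using exists_inj_on[of ?L "{1..<s}"] finite_V by (auto simp: s_def)
  define h :: "'a \<Rightarrow> nat + (nat + nat)" where
    "h x = (if x = c then Inl 0 else if x = a then Inr (Inl 0) else if x \<in> M then Inr (Inr (g x)) else Inr (Inl (f x)))" for x
  have fL: "1 \<le> f x" "f x < s" if "x \<in> ?L" for x
  proof -
    have "f x \<in> {1..<s}" using f(2) that by blast
    then show "1 \<le> f x" "f x < s" by auto
  qed
  have gM: "g x < t" if "x \<in> M" for x using g(2) that by blast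
  let ?U = "graph_union (star_graph s) (matching_graph t)"
  let ?H = "graph_join (complete_graph 1) ?U"
  have hL: "h x = Inr (Inl (f x))" if "x \<in> ?L" for x using that by (simp add: h_def)
  have hM: "h x = Inr (Inr (g x))" if "x \<in> M" for x using that c by (auto simp: h_def)
  have hc: "h c = Inl 0" "h a = Inr (Inl 0)" using c by (auto simp: h_def)
  have cs: "x = c \<or> x = a \<or> x \<in> M \<or> x \<in> ?L" if "x \<in> V" for x using that by blast
  have vU: "h x \<in> Inr ` pverts ?U" if x: "x \<in> V" "x \<noteq> c" for x
  proof -
    consider "x = a" | "x \<in> M" | "x \<in> ?L" using cs x by blast
    then show ?thesis
    proof cases
      case 1 then show ?thesis by (simp add: hc graph_union_def star_graph_def s_def)
    next
      case 2 then show ?thesis by (simp add: hM gM graph_union_def matching_graph_def)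
    next
      case 3 then show ?thesis using fL[OF 3] hL[OF 3] by (simp add: graph_union_def star_graph_def)
    qed
  qed
  have vc: "h c \<in> Inl ` pverts (complete_graph 1)" by (simp add: hc complete_graph_def)
  have star: "(h a, h y) \<in> parcs ?H \<and> (h y, h a) \<in> parcs ?H" if y: "y \<in> ?L" for y
    using fL[OF y] hL[OF y] hc by (simp add: graph_simps star_graph_def)
  have "is_subgraph_of G ?H"
  proof (rule is_subgraph_ofI[OF G])
    show "pair_graph ?H"
      by (intro pair_graph_graph_join pair_graph_graph_union pair_graph_complete_graph
          pair_graph_star_graph pair_graph_matching_graph)
    have "x = y" if xy: "x \<in> V" "y \<in> V" "h x = h y" for x y
    proof -
      have fi: "f x = f y \<Longrightarrow> x = y" if "x \<in> ?L" "y \<in> ?L" using f(1) that by (meson inj_onD)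
      have gi: "g x = g y \<Longrightarrow> x = y" if "x \<in> M" "y \<in> M" using g(1) that by (meson inj_onD)
      have f0: "f z \<noteq> 0" if "z \<in> ?L" for z using fL[OF that] by simp
      from cs[OF xy(1)] cs[OF xy(2)] show ?thesis
        using xy(3) hc hL hM fi gi f0[of x] f0[of y] by (elim disjE) (simp_all del: Diff_iff)
    qed
    then show "inj_on h V" by (rule inj_onI)
    have "h x \<in> pverts ?H" if "x \<in> V" for x
    proof (cases "x = c")
      case True then show ?thesis using vc by (auto simp: graph_join_def graph_union_def)
    next
      case False
      then have "h x \<in> Inr ` pverts ?U" using vU that by blast
      then show ?thesis unfolding graph_join_def graph_union_def[of "complete_graph 1"] by auto
    qed
    then show "h ` V \<subseteq> pverts ?H" by blast
    fix x y assume xy: "adj x y"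
    have V: "x \<in> V" "y \<in> V" "x \<noteq> y" using adj_V[OF xy] adj_neq[OF xy] by auto
    consider "x = c" | "y = c" | "x \<in> M" "y \<in> M" | "x = a" "y \<in> ?L" | "y = a" "x \<in> ?L"
      using e[OF xy] V by blast
    then show "(h x, h y) \<in> parcs ?H"
    proof cases
      case 1 then show ?thesis using vc vU[OF V(2)] V by (simp add: graph_join_def)
    next
      case 2 then show ?thesis using vc vU[OF V(1)] V by (simp add: graph_join_def)
    next
      case 3
      then show ?thesis using g(3)[rule_format, OF 3 xy] hM[OF 3(1)] hM[OF 3(2)] by (simp add: graph_simps)
    next
      case 4 then show ?thesis using star by blast
    next
      case 5 then show ?thesis using star by blast
    qed
  qed
  then show ?thesis using t by (intro exI[of _ s] exI[of _ t]) (simp add: s_def)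
qed

lemma two_hubs_subgraph:
  assumes two_hubs
  shows "\<exists>t\<ge>7. is_subgraph_of G (graph_join (complete_graph 2) (matching_graph t))"
proof -
  obtain c d where c: "c \<in> V" "d \<in> V" "c \<noteq> d"
    and u: "\<forall>x y z. adj x y \<longrightarrow> adj x z \<longrightarrow> {x, y, z} \<inter> {c, d} = {} \<longrightarrow> y = z"
    using assms unfolding two_hubs_def by (elim bexE conjE)
  let ?M = "V - {c, d}"
  have MV: "?M \<subseteq> V" by blast
  have "\<forall>x\<in>?M. \<forall>y\<in>?M. \<forall>z\<in>?M. adj x y \<longrightarrow> adj x z \<longrightarrow> y = z" using u by blast
  from matching_embedding[OF MV this] obtain t g where t: "7 \<le> t" and g: "inj_on g ?M" "g ` ?M \<subseteq> {..<t}"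
    "\<forall>x\<in>?M. \<forall>y\<in>?M. adj x y \<longrightarrow> (g x, g y) \<in> parcs (matching_graph t)"
    by (elim exE conjE)
  define h :: "'a \<Rightarrow> nat + nat" where "h x = (if x = c then Inl 0 else if x = d then Inl 1 else Inr (g x))" for x
  have gM: "g x < t" if "x \<in> ?M" for x using g(2) that by blast
  have hM: "h x = Inr (g x)" if "x \<in> ?M" for x using that by (simp add: h_def)
  have hc: "h c = Inl 0" "h d = Inl 1" using c by (auto simp: h_def)
  let ?H = "graph_join (complete_graph 2) (matching_graph t)"
  have cs: "x \<in> {c, d} \<or> x \<in> ?M" if "x \<in> V" for x using that by blast
  have vM: "h x \<in> Inr ` pverts (matching_graph t)" if "x \<in> ?M" for x
    using gM[OF that] hM[OF that] by (simp add: matching_graph_def)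
  have vc: "h x \<in> Inl ` pverts (complete_graph 2)" if "x \<in> {c, d}" for x
    using that hc by (auto simp: complete_graph_def)
  have "is_subgraph_of G ?H"
  proof (rule is_subgraph_ofI[OF G])
    show "pair_graph ?H"
      by (intro pair_graph_graph_join pair_graph_complete_graph pair_graph_matching_graph)
    have "x = y" if xy: "x \<in> V" "y \<in> V" "h x = h y" for x y
    proof -
      have gi: "g x = g y \<Longrightarrow> x = y" if "x \<in> ?M" "y \<in> ?M" using g(1) that by (meson inj_onD)
      have cs': "z = c \<or> z = d \<or> z \<in> ?M" if "z \<in> V" for z using that by blast
      from cs'[OF xy(1)] cs'[OF xy(2)] show ?thesis
        using xy(3) hc hM gi by (elim disjE) (simp_all del: Diff_iff)
    qed
    then show "inj_on h V" by (rule inj_onI)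
    have "h x \<in> pverts ?H" if "x \<in> V" for x
      using cs[OF that] vM[of x] vc[of x] unfolding graph_join_def graph_union_def by auto
    then show "h ` V \<subseteq> pverts ?H" by blast
    fix x y assume xy: "adj x y"
    have V: "x \<in> V" "y \<in> V" "x \<noteq> y" using adj_V[OF xy] adj_neq[OF xy] by auto
    consider "x \<in> {c, d}" "y \<in> ?M" | "y \<in> {c, d}" "x \<in> ?M" | "x \<in> ?M" "y \<in> ?M" | "x \<in> {c, d}" "y \<in> {c, d}"
      using cs V by blast
    then show "(h x, h y) \<in> parcs ?H"
    proof cases
      case 1 then show ?thesis using vM[of y] vc[of x] by (simp add: graph_join_def)
    next
      case 2 then show ?thesis using vM[of x] vc[of y] by (simp add: graph_join_def)
    next
      case 3
      then show ?thesis using g(3)[rule_format, OF 3 xy] hM[OF 3(1)] hM[OF 3(2)] by (simp add: graph_simps)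
    next
      case 4
      then have "(x = c \<and> y = d) \<or> (x = d \<and> y = c)" using V(3) by blast
      moreover have "(Inl 0, Inl 1) \<in> parcs ?H" "(Inl 1, Inl 0) \<in> parcs ?H"
        by (simp_all add: graph_simps)
      ultimately show ?thesis using hc by auto
    qed
  qed
  then show ?thesis using t by blast
qed

end

theorem theorem3p3:
  fixes G :: "'a pair_pre_digraph" and k n :: nat
  assumes "k \<ge> 1"
    and "pair_graph G"
    and "connected (with_proj G)"
    and "card (pverts G) = n"
    and "\<not> contains_path_on G (min n (2 * k + 3))"
    and "card {v \<in> pverts G. \<not> out_degree (with_proj G) v \<ge> k} \<le> 1"
  shows
    "(is_subgraph_of G (H_graph (2 * k + 2) (2 * k + 1) k) \<or>
      (n \<ge> 2 * k + 3 \<and> is_subgraph_of G (H_graph n (2 * k + 2) k)))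
   \<or> (\<exists>t\<ge>1. is_subgraph_of G
        (graph_join (complete_graph 1)
          (graph_union (copies t (complete_graph k))
            (graph_union (complete_graph (k + 1)) (complete_graph 1)))))
   \<or> (\<exists>s\<ge>1. \<exists>t\<ge>1. is_subgraph_of G (linked_graph k s t))
   \<or> (k = 2 \<and>
       ((\<exists>t\<ge>6. is_subgraph_of G (graph_join (complete_graph 1) (matching_graph t))) \<or>
        (\<exists>s t. s \<ge> 1 \<and> s + t \<ge> 6 \<and>
          is_subgraph_of G
            (graph_join (complete_graph 1) (graph_union (star_graph s) (matching_graph t))))))
   \<or> (k = 3 \<and>
       (\<exists>t\<ge>7. is_subgraph_of G (graph_join (complete_graph 2) (matching_graph t))))"
proof -
  interpret pair_simple_graph G using assms(2) by (rule pair_simple_graph.intro)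
  note conn = connected_is_connected[OF assms(3)]
  have "at_most_one_low k"
    unfolding at_most_one_low_def
  proof (intro ballI impI)
    fix x y assume xy: "x \<in> V" "y \<in> V" "card (nbrs x) < k" "card (nbrs y) < k"
    let ?B = "{v \<in> V. \<not> out_degree (with_proj G) v \<ge> k}"
    have fin: "finite ?B" using finite_V by simp
    have "\<forall>a\<in>?B. \<forall>b\<in>?B. a = b" using iffD1[OF card_le_Suc0_iff_eq[OF fin]] assms(6) by simp
    moreover have "x \<in> ?B" "y \<in> ?B" using xy by (simp_all add: out_degree_eq)
    ultimately show "x = y" by blast
  qed
  moreover have "\<nexists>p. is_path p \<and> length p = min (card V) (2 * k + 3)"
    using assms(4,5) by (simp add: contains_path_on_def vpath_is_path)
  ultimately have "(2 * k + 2 \<le> n \<and> covered k) \<or> (2 * k + 3 \<le> n \<and> covered_but_edge k) \<or>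
    block_cut k \<or> linked k \<or> k = 2 \<and> hub_star \<or> k = 3 \<and> two_hubs"
    using no_long_path_structure[OF conn(1) _ assms(1) conn(2)] assms(4) by blast
  moreover have "n = 2 * k + 2 \<or> 2 * k + 3 \<le> n \<and> covered_but_edge k" if "2 * k + 2 \<le> n" "covered k"
    using covered_imp_covered_but_edge[OF that(2)] that(1) assms(4) by (cases "n = 2 * k + 2") simp_all
  ultimately consider "n = 2 * k + 2" "covered k" | "2 * k + 3 \<le> n" "covered_but_edge k"
    | "block_cut k" | "linked k" | "k = 2" hub_star | "k = 3" two_hubs
    by argo
  then show ?thesis
  proof cases
    case 1 then show ?thesis using covered_subgraph assms(4) by blast
  next
    case 2 then show ?thesis using covered_but_edge_subgraph assms(4) by blast
  next
    case 3 then show ?thesis using block_cut_subgraph by blast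
  next
    case 4 then show ?thesis using linked_subgraph by blast
  next
    case 5 then show ?thesis using hub_star_subgraph by blast
  next
    case 6 then show ?thesis using two_hubs_subgraph by blast
  qed
qed

end
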